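(* Let $G$ be a compact LCA group, let $X$ be a Lévy process on $G$ with $L^2$-generator $\mathscr{L}$ satisfying Dalang's condition (D), let $\sigma:\mathbf{R}\to\mathbf{R}$ be Lipschitz continuous, and let $u_0\in L^2(G)$ be nonrandom. For $\lambda>0$ let $u$ be the mild solution of $\partial_t u=\mathscr{L}u+\lambda\sigma(u)\xi$ with initial value $u_0$, and let $\mathscr{E}_t(\lambda)=\sqrt{\mathrm{E}(\|u_t\|_{L^2(G)}^2)}$. If $\sigma\in L^\infty(\mathbf{R})$, then $$\limsup_{\lambda\uparrow\infty}\frac{\mathscr{E}_t(\lambda)}{\lambda}<\infty\qquad\text{for all }t>0.$$ If in addition $\inf_{x\in G}|u_0(x)|>0$ and $\inf_{z\in\mathbf{R}}|\sigma(z)|>0$, then $$\liminf_{\lambda\uparrow\infty}\frac{\mathscr{E}_t(\lambda)}{\lambda}>0\qquad\text{for all }t>0.$$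
   Context: Groups. An LCA group is a locally compact Hausdorff Abelian topological group, written multiplicatively, with identity $e_G$. $G^*$ is its dual (character) group and $(x,\chi):=\chi(x)$. $m_G,m_{G^*}$ are Haar measures, normalized so that the Fourier transform $\hat f(\chi)=\int_G (x,\chi)f(x)\,m_G(dx)$ extends to an isometry $L^2(G)\to L^2(G^* )$, with $m_G(G)=1$ when $G$ is compact. $L^2(G)=L^2(m_G)$. Lévy processes. A Lévy process on $G$ is a $G$-valued process $X=\{X_t\}_{t\ge0}$ with $X_0=e_G$, such that $X_{t+s}X_s^{-1}$ is independent of $\{X_r\}_{r\in[0,s]}$ and has the law of $X_t$ ($s,t\ge 0$), and $t\mapsto X_t$ is a.s. right continuous with left limits. Its characteristic exponent $\Psi:G^*\to\mathbf{C}$ is the continuous function with $\mathrm{E}(X_t,\chi)=e^{-t\Psi(\chi)}$. Its semigroup is $(P_tf)(x)=\mathrm{E}f(xX_t)$, and $\mathscr{L}f=\lim_{t\downarrow0}t^{-1}(P_tf-f)$ in $L^2(G)$, with domain those $f\in L^2(G)$ for which the limit exists. Dalang's condition (D): $\int_{G^*}(\beta+\operatorname{Re}\Psi(\chi))^{-1}m_{G^*}(d\chi)<\infty$ for one, hence all, $\beta>0$. Under (D), $X_t$ ($t>0$) has the continuous transition density $p_t(x)=\int_{G^*}(x^{-1},\chi)e^{-t\Psi(\chi)}m_{G^*}(d\chi)$, so that $(P_tf)(x)=\int_G f(xy)p_t(y)\,m_G(dy)$. Noise. $\xi$ is a space--time white noise on $\mathbf{R}_+\times G$: a centered Gaussian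 random field indexed by Borel subsets of $\mathbf{R}_+\times G$ of finite $(\mathrm{Leb}\times m_G)$-measure, with covariance $\mathrm{Cov}(\xi(E),\xi(F))=(\mathrm{Leb}\times m_G)(E\cap F)$; $\int\cdot\,d\xi$ of nonrandom $L^2$ functions is the Wiener integral. $\mathscr{F}_t$ is the $\sigma$-algebra generated by $\int_{(0,s)\times G}\varphi(y)\,\xi(dr\,dy)$, $s\in[0,t]$, $\varphi\in L^2(G)$, with the filtration completed and made right continuous. Stochastic convolution. A random field is a real-valued process $Z_t(x)(\omega)$ ($t\ge0$, $x\in G$) that is product measurable in $(\omega,t,x)$; $\mathcal{N}_\beta(Z)=\sup_{t\ge0}\{e^{-2\beta t}\mathrm{E}(\|Z_t\|_{L^2(G)}^2)\}^{1/2}$. An elementary random field is $Z_t(x)=Y\mathbf{1}_{[a,b)}(t)\psi(x)$ with $0\le a<b$, $\psi\in C_c(G)$, $Y\in L^2(\mathrm{P})$ $\mathscr{F}_a$-measurable; a simple random field is a finite sum of these. $\mathcal{P}^2_\beta(G)$ is the completion of the simple random fields in the norm $\mathcal{N}_\beta$ (versions being identified). $\mathcal{L}^2_\beta(G)$ is the space of nonrandom measurable $K:(0,\infty)\times G\to\mathbf{R}$ with $\|K\|^2_{\mathcal{L}^2_\beta(G)}=\int_0^\infty e^{-2\beta s}\|K_s\|^2_{L^2(G)}ds<\infty$. For $K\in\mathcal{L}^2_\beta(G)$ and an elementary random field $Z_t(x)=Y\mathbf{1}_{[a,b)}(t)\psi(x)$ with $0\le a<b$, $\psi\in C_c(G)$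 and $Y\in L^2(\mathrm{P})$ $\mathscr{F}_a$-measurable, $(K\circledast Z)_t(x)=Y\int_{(0,t)\times G}\mathbf{1}_{[a,b)}(s)K_{t-s}(yx^{-1})\psi(y)\,\xi(ds\,dy)$; this is extended by linearity to simple $Z$ and then by continuity (using $\mathcal{N}_\beta(K\circledast Z)\le\mathcal{N}_\beta(Z)\|K\|_{\mathcal{L}^2_\beta(G)}$) to all $Z\in\mathcal{P}^2_\beta(G)$, with $K\circledast Z\in\mathcal{P}^2_\beta(G)$. Mild solution. A mild solution with initial value $u_0$ is an $L^2(G)$-valued process $u=\{u_t\}_{t\ge0}$, belonging to $\mathcal{P}^2_\beta(G)$ for some sufficiently large $\beta$, such that $u_t=P_tu_0+\lambda(p\circledast\sigma(u))_t$ a.s. for all $t>0$, as an identity in $L^2(G)$. For compact $G$ and Lipschitz $\sigma$, under (D), a mild solution with $\mathrm{E}(\|u_t\|^2_{L^2(G)})\le c_1e^{c_2t}$ ($t\ge 0$) for some finite $c_1,c_2>0$ exists and is unique up to modification among mild solutions satisfying such a bound; "the mild solution" refers to it. *)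

theory Defs
  imports "HOL-Probability.Probability"
begin

section \<open>Groups, characters and Haar measures\<close>

text \<open>Topological Abelian groups are written additively, following the library class
  \<^class>\<open>topological_ab_group_add\<close>: the product \<open>x y\<close> is \<open>x + y\<close>, the identity is \<open>0\<close>, and
  \<open>x y\<^sup>-\<^sup>1\<close> is \<open>x - y\<close>.\<close>

typedef (overloaded) ('g::topological_ab_group_add) character =
  "{\<gamma>. continuous_on UNIV \<gamma> \<and> (\<forall>x::'g. cmod (\<gamma> x) = 1) \<and> (\<forall>x y. \<gamma> (x + y) = \<gamma> x * \<gamma> y)}"
  morphisms char_eval Abs_character
  by (rule exI[where x = "\<lambda>_. 1"]) auto

setup_lifting type_definition_character

instantiation character :: (topological_ab_group_add) ab_group_add
begin

lift_definition zero_character :: "'a character" is "\<lambda>_. 1"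
  by auto

lift_definition plus_character :: "'a character \<Rightarrow> 'a character \<Rightarrow> 'a character"
  is "\<lambda>\<gamma> \<eta> x. \<gamma> x * \<eta> x"
  by (auto simp: norm_mult intro!: continuous_intros)

lift_definition uminus_character :: "'a character \<Rightarrow> 'a character" is "\<lambda>\<gamma> x. cnj (\<gamma> x)"
  by (auto intro!: continuous_intros)

lift_definition minus_character :: "'a character \<Rightarrow> 'a character \<Rightarrow> 'a character"
  is "\<lambda>\<gamma> \<eta> x. \<gamma> x * cnj (\<eta> x)"
  by (auto simp: norm_mult intro!: continuous_intros)

instance
proof
  fix a b c :: "'a character"
  show "a + b + c = a + (b + c)" by transfer (auto simp: mult.assoc)
  show "a + b = b + a" by transfer (auto simp: mult.commute)
  show "0 + a = a" by transfer auto
  show "- a + a = 0"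
    by transfer (auto simp: fun_eq_iff mult.commute[of "cnj _"] complex_norm_square[symmetric])
  show "a - b = a + - b" by transfer auto
qed

end

text \<open>The dual group carries the compact-open topology.\<close>

instantiation character :: (topological_ab_group_add) topological_space
begin

definition open_character :: "'a character set \<Rightarrow> bool" where
  "open_character = generate_topology
     {{\<gamma>. char_eval \<gamma> ` C \<subseteq> U} | C U. compact C \<and> open U}"

instance
  unfolding open_character_def[abs_def]
proof
  show "open (UNIV :: 'a character set)"
    unfolding open_character_def by (rule generate_topology.UNIV)
  fix S T :: "'a character set"
  show "open S \<Longrightarrow> open T \<Longrightarrow> open (S \<inter> T)"
    unfolding open_character_def by (rule generate_topology.Int)
next
  fix K :: "'a character set set"
  show "\<forall>S\<in>K. open S \<Longrightarrow> open (\<Union>K)"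
    unfolding open_character_def by (blast intro: generate_topology.UN)
qed

end

lemma tendsto_characterI:
  fixes l :: "'g::topological_ab_group_add character"
  assumes "\<And>C U. compact C \<Longrightarrow> open U \<Longrightarrow> char_eval l ` C \<subseteq> U
             \<Longrightarrow> eventually (\<lambda>x. char_eval (f x) ` C \<subseteq> U) F"
  shows "(f \<longlongrightarrow> l) F"
proof (rule topological_tendstoI)
  fix S :: "'g character set"
  assume "open S" "l \<in> S"
  then have "generate_topology {{\<gamma>. char_eval \<gamma> ` C \<subseteq> U} | C U. compact C \<and> open U} S"
    by (simp add: open_character_def)
  then show "eventually (\<lambda>x. f x \<in> S) F" using \<open>l \<in> S\<close>
  proof (induction rule: generate_topology.induct)
    case UNIV
    then show ?case by simp
  next
    case (Int a b)
    then show ?case by (simp add: eventually_conj_iff)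
  next
    case (UN K)
    then obtain k where "k \<in> K" "l \<in> k" by auto
    with UN have "eventually (\<lambda>x. f x \<in> k) F" by auto
    then show ?case by eventually_elim (use \<open>k \<in> K\<close> in auto)
  next
    case (Basis s)
    then obtain C U where CU: "compact C" "open U" and s: "s = {\<gamma>. char_eval \<gamma> ` C \<subseteq> U}"
      by auto
    from Basis s have "char_eval l ` C \<subseteq> U" by simp
    then have "eventually (\<lambda>x. char_eval (f x) ` C \<subseteq> U) F" by (intro assms CU)
    then show ?case by (simp add: s)
  qed
qed

lemma open_character_subbasis:
  fixes C :: "'g::topological_ab_group_add set"
  shows "compact C \<Longrightarrow> open U \<Longrightarrow> open {\<gamma>. char_eval \<gamma> ` C \<subseteq> U}"
  unfolding open_character_def
  by (rule generate_topology.Basis, rule CollectI, rule exI[of _ C], rule exI[of _ U]) simp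

lemma eventually_nhds_character:
  fixes \<gamma> :: "'g::topological_ab_group_add character"
  assumes C: "compact C" and e: "e > 0"
  shows "eventually (\<lambda>\<eta>. \<forall>x\<in>C. cmod (char_eval \<eta> x - char_eval \<gamma> x) < e) (nhds \<gamma>)"
proof -
  define B where "B = (\<lambda>x. {y. dist (char_eval \<gamma> x) (char_eval \<gamma> y) < e / 3})"
  define D where "D = (\<lambda>x. C \<inter> {y. dist (char_eval \<gamma> x) (char_eval \<gamma> y) \<le> e / 3})"
  have cont: "continuous_on UNIV (char_eval \<gamma>)" using char_eval[of \<gamma>] by simp
  have B: "open (B x)" for x
    unfolding B_def by (intro open_Collect_less continuous_intros cont)
  have "closed {y. dist (char_eval \<gamma> x) (char_eval \<gamma> y) \<le> e / 3}" for x
    by (intro closed_Collect_le continuous_intros cont)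
  then have D: "compact (D x)" for x
    unfolding D_def using C by (rule compact_Int_closed[rotated])
  have "C \<subseteq> (\<Union>x\<in>C. B x)" using e by (auto simp: B_def)
  then obtain I where I: "I \<subseteq> C" "finite I" "C \<subseteq> (\<Union>x\<in>I. B x)"
    by (rule compactE_image[OF C B])
  have "eventually (\<lambda>\<eta>. \<eta> \<in> {\<eta>. char_eval \<eta> ` D x \<subseteq> ball (char_eval \<gamma> x) (2 * e / 3)}) (nhds \<gamma>)"
    for x
    using e by (intro eventually_nhds_in_open open_character_subbasis D open_ball) (auto simp: D_def)
  then have "eventually (\<lambda>\<eta>. \<forall>x\<in>I. char_eval \<eta> ` D x \<subseteq> ball (char_eval \<gamma> x) (2 * e / 3)) (nhds \<gamma>)"
    using I(2) by (simp add: eventually_ball_finite)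
  then show ?thesis
  proof eventually_elim
    case (elim \<eta>)
    show ?case
    proof
      fix y assume "y \<in> C"
      with I obtain x where x: "x \<in> I" "y \<in> B x" by auto
      then have "y \<in> D x" using \<open>y \<in> C\<close> by (auto simp: B_def D_def)
      then have 1: "dist (char_eval \<gamma> x) (char_eval \<eta> y) < 2 * e / 3"
        using elim x(1) by (auto simp: image_subset_iff)
      have 2: "dist (char_eval \<gamma> x) (char_eval \<gamma> y) < e / 3" using x(2) by (simp add: B_def)
      have "dist (char_eval \<eta> y) (char_eval \<gamma> y) < 2 * e / 3 + e / 3"
        using 1 2 dist_triangle3[of "char_eval \<eta> y" "char_eval \<gamma> y" "char_eval \<gamma> x"] by linarith
      then show "cmod (char_eval \<eta> y - char_eval \<gamma> y) < e" by (simp add: dist_norm)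
    qed
  qed
qed

instance character :: (topological_ab_group_add) topological_ab_group_add
proof
  fix a b :: "'a character"
  show "((\<lambda>x. fst x + snd x) \<longlongrightarrow> a + b) (nhds a \<times>\<^sub>F nhds b)"
  proof (rule tendsto_characterI)
    fix C :: "'a set" and U :: "complex set"
    assume C: "compact C" and U: "open U" "char_eval (a + b) ` C \<subseteq> U"
    have "continuous_on UNIV (char_eval (a + b))" using char_eval[of "a + b"] by simp
    then have "compact (char_eval (a + b) ` C)"
      by (intro compact_continuous_image C) (auto intro: continuous_on_subset)
    then obtain e where e: "e > 0" "(\<Union>z\<in>char_eval (a + b) ` C. ball z e) \<subseteq> U"
      using U by (rule compact_subset_open_imp_ball_epsilon_subset)
    have "eventually (\<lambda>p. (\<forall>x\<in>C. cmod (char_eval (fst p) x - char_eval a x) < e / 2) \<and>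
        (\<forall>x\<in>C. cmod (char_eval (snd p) x - char_eval b x) < e / 2)) (nhds a \<times>\<^sub>F nhds b)"
      using e(1) by (intro eventually_prodI eventually_nhds_character[OF C]) auto
    then show "eventually (\<lambda>p. char_eval (fst p + snd p) ` C \<subseteq> U) (nhds a \<times>\<^sub>F nhds b)"
    proof eventually_elim
      case (elim p)
      have "char_eval (fst p + snd p) x \<in> ball (char_eval (a + b) x) e" if "x \<in> C" for x
      proof -
        have n: "cmod (char_eval (fst p) x) = 1" "cmod (char_eval b x) = 1"
          using char_eval[of "fst p"] char_eval[of b] by auto
        have "char_eval (a + b) x - char_eval (fst p + snd p) x =
            - (char_eval (fst p) x * (char_eval (snd p) x - char_eval b x)
               + (char_eval (fst p) x - char_eval a x) * char_eval b x)"
          by (simp add: plus_character.rep_eq algebra_simps)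
        then have "cmod (char_eval (a + b) x - char_eval (fst p + snd p) x) =
            cmod (char_eval (fst p) x * (char_eval (snd p) x - char_eval b x)
               + (char_eval (fst p) x - char_eval a x) * char_eval b x)"
          by (simp only: norm_minus_cancel)
        also have "\<dots> \<le> cmod (char_eval (fst p) x * (char_eval (snd p) x - char_eval b x))
               + cmod ((char_eval (fst p) x - char_eval a x) * char_eval b x)"
          by (rule norm_triangle_ineq)
        also have "\<dots> = cmod (char_eval (snd p) x - char_eval b x)
               + cmod (char_eval (fst p) x - char_eval a x)"
          by (simp add: norm_mult n)
        also have "\<dots> < e / 2 + e / 2" using elim that by (intro add_strict_mono) auto
        finally show ?thesis by (simp add: dist_norm)
      qed
      then have "char_eval (fst p + snd p) ` C \<subseteq> (\<Union>z\<in>char_eval (a + b) ` C. ball z e)"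
        by (intro image_subsetI) (rule UN_I, rule imageI)
      then show ?case using e(2) by (rule subset_trans)
    qed
  qed
  show "(uminus \<longlongrightarrow> - a) (nhds a)"
  proof (rule tendsto_characterI)
    fix C :: "'a set" and U :: "complex set"
    assume *: "compact C" "open U" "char_eval (- a) ` C \<subseteq> U"
    have "open (cnj -` U)" using * by (intro open_vimage continuous_intros)
    then have "eventually (\<lambda>\<eta>. \<eta> \<in> {\<eta>. char_eval \<eta> ` C \<subseteq> cnj -` U}) (nhds a)"
      using * by (intro eventually_nhds_in_open open_character_subbasis)
        (auto simp: uminus_character.rep_eq)
    then show "eventually (\<lambda>\<eta>. char_eval (- \<eta>) ` C \<subseteq> U) (nhds a)"
      by eventually_elim (auto simp: uminus_character.rep_eq)
  qed
qed

instance character :: (topological_ab_group_add) t2_space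
proof
  fix a b :: "'a character"
  assume "a \<noteq> b"
  then have "char_eval a \<noteq> char_eval b" by (simp add: char_eval_inject)
  then obtain x where "char_eval a x \<noteq> char_eval b x" by blast
  from hausdorff[OF this] obtain U V where UV: "open U" "open V"
    "char_eval a x \<in> U" "char_eval b x \<in> V" "U \<inter> V = {}"
    by (elim exE conjE)
  show "\<exists>S T. open S \<and> open T \<and> a \<in> S \<and> b \<in> T \<and> S \<inter> T = {}"
  proof (intro exI conjI)
    show "open {\<gamma>. char_eval \<gamma> ` {x} \<subseteq> U}" by (intro open_character_subbasis UV compact_sing)
    show "open {\<gamma>. char_eval \<gamma> ` {x} \<subseteq> V}" by (intro open_character_subbasis UV compact_sing)
    show "a \<in> {\<gamma>. char_eval \<gamma> ` {x} \<subseteq> U}" "b \<in> {\<gamma>. char_eval \<gamma> ` {x} \<subseteq> V}"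
      using UV by simp_all
    show "{\<gamma>. char_eval \<gamma> ` {x} \<subseteq> U} \<inter> {\<gamma>. char_eval \<gamma> ` {x} \<subseteq> V} = {}"
      using UV(5) by auto
  qed
qed

definition haar_measure :: "('g::{topological_ab_group_add, t2_space}) measure \<Rightarrow> bool" where
  "haar_measure m \<longleftrightarrow>
     sets m = sets borel \<and>
     emeasure m UNIV \<noteq> 0 \<and>
     (\<forall>C. compact C \<longrightarrow> emeasure m C < \<infinity>) \<and>
     (\<forall>A\<in>sets m. emeasure m A = (INF U\<in>{U. open U \<and> A \<subseteq> U}. emeasure m U)) \<and>
     (\<forall>U. open U \<longrightarrow>
        emeasure m U = (SUP C\<in>{C. compact C \<and> C \<subseteq> U}. emeasure m C)) \<and>
     (\<forall>a. \<forall>A\<in>sets m. emeasure m ((\<lambda>x. a + x) ` A) = emeasure m A)"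

definition fourier ::
  "('g::topological_ab_group_add) measure \<Rightarrow> ('g \<Rightarrow> complex) \<Rightarrow> 'g character \<Rightarrow> complex" where
  "fourier mG f \<gamma> = (\<integral>x. char_eval \<gamma> x * f x \<partial>mG)"

text \<open>\<open>mD\<close> is the Haar measure on the dual group for which the Fourier transform is isometric on
  \<open>L\<^sup>1 \<inter> L\<^sup>2\<close>, and hence extends to an isometry of \<open>L\<^sup>2\<close>.\<close>

definition dual_haar_measure ::
  "('g::topological_ab_group_add) measure \<Rightarrow> 'g character measure \<Rightarrow> bool" where
  "dual_haar_measure mG mD \<longleftrightarrow>
     haar_measure mD \<and>
     (\<forall>f :: 'g \<Rightarrow> complex. integrable mG f \<longrightarrow> integrable mG (\<lambda>x. (cmod (f x))\<^sup>2) \<longrightarrow>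
        (\<integral>\<^sup>+\<gamma>. ennreal ((cmod (fourier mG f \<gamma>))\<^sup>2) \<partial>mD) = (\<integral>\<^sup>+x. ennreal ((cmod (f x))\<^sup>2) \<partial>mG))"

definition square_integrable :: "'a measure \<Rightarrow> ('a \<Rightarrow> real) \<Rightarrow> bool" where
  "square_integrable m f \<longleftrightarrow> f \<in> borel_measurable m \<and> integrable m (\<lambda>x. (f x)\<^sup>2)"

definition L2_norm_sq :: "'a measure \<Rightarrow> ('a \<Rightarrow> real) \<Rightarrow> ennreal" where
  "L2_norm_sq m f = (\<integral>\<^sup>+x. ennreal ((f x)\<^sup>2) \<partial>m)"

definition esqrt :: "ennreal \<Rightarrow> ennreal" where
  "esqrt a = (if a = \<infinity> then \<infinity> else ennreal (sqrt (enn2real a)))"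

section \<open>Levy processes\<close>

definition levy_process ::
  "'x measure \<Rightarrow> (real \<Rightarrow> 'x \<Rightarrow> 'g::{topological_ab_group_add, t2_space}) \<Rightarrow> bool" where
  "levy_process N X \<longleftrightarrow>
     prob_space N \<and>
     (\<forall>t\<ge>0. X t \<in> measurable N borel) \<and>
     (AE \<omega> in N. X 0 \<omega> = 0) \<and>
     (\<forall>s\<ge>0. \<forall>t\<ge>0.
        prob_space.indep_set N
          (sigma_sets (space N) {(\<lambda>\<omega>. X (t + s) \<omega> - X s \<omega>) -` A \<inter> space N | A. A \<in> sets borel})
          (sigma_sets (space N) {X r -` A \<inter> space N | r A. r \<in> {0..s} \<and> A \<in> sets borel}) \<and>
        distr N borel (\<lambda>\<omega>. X (t + s) \<omega> - X s \<omega>) = distr N borel (X t)) \<and>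
     (AE \<omega> in N. \<forall>t\<ge>0. ((\<lambda>s. X s \<omega>) \<longlongrightarrow> X t \<omega>) (at_right t) \<and>
        (t > 0 \<longrightarrow> (\<exists>l. ((\<lambda>s. X s \<omega>) \<longlongrightarrow> l) (at_left t))))"

definition characteristic_exponent ::
  "'x measure \<Rightarrow> (real \<Rightarrow> 'x \<Rightarrow> 'g::topological_ab_group_add) \<Rightarrow> ('g character \<Rightarrow> complex) \<Rightarrow> bool" where
  "characteristic_exponent N X \<Psi> \<longleftrightarrow>
     continuous_on UNIV \<Psi> \<and>
     (\<forall>t\<ge>0. \<forall>\<gamma>. (\<integral>\<omega>. char_eval \<gamma> (X t \<omega>) \<partial>N) = exp (- (of_real t * \<Psi> \<gamma>)))"

definition levy_semigroup ::
  "'x measure \<Rightarrow> (real \<Rightarrow> 'x \<Rightarrow> 'g::topological_ab_group_add) \<Rightarrow> real \<Rightarrow> ('g \<Rightarrow> real) \<Rightarrow> 'g \<Rightarrow> real" where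
  "levy_semigroup N X t f x = (\<integral>\<omega>. f (x + X t \<omega>) \<partial>N)"

text \<open>The generator is represented by its graph, a relation between square integrable functions.\<close>

definition L2_generator ::
  "'g measure \<Rightarrow> (real \<Rightarrow> ('g \<Rightarrow> real) \<Rightarrow> 'g \<Rightarrow> real) \<Rightarrow> (('g \<Rightarrow> real) \<times> ('g \<Rightarrow> real)) set" where
  "L2_generator mG P = {(f, g). square_integrable mG f \<and> square_integrable mG g \<and>
     ((\<lambda>t. L2_norm_sq mG (\<lambda>x. (P t f x - f x) / t - g x)) \<longlongrightarrow> 0) (at_right 0)}"

definition dalang_condition ::
  "('g::topological_ab_group_add) character measure \<Rightarrow> ('g character \<Rightarrow> complex) \<Rightarrow> bool" where
  "dalang_condition mD \<Psi> \<longleftrightarrow>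
     (\<exists>\<beta>>0. (\<integral>\<^sup>+\<gamma>. ennreal (1 / (\<beta> + Re (\<Psi> \<gamma>))) \<partial>mD) < \<infinity>)"

text \<open>The integral below is real for the exponent of a Levy process (\<open>\<Psi> (- \<gamma>)\<close> is the conjugate of
  \<open>\<Psi> \<gamma>\<close>); taking the real part only changes the type.\<close>

definition transition_density ::
  "('g::topological_ab_group_add) character measure \<Rightarrow> ('g character \<Rightarrow> complex)
     \<Rightarrow> real \<Rightarrow> 'g \<Rightarrow> real" where
  "transition_density mD \<Psi> t x =
     Re (\<integral>\<gamma>. char_eval \<gamma> (- x) * exp (- (of_real t * \<Psi> \<gamma>)) \<partial>mD)"

section \<open>Space-time white noise and the Wiener integral\<close>

definition time_space :: "'g measure \<Rightarrow> (real \<times> 'g) measure" where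
  "time_space mG = restrict_space lborel {0..} \<Otimes>\<^sub>M mG"

definition finite_sets :: "'a measure \<Rightarrow> 'a set set" where
  "finite_sets \<nu> = {E \<in> sets \<nu>. emeasure \<nu> E < \<infinity>}"

text \<open>The first disjunct is the degenerate normal law of variance \<open>0\<close>.\<close>

definition centered_normal_rv :: "'w measure \<Rightarrow> ('w \<Rightarrow> real) \<Rightarrow> bool" where
  "centered_normal_rv M Y \<longleftrightarrow> Y \<in> borel_measurable M \<and>
     ((AE \<omega> in M. Y \<omega> = 0) \<or> (\<exists>s>0. distributed M lborel Y (normal_density 0 s)))"

definition centered_gaussian_field :: "'w measure \<Rightarrow> 'i set \<Rightarrow> ('i \<Rightarrow> 'w \<Rightarrow> real) \<Rightarrow> bool" where
  "centered_gaussian_field M I \<xi> \<longleftrightarrow>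
     (\<forall>J c. finite J \<longrightarrow> J \<subseteq> I \<longrightarrow> centered_normal_rv M (\<lambda>\<omega>. \<Sum>j\<in>J. c j * \<xi> j \<omega>))"

definition white_noise ::
  "'w measure \<Rightarrow> 'g measure \<Rightarrow> ((real \<times> 'g) set \<Rightarrow> 'w \<Rightarrow> real) \<Rightarrow> bool" where
  "white_noise M mG \<xi> \<longleftrightarrow>
     prob_space M \<and>
     centered_gaussian_field M (finite_sets (time_space mG)) \<xi> \<and>
     (\<forall>E\<in>finite_sets (time_space mG). \<forall>F\<in>finite_sets (time_space mG).
        (\<integral>\<omega>. \<xi> E \<omega> * \<xi> F \<omega> \<partial>M) = measure (time_space mG) (E \<inter> F))"

text \<open>\<open>V\<close> is a version of the Wiener integral of \<open>h\<close>: the limit in \<open>L\<^sup>2(P)\<close> of the integrals of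
  step functions that converge to \<open>h\<close> in \<open>L\<^sup>2\<close>.\<close>

definition wiener_integral ::
  "'w measure \<Rightarrow> 'g measure \<Rightarrow> ((real \<times> 'g) set \<Rightarrow> 'w \<Rightarrow> real)
     \<Rightarrow> (real \<times> 'g \<Rightarrow> real) \<Rightarrow> ('w \<Rightarrow> real) \<Rightarrow> bool" where
  "wiener_integral M mG \<xi> h V \<longleftrightarrow>
     square_integrable (time_space mG) h \<and> V \<in> borel_measurable M \<and>
     (\<exists>J c. (\<forall>n::nat. finite (J n) \<and> J n \<subseteq> finite_sets (time_space mG)) \<and>
        (\<lambda>n. L2_norm_sq (time_space mG) (\<lambda>z. (\<Sum>E\<in>J n. c n E * indicator E z) - h z))
          \<longlonglongrightarrow> 0 \<and>
        (\<lambda>n. L2_norm_sq M (\<lambda>\<omega>. (\<Sum>E\<in>J n. c n E * \<xi> E \<omega>) - V \<omega>)) \<longlonglongrightarrow> 0)"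

definition augmented_noise_algebra ::
  "'w measure \<Rightarrow> 'g measure \<Rightarrow> ((real \<times> 'g) set \<Rightarrow> 'w \<Rightarrow> real) \<Rightarrow> real \<Rightarrow> 'w set set" where
  "augmented_noise_algebra M mG \<xi> t = sigma_sets (space M)
     ({V -` B \<inter> space M | V B s \<phi>. s \<in> {0..t} \<and> square_integrable mG \<phi> \<and> B \<in> sets borel \<and>
         wiener_integral M mG \<xi> (\<lambda>(r, y). indicator {0<..<s} r * \<phi> y) V}
      \<union> null_sets M)"

definition noise_filtration ::
  "'w measure \<Rightarrow> 'g measure \<Rightarrow> ((real \<times> 'g) set \<Rightarrow> 'w \<Rightarrow> real) \<Rightarrow> real \<Rightarrow> 'w measure" where
  "noise_filtration M mG \<xi> t = sigma (space M) (\<Inter>r\<in>{t<..}. augmented_noise_algebra M mG \<xi> r)"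

section \<open>Random fields and the stochastic convolution\<close>

definition random_field ::
  "'w measure \<Rightarrow> 'g measure \<Rightarrow> (real \<Rightarrow> 'g \<Rightarrow> 'w \<Rightarrow> real) \<Rightarrow> bool" where
  "random_field M mG Z \<longleftrightarrow>
     (\<lambda>(\<omega>, t, x). Z t x \<omega>) \<in> borel_measurable (M \<Otimes>\<^sub>M restrict_space borel {0..} \<Otimes>\<^sub>M mG)"

definition expected_L2_norm_sq ::
  "'w measure \<Rightarrow> 'g measure \<Rightarrow> (real \<Rightarrow> 'g \<Rightarrow> 'w \<Rightarrow> real) \<Rightarrow> real \<Rightarrow> ennreal" where
  "expected_L2_norm_sq M mG Z t = (\<integral>\<^sup>+\<omega>. L2_norm_sq mG (\<lambda>x. Z t x \<omega>) \<partial>M)"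

definition field_norm ::
  "'w measure \<Rightarrow> 'g measure \<Rightarrow> real \<Rightarrow> (real \<Rightarrow> 'g \<Rightarrow> 'w \<Rightarrow> real) \<Rightarrow> ennreal" where
  "field_norm M mG \<beta> Z =
     (SUP t\<in>{0..}. esqrt (ennreal (exp (- 2 * \<beta> * t)) * expected_L2_norm_sq M mG Z t))"

definition elementary_data ::
  "'w measure \<Rightarrow> ('g::topological_space) measure \<Rightarrow> ((real \<times> 'g) set \<Rightarrow> 'w \<Rightarrow> real)
     \<Rightarrow> ('w \<Rightarrow> real) \<Rightarrow> real \<Rightarrow> real \<Rightarrow> ('g \<Rightarrow> real) \<Rightarrow> bool" where
  "elementary_data M mG \<xi> Y a b \<psi> \<longleftrightarrow>
     0 \<le> a \<and> a < b \<and>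
     continuous_on UNIV \<psi> \<and> compact (closure {x. \<psi> x \<noteq> 0}) \<and>
     Y \<in> borel_measurable (noise_filtration M mG \<xi> a) \<and> square_integrable M Y"

definition elementary_field ::
  "('w \<Rightarrow> real) \<Rightarrow> real \<Rightarrow> real \<Rightarrow> ('g \<Rightarrow> real) \<Rightarrow> real \<Rightarrow> 'g \<Rightarrow> 'w \<Rightarrow> real" where
  "elementary_field Y a b \<psi> t x \<omega> = Y \<omega> * indicator {a..<b} t * \<psi> x"

definition simple_field ::
  "'w measure \<Rightarrow> ('g::topological_space) measure \<Rightarrow> ((real \<times> 'g) set \<Rightarrow> 'w \<Rightarrow> real)
     \<Rightarrow> (real \<Rightarrow> 'g \<Rightarrow> 'w \<Rightarrow> real) \<Rightarrow> bool" where
  "simple_field M mG \<xi> Z \<longleftrightarrow> (\<exists>(n::nat) Y a b \<psi>.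
     (\<forall>i<n. elementary_data M mG \<xi> (Y i) (a i) (b i) (\<psi> i)) \<and>
     Z = (\<lambda>t x \<omega>. \<Sum>i<n. elementary_field (Y i) (a i) (b i) (\<psi> i) t x \<omega>))"

text \<open>The completion of the simple random fields is realised inside the random fields: every
  \<^const>\<open>field_norm\<close>-Cauchy sequence of simple random fields has a product measurable limit, unique up
  to versions.\<close>

definition predictable_fields ::
  "'w measure \<Rightarrow> ('g::topological_space) measure \<Rightarrow> ((real \<times> 'g) set \<Rightarrow> 'w \<Rightarrow> real) \<Rightarrow> real
     \<Rightarrow> (real \<Rightarrow> 'g \<Rightarrow> 'w \<Rightarrow> real) set" where
  "predictable_fields M mG \<xi> \<beta> = {Z. random_field M mG Z \<and>
     (\<exists>S. (\<forall>n::nat. simple_field M mG \<xi> (S n)) \<and>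
        (\<lambda>n. field_norm M mG \<beta> (\<lambda>t x \<omega>. S n t x \<omega> - Z t x \<omega>)) \<longlonglongrightarrow> 0)}"

definition kernel_space :: "'g measure \<Rightarrow> real \<Rightarrow> (real \<Rightarrow> 'g \<Rightarrow> real) set" where
  "kernel_space mG \<beta> = {K.
     (\<lambda>(s, x). K s x) \<in> borel_measurable (restrict_space borel {0<..} \<Otimes>\<^sub>M mG) \<and>
     (\<integral>\<^sup>+s\<in>{0<..}. ennreal (exp (- 2 * \<beta> * s)) * L2_norm_sq mG (K s) \<partial>lborel) < \<infinity>}"

text \<open>\<open>W\<close> is a product measurable version of the convolution of \<open>K\<close> with the elementary random field
  given by \<open>Y\<close>, \<open>a\<close>, \<open>b\<close>, \<open>\<psi>\<close>.\<close>

definition elementary_convolution ::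
  "'w measure \<Rightarrow> ('g::topological_ab_group_add) measure \<Rightarrow> ((real \<times> 'g) set \<Rightarrow> 'w \<Rightarrow> real)
     \<Rightarrow> (real \<Rightarrow> 'g \<Rightarrow> real) \<Rightarrow> ('w \<Rightarrow> real) \<Rightarrow> real \<Rightarrow> real \<Rightarrow> ('g \<Rightarrow> real)
     \<Rightarrow> (real \<Rightarrow> 'g \<Rightarrow> 'w \<Rightarrow> real) \<Rightarrow> bool" where
  "elementary_convolution M mG \<xi> K Y a b \<psi> W \<longleftrightarrow>
     random_field M mG W \<and>
     (\<forall>t\<ge>0. \<forall>x. \<exists>V.
        wiener_integral M mG \<xi>
          (\<lambda>(s, y). indicator {0<..<t} s * indicator {a..<b} s * K (t - s) (y - x) * \<psi> y) V \<and>
        (AE \<omega> in M. W t x \<omega> = Y \<omega> * V \<omega>))"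

definition simple_convolution ::
  "'w measure \<Rightarrow> ('g::topological_ab_group_add) measure \<Rightarrow> ((real \<times> 'g) set \<Rightarrow> 'w \<Rightarrow> real)
     \<Rightarrow> (real \<Rightarrow> 'g \<Rightarrow> real) \<Rightarrow> (real \<Rightarrow> 'g \<Rightarrow> 'w \<Rightarrow> real) \<Rightarrow> (real \<Rightarrow> 'g \<Rightarrow> 'w \<Rightarrow> real) \<Rightarrow> bool" where
  "simple_convolution M mG \<xi> K Z W \<longleftrightarrow> (\<exists>(n::nat) Y a b \<psi> V.
     (\<forall>i<n. elementary_data M mG \<xi> (Y i) (a i) (b i) (\<psi> i) \<and>
        elementary_convolution M mG \<xi> K (Y i) (a i) (b i) (\<psi> i) (V i)) \<and>
     Z = (\<lambda>t x \<omega>. \<Sum>i<n. elementary_field (Y i) (a i) (b i) (\<psi> i) t x \<omega>) \<and>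
     W = (\<lambda>t x \<omega>. \<Sum>i<n. V i t x \<omega>))"

text \<open>\<open>W\<close> is a version of the stochastic convolution of \<open>K\<close> and \<open>Z\<close>, i.e. of the continuous
  extension of the convolution with simple random fields.\<close>

definition stochastic_convolution ::
  "'w measure \<Rightarrow> ('g::topological_ab_group_add) measure \<Rightarrow> ((real \<times> 'g) set \<Rightarrow> 'w \<Rightarrow> real) \<Rightarrow> real
     \<Rightarrow> (real \<Rightarrow> 'g \<Rightarrow> real) \<Rightarrow> (real \<Rightarrow> 'g \<Rightarrow> 'w \<Rightarrow> real) \<Rightarrow> (real \<Rightarrow> 'g \<Rightarrow> 'w \<Rightarrow> real) \<Rightarrow> bool" where
  "stochastic_convolution M mG \<xi> \<beta> K Z W \<longleftrightarrow>
     K \<in> kernel_space mG \<beta> \<and> Z \<in> predictable_fields M mG \<xi> \<beta> \<and> random_field M mG W \<and>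
     (\<exists>S T. (\<forall>n::nat. simple_convolution M mG \<xi> K (S n) (T n)) \<and>
        (\<lambda>n. field_norm M mG \<beta> (\<lambda>t x \<omega>. S n t x \<omega> - Z t x \<omega>)) \<longlonglongrightarrow> 0 \<and>
        (\<lambda>n. field_norm M mG \<beta> (\<lambda>t x \<omega>. T n t x \<omega> - W t x \<omega>)) \<longlonglongrightarrow> 0)"

text \<open>\<open>P\<close> is the semigroup and \<open>p\<close> its density. The spaces \<^const>\<open>predictable_fields\<close> and the
  convolution are increasing in \<open>\<beta>\<close>, so a single \<open>\<beta>\<close> serves for \<open>u\<close> and for \<open>\<sigma>(u)\<close>. Almost sure
  equality in \<open>L\<^sup>2\<close> is equality almost everywhere; elements of \<^const>\<open>predictable_fields\<close> are almost
  surely square integrable in \<open>x\<close> at each time.\<close>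

definition mild_solution ::
  "'w measure \<Rightarrow> ('g::topological_ab_group_add) measure \<Rightarrow> ((real \<times> 'g) set \<Rightarrow> 'w \<Rightarrow> real)
     \<Rightarrow> (real \<Rightarrow> ('g \<Rightarrow> real) \<Rightarrow> 'g \<Rightarrow> real) \<Rightarrow> (real \<Rightarrow> 'g \<Rightarrow> real)
     \<Rightarrow> (real \<Rightarrow> real) \<Rightarrow> real \<Rightarrow> ('g \<Rightarrow> real) \<Rightarrow> (real \<Rightarrow> 'g \<Rightarrow> 'w \<Rightarrow> real) \<Rightarrow> bool" where
  "mild_solution M mG \<xi> P p \<sigma> l u0 u \<longleftrightarrow>
     (AE \<omega> in M. AE x in mG. u 0 x \<omega> = u0 x) \<and>
     (\<exists>\<beta>>0. u \<in> predictable_fields M mG \<xi> \<beta> \<and>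
       (\<exists>W. stochastic_convolution M mG \<xi> \<beta> p (\<lambda>t x \<omega>. \<sigma> (u t x \<omega>)) W \<and>
         (\<forall>t>0. AE \<omega> in M. AE x in mG. u t x \<omega> = P t u0 x + l * W t x \<omega>)))"

definition exponentially_bounded_field ::
  "'w measure \<Rightarrow> 'g measure \<Rightarrow> (real \<Rightarrow> 'g \<Rightarrow> 'w \<Rightarrow> real) \<Rightarrow> bool" where
  "exponentially_bounded_field M mG u \<longleftrightarrow>
     (\<exists>c1>0. \<exists>c2>0. \<forall>t\<ge>0. expected_L2_norm_sq M mG u t \<le> ennreal (c1 * exp (c2 * t)))"

definition energy ::
  "'w measure \<Rightarrow> 'g measure \<Rightarrow> (real \<Rightarrow> 'g \<Rightarrow> 'w \<Rightarrow> real) \<Rightarrow> real \<Rightarrow> ennreal" where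
  "energy M mG u t = esqrt (expected_L2_norm_sq M mG u t)"

end

theory Submission
  imports Defs
begin

text \<open>Write the mild solution at level \<open>\<lambda>\<close> as \<open>u\<^sub>t = P\<^sub>t u\<^sub>0 + \<lambda> W\<^sub>t\<close>, where \<open>W\<close> is the stochastic
  convolution of the transition density \<open>p\<close> with \<open>\<sigma>(u)\<close>. The first summand is deterministic, lies in
  \<open>L\<^sup>2\<close> and is the same for all \<open>\<lambda>\<close>, so both claims follow once \<open>E \<parallel>W\<^sub>t\<parallel>\<^sup>2\<close> is bounded above and away
  from \<open>0\<close> uniformly in \<open>\<lambda>\<close>. Those bounds come from the Ito-Walsh isometry
  \<open>E \<parallel>(K \<circledast> Z)\<^sub>t\<parallel>\<^sup>2 = \<integral>\<^sub>0\<^sup>t \<parallel>K\<^sub>t\<^sub>-\<^sub>s\<parallel>\<^sup>2 E \<parallel>Z\<^sub>s\<parallel>\<^sup>2 ds\<close>: the group has mass \<open>1\<close>, so if \<open>c \<le> \<bar>\<sigma>\<bar> \<le> C\<close> then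
  \<open>E \<parallel>\<sigma>(u\<^sub>s)\<parallel>\<^sup>2\<close> lies between \<open>c\<^sup>2\<close> and \<open>C\<^sup>2\<close> whatever \<open>u\<close> is, and what remains is the constant
  \<open>\<integral>\<^sub>0\<^sup>t \<parallel>p\<^sub>s\<parallel>\<^sup>2 ds\<close>. It is finite because \<open>p\<close> belongs to a kernel space, and at least \<open>t\<close> because
  \<open>p\<^sub>s\<close> has integral \<open>1\<close>. The inequality \<open>(x + y)\<^sup>2 \<le> 2 x\<^sup>2 + 2 y\<^sup>2\<close> replaces the triangle inequality
  throughout, since only finiteness and positivity of the limits are at stake; for the same reason the
  isometry is carried over from simple fields to general ones only up to a factor \<open>4\<close>
  (\<open>stochastic_convolution_energy\<close>).

  For simple fields the isometry reduces to \<open>E[Y V Y' V'] = E[Y Y'] \<langle>h, h'\<rangle>\<close>, where \<open>V\<close>, \<open>V'\<close> are Wiener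
  integrals of \<open>h\<close>, \<open>h'\<close> over times after those at which \<open>Y\<close>, \<open>Y'\<close> are known, and hence to the
  independence of the noise after time \<open>a\<close> from the past up to \<open>a\<close> (\<open>past_indep_future\<close>). Every Wiener
  integral of \<open>h\<close> has characteristic function \<open>exp (- \<parallel>h\<parallel>\<^sup>2 / 2)\<close>, so \<open>E exp (i (X + V))\<close> factorises when \<open>X\<close>
  and \<open>V\<close> live on disjoint sets of times. To reach events that depend on many past integrals at once, a
  uniqueness theorem for joint characteristic functions is derived from the one-dimensional theorem of
  Levy by using the nonnegative weights \<open>1 + cos X\<close> and \<open>1 + sin X\<close> (\<open>char_agree_generated\<close>).

  Integrating the isometry over the group uses Tonelli's theorem for \<open>p\<^sub>s(y - x)\<close>, while subtraction
  need not be measurable for the product of the Borel algebras. Here Dalang's condition helps: the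
  Plancherel identity and translation invariance give every character mass \<open>1\<close>, so the condition is a convergent series and the
  dual group is countable; then \<open>p\<^sub>s(y - x)\<close> is an integral over a countable set of products of functions
  of \<open>s\<close>, \<open>y\<close> and \<open>x\<close> alone.\<close>

section \<open>Square integrable functions\<close>

lemma square_integrable_iff_L2_norm_sq:
  "square_integrable m f \<longleftrightarrow> f \<in> borel_measurable m \<and> L2_norm_sq m f < \<infinity>"
  unfolding square_integrable_def L2_norm_sq_def by (auto simp: integrable_iff_bounded)

lemma L2_norm_sq_eq_integral:
  "square_integrable m f \<Longrightarrow> L2_norm_sq m f = ennreal (\<integral>x. (f x)\<^sup>2 \<partial>m)"
  unfolding square_integrable_def L2_norm_sq_def by (subst nn_integral_eq_integral) auto

lemma square_integrable_measurable [measurable_dest]: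
  "square_integrable m f \<Longrightarrow> f \<in> borel_measurable m"
  by (simp add: square_integrable_def)

lemma L2_norm_sq_add_le:
  assumes [measurable]: "f \<in> borel_measurable m" "g \<in> borel_measurable m"
  shows "L2_norm_sq m (\<lambda>x. f x + g x) \<le> 2 * L2_norm_sq m f + 2 * L2_norm_sq m g"
proof -
  have "L2_norm_sq m (\<lambda>x. f x + g x)
      \<le> (\<integral>\<^sup>+x. 2 * ennreal ((f x)\<^sup>2) + 2 * ennreal ((g x)\<^sup>2) \<partial>m)"
    unfolding L2_norm_sq_def
  proof (rule nn_integral_mono)
    fix x
    have "(f x + g x)\<^sup>2 \<le> 2 * (f x)\<^sup>2 + 2 * (g x)\<^sup>2"
      using zero_le_power2[of "f x - g x"] by (simp add: power2_eq_square algebra_simps)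
    then have "ennreal ((f x + g x)\<^sup>2) \<le> ennreal (2 * (f x)\<^sup>2 + 2 * (g x)\<^sup>2)" by (rule ennreal_leI)
    then show "ennreal ((f x + g x)\<^sup>2) \<le> 2 * ennreal ((f x)\<^sup>2) + 2 * ennreal ((g x)\<^sup>2)"
      by (simp add: ennreal_plus ennreal_mult)
  qed
  also have "\<dots> = 2 * L2_norm_sq m f + 2 * L2_norm_sq m g"
    unfolding L2_norm_sq_def by (subst nn_integral_add) (auto simp: nn_integral_cmult)
  finally show ?thesis .
qed

lemma L2_norm_sq_cmult:
  assumes [measurable]: "f \<in> borel_measurable m"
  shows "L2_norm_sq m (\<lambda>x. c * f x) = ennreal (c\<^sup>2) * L2_norm_sq m f"
  unfolding L2_norm_sq_def by (subst nn_integral_cmult[symmetric]) (auto simp: power_mult_distrib ennreal_mult)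

lemma L2_norm_sq_triangle:
  assumes [measurable]: "f \<in> borel_measurable m" "g \<in> borel_measurable m"
  shows "L2_norm_sq m g \<le> 2 * L2_norm_sq m (\<lambda>x. f x - g x) + 2 * L2_norm_sq m f"
    and "L2_norm_sq m f \<le> 2 * L2_norm_sq m (\<lambda>x. f x - g x) + 2 * L2_norm_sq m g"
proof -
  have "L2_norm_sq m (\<lambda>x. - 1 * (f x - g x)) = L2_norm_sq m (\<lambda>x. f x - g x)"
    by (subst L2_norm_sq_cmult) auto
  then show "L2_norm_sq m g \<le> 2 * L2_norm_sq m (\<lambda>x. f x - g x) + 2 * L2_norm_sq m f"
    using L2_norm_sq_add_le[of "\<lambda>x. - 1 * (f x - g x)" m f] by simp
  show "L2_norm_sq m f \<le> 2 * L2_norm_sq m (\<lambda>x. f x - g x) + 2 * L2_norm_sq m g"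
    using L2_norm_sq_add_le[of "\<lambda>x. f x - g x" m g] by simp
qed

lemma L2_norm_sq_mono:
  "(\<And>x. x \<in> space m \<Longrightarrow> \<bar>f x\<bar> \<le> \<bar>g x\<bar>) \<Longrightarrow> L2_norm_sq m f \<le> L2_norm_sq m g"
  unfolding L2_norm_sq_def by (intro nn_integral_mono ennreal_leI) (simp add: abs_le_square_iff)

lemma square_integrable_add:
  assumes f: "square_integrable m f" and g: "square_integrable m g"
  shows "square_integrable m (\<lambda>x. f x + g x)"
proof -
  have "2 * L2_norm_sq m f + 2 * L2_norm_sq m g < \<infinity>"
    using assms by (auto simp: square_integrable_iff_L2_norm_sq ennreal_mult_less_top)
  then show ?thesis
    using assms L2_norm_sq_add_le[of f m g]
    by (auto simp: square_integrable_iff_L2_norm_sq intro: order.strict_trans1)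
qed

lemma square_integrable_cmult:
  "square_integrable m f \<Longrightarrow> square_integrable m (\<lambda>x. c * f x)"
  by (auto simp: square_integrable_iff_L2_norm_sq L2_norm_sq_cmult ennreal_mult_less_top)

lemma square_integrable_diff:
  "square_integrable m f \<Longrightarrow> square_integrable m g \<Longrightarrow> square_integrable m (\<lambda>x. f x - g x)"
  using square_integrable_add[of m f "\<lambda>x. - 1 * g x"] square_integrable_cmult[of m g "- 1"] by simp

lemma square_integrable_sum:
  "(\<And>i. i \<in> I \<Longrightarrow> square_integrable m (f i)) \<Longrightarrow> square_integrable m (\<lambda>x. \<Sum>i\<in>I. f i x)"
proof (induction I rule: infinite_finite_induct)
  case (insert i I)
  then show ?case using square_integrable_add[of m "f i" "\<lambda>x. \<Sum>i\<in>I. f i x"] by simp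
qed (auto simp: square_integrable_def)

lemma square_integrable_bounded_by:
  assumes "square_integrable m g" "f \<in> borel_measurable m" "\<And>x. x \<in> space m \<Longrightarrow> \<bar>f x\<bar> \<le> \<bar>g x\<bar>"
  shows "square_integrable m f"
  using assms L2_norm_sq_mono[of m f g] by (auto simp: square_integrable_iff_L2_norm_sq)

lemma square_integrable_mult:
  assumes f: "square_integrable m f" and g: "square_integrable m g"
  shows "integrable m (\<lambda>x. f x * g x)"
proof (rule Bochner_Integration.integrable_bound)
  show "integrable m (\<lambda>x. (f x)\<^sup>2 + (g x)\<^sup>2)" using f g by (auto simp: square_integrable_def)
  show "(\<lambda>x. f x * g x) \<in> borel_measurable m" using f g by measurable
  have "\<bar>f x\<bar> * \<bar>g x\<bar> \<le> (f x)\<^sup>2 + (g x)\<^sup>2" for x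
  proof -
    have "2 * (\<bar>f x\<bar> * \<bar>g x\<bar>) \<le> (f x)\<^sup>2 + (g x)\<^sup>2"
      using zero_le_power2[of "\<bar>f x\<bar> - \<bar>g x\<bar>"] by (simp add: power2_diff)
    moreover have "0 \<le> \<bar>f x\<bar> * \<bar>g x\<bar>" by simp
    ultimately show ?thesis by linarith
  qed
  then show "AE x in m. norm (f x * g x) \<le> norm ((f x)\<^sup>2 + (g x)\<^sup>2)"
    by (auto simp: abs_mult)
qed

lemma Cauchy_Schwarz_integral:
  assumes f: "square_integrable m f" and g: "square_integrable m g"
  shows "\<bar>\<integral>x. f x * g x \<partial>m\<bar> \<le> sqrt (\<integral>x. (f x)\<^sup>2 \<partial>m) * sqrt (\<integral>x. (g x)\<^sup>2 \<partial>m)"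
proof -
  note [measurable] = square_integrable_measurable[OF f] square_integrable_measurable[OF g]
  have i: "integrable m (\<lambda>x. f x * g x)" by (rule square_integrable_mult[OF f g])
  have "(\<integral>\<^sup>+x. ennreal \<bar>f x\<bar> * ennreal \<bar>g x\<bar> \<partial>m)\<^sup>2
      \<le> (\<integral>\<^sup>+x. ennreal \<bar>f x\<bar> ^ 2 \<partial>m) * (\<integral>\<^sup>+x. ennreal \<bar>g x\<bar> ^ 2 \<partial>m)"
    by (rule Cauchy_Schwarz_nn_integral) measurable
  also have "(\<integral>\<^sup>+x. ennreal \<bar>f x\<bar> ^ 2 \<partial>m) = ennreal (\<integral>x. (f x)\<^sup>2 \<partial>m)"
    using L2_norm_sq_eq_integral[OF f] by (simp add: L2_norm_sq_def ennreal_power)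
  also have "(\<integral>\<^sup>+x. ennreal \<bar>g x\<bar> ^ 2 \<partial>m) = ennreal (\<integral>x. (g x)\<^sup>2 \<partial>m)"
    using L2_norm_sq_eq_integral[OF g] by (simp add: L2_norm_sq_def ennreal_power)
  also have "(\<integral>\<^sup>+x. ennreal \<bar>f x\<bar> * ennreal \<bar>g x\<bar> \<partial>m) = ennreal (\<integral>x. \<bar>f x * g x\<bar> \<partial>m)"
    using integrable_abs[OF i] by (subst nn_integral_eq_integral[symmetric]) (auto simp: abs_mult ennreal_mult)
  finally have "(\<integral>x. \<bar>f x * g x\<bar> \<partial>m)\<^sup>2 \<le> (\<integral>x. (f x)\<^sup>2 \<partial>m) * (\<integral>x. (g x)\<^sup>2 \<partial>m)"
    by (simp add: ennreal_power ennreal_mult[symmetric] integral_nonneg_AE)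
  then have "sqrt ((\<integral>x. \<bar>f x * g x\<bar> \<partial>m)\<^sup>2) \<le> sqrt ((\<integral>x. (f x)\<^sup>2 \<partial>m) * (\<integral>x. (g x)\<^sup>2 \<partial>m))"
    by (rule real_sqrt_le_mono)
  then have "(\<integral>x. \<bar>f x * g x\<bar> \<partial>m) \<le> sqrt (\<integral>x. (f x)\<^sup>2 \<partial>m) * sqrt (\<integral>x. (g x)\<^sup>2 \<partial>m)"
    by (simp add: real_sqrt_mult)
  then show ?thesis using integral_abs_bound[of m "\<lambda>x. f x * g x"] by linarith
qed

lemma (in prob_space) integral_abs_le_L2:
  assumes f: "square_integrable M f"
  shows "(\<integral>x. \<bar>f x\<bar> \<partial>M) \<le> sqrt (\<integral>x. (f x)\<^sup>2 \<partial>M)"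
proof -
  have "square_integrable M (\<lambda>x. \<bar>f x\<bar>)" using f by (auto simp: square_integrable_def)
  moreover have "square_integrable M (\<lambda>x. 1)" by (auto simp: square_integrable_def)
  ultimately have "\<bar>\<integral>x. \<bar>f x\<bar> * 1 \<partial>M\<bar> \<le> sqrt (\<integral>x. \<bar>f x\<bar>\<^sup>2 \<partial>M) * sqrt (\<integral>x. 1\<^sup>2 \<partial>M)"
    by (rule Cauchy_Schwarz_integral)
  then show ?thesis by (simp add: prob_space)
qed

definition L2_tendsto :: "'a measure \<Rightarrow> (nat \<Rightarrow> 'a \<Rightarrow> real) \<Rightarrow> ('a \<Rightarrow> real) \<Rightarrow> bool" where
  "L2_tendsto m f g \<longleftrightarrow> (\<lambda>n. L2_norm_sq m (\<lambda>x. f n x - g x)) \<longlonglongrightarrow> 0"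

lemma square_integrable_L2_tendsto:
  assumes f: "\<And>n. square_integrable m (f n)" and g: "g \<in> borel_measurable m"
    and lim: "L2_tendsto m f g"
  shows "square_integrable m g"
proof -
  have "eventually (\<lambda>n. L2_norm_sq m (\<lambda>x. f n x - g x) < 1) sequentially"
    using lim unfolding L2_tendsto_def by (rule order_tendstoD) simp
  then obtain n where "L2_norm_sq m (\<lambda>x. f n x - g x) < 1" by (auto simp: eventually_sequentially)
  then have "square_integrable m (\<lambda>x. f n x - g x)"
    using f[of n] g by (auto simp: square_integrable_iff_L2_norm_sq intro: order.strict_trans)
  from square_integrable_diff[OF f[of n] this] show ?thesis by simp
qed

lemma L2_tendsto_integral:
  assumes f: "\<And>n. square_integrable m (f n)" and g: "square_integrable m g"
  shows "L2_tendsto m f g \<longleftrightarrow> (\<lambda>n. \<integral>x. (f n x - g x)\<^sup>2 \<partial>m) \<longlonglongrightarrow> 0"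
  unfolding L2_tendsto_def
  using L2_norm_sq_eq_integral[OF square_integrable_diff[OF f g]]
    tendsto_ennreal_iff[of "\<lambda>n. \<integral>x. (f n x - g x)\<^sup>2 \<partial>m" sequentially 0]
  by simp

text \<open>Expand \<open>f\<^sub>n g\<^sub>n - f' g'\<close> into three products, each with a factor tending to \<open>0\<close>, and apply
  Cauchy-Schwarz. With \<open>g = f\<close> it carries variances to limits, with \<open>g = 1\<close> expectations.\<close>

lemma L2_tendsto_inner:
  assumes f: "\<And>n. square_integrable m (f n)" "square_integrable m f'" "L2_tendsto m f f'"
    and g: "\<And>n. square_integrable m (g n)" "square_integrable m g'" "L2_tendsto m g g'"
  shows "(\<lambda>n. \<integral>x. f n x * g n x \<partial>m) \<longlonglongrightarrow> (\<integral>x. f' x * g' x \<partial>m)"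
proof -
  define a where "a n = sqrt (\<integral>x. (f n x - f' x)\<^sup>2 \<partial>m)" for n
  define b where "b n = sqrt (\<integral>x. (g n x - g' x)\<^sup>2 \<partial>m)" for n
  define A where "A = sqrt (\<integral>x. (f' x)\<^sup>2 \<partial>m)"
  define B where "B = sqrt (\<integral>x. (g' x)\<^sup>2 \<partial>m)"
  have a: "a \<longlonglongrightarrow> 0" using f tendsto_real_sqrt[of _ 0] unfolding a_def by (simp add: L2_tendsto_integral)
  have b: "b \<longlonglongrightarrow> 0" using g tendsto_real_sqrt[of _ 0] unfolding b_def by (simp add: L2_tendsto_integral)
  have "\<bar>(\<integral>x. f n x * g n x \<partial>m) - (\<integral>x. f' x * g' x \<partial>m)\<bar> \<le> a n * b n + A * b n + a n * B" for n
  proof -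
    note i = square_integrable_mult
    have df: "square_integrable m (\<lambda>x. f n x - f' x)" and dg: "square_integrable m (\<lambda>x. g n x - g' x)"
      using f g by (auto intro: square_integrable_diff)
    have eq: "f n x * g n x - f' x * g' x = (f n x - f' x) * (g n x - g' x) + f' x * (g n x - g' x)
          + (f n x - f' x) * g' x" for x by (simp add: algebra_simps)
    have "(\<integral>x. f n x * g n x \<partial>m) - (\<integral>x. f' x * g' x \<partial>m)
      = (\<integral>x. (f n x - f' x) * (g n x - g' x) + f' x * (g n x - g' x) + (f n x - f' x) * g' x \<partial>m)"
      using i[OF f(1)[of n] g(1)[of n]] i[OF f(2) g(2)]
      by (subst Bochner_Integration.integral_diff[symmetric]) (auto simp: eq)
    also have "\<dots> = (\<integral>x. (f n x - f' x) * (g n x - g' x) \<partial>m) + (\<integral>x. f' x * (g n x - g' x) \<partial>m)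
        + (\<integral>x. (f n x - f' x) * g' x \<partial>m)"
      using i[OF df dg] i[OF f(2) dg] i[OF df g(2)] by simp
    finally show ?thesis
      using Cauchy_Schwarz_integral[OF df dg] Cauchy_Schwarz_integral[OF f(2) dg]
        Cauchy_Schwarz_integral[OF df g(2)]
      unfolding a_def b_def A_def B_def by linarith
  qed
  moreover have "(\<lambda>n. a n * b n + A * b n + a n * B) \<longlonglongrightarrow> 0 * 0 + A * 0 + 0 * B"
    by (intro tendsto_intros a b)
  ultimately have "(\<lambda>n. a n * b n + A * b n + a n * B) \<longlonglongrightarrow> 0"
    and "\<forall>n. norm ((\<integral>x. f n x * g n x \<partial>m) - (\<integral>x. f' x * g' x \<partial>m)) \<le> a n * b n + A * b n + a n * B"
    by simp_all
  then have "(\<lambda>n. (\<integral>x. f n x * g n x \<partial>m) - (\<integral>x. f' x * g' x \<partial>m)) \<longlonglongrightarrow> 0"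
    by (rule Lim_null_comparison[rotated, OF _ always_eventually])
  then show ?thesis by (rule LIM_zero_cancel)
qed

lemma L2_tendsto_add:
  assumes f: "\<And>n. f n \<in> borel_measurable m" "f' \<in> borel_measurable m" "L2_tendsto m f f'"
    and g: "\<And>n. g n \<in> borel_measurable m" "g' \<in> borel_measurable m" "L2_tendsto m g g'"
  shows "L2_tendsto m (\<lambda>n x. f n x + g n x) (\<lambda>x. f' x + g' x)"
  unfolding L2_tendsto_def
proof (rule tendsto_sandwich[OF _ _ tendsto_const])
  have "L2_norm_sq m (\<lambda>x. f n x + g n x - (f' x + g' x))
      \<le> 2 * L2_norm_sq m (\<lambda>x. f n x - f' x) + 2 * L2_norm_sq m (\<lambda>x. g n x - g' x)" for n
    using L2_norm_sq_add_le[of "\<lambda>x. f n x - f' x" m "\<lambda>x. g n x - g' x"] f g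
    by (simp add: algebra_simps)
  then show "\<forall>\<^sub>F n in sequentially. L2_norm_sq m (\<lambda>x. f n x + g n x - (f' x + g' x))
      \<le> 2 * L2_norm_sq m (\<lambda>x. f n x - f' x) + 2 * L2_norm_sq m (\<lambda>x. g n x - g' x)" by simp
  have "(\<lambda>n. 2 * L2_norm_sq m (\<lambda>x. f n x - f' x) + 2 * L2_norm_sq m (\<lambda>x. g n x - g' x))
      \<longlonglongrightarrow> 2 * 0 + 2 * 0"
    using f(3) g(3) unfolding L2_tendsto_def
    by (intro tendsto_add ennreal_tendsto_cmult) auto
  then show "(\<lambda>n. 2 * L2_norm_sq m (\<lambda>x. f n x - f' x) + 2 * L2_norm_sq m (\<lambda>x. g n x - g' x))
      \<longlonglongrightarrow> 0" by simp
qed simp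

lemma L2_tendsto_cmult:
  assumes f: "\<And>n. f n \<in> borel_measurable m" "f' \<in> borel_measurable m" "L2_tendsto m f f'"
  shows "L2_tendsto m (\<lambda>n x. c * f n x) (\<lambda>x. c * f' x)"
proof -
  have "(\<lambda>n. ennreal (c\<^sup>2) * L2_norm_sq m (\<lambda>x. f n x - f' x)) \<longlonglongrightarrow> ennreal (c\<^sup>2) * 0"
    using f(3) unfolding L2_tendsto_def by (intro ennreal_tendsto_cmult) auto
  then show ?thesis
    using f L2_norm_sq_cmult[of "\<lambda>x. f _ x - f' x" m c] unfolding L2_tendsto_def
    by (simp add: right_diff_distrib)
qed

lemma L2_tendsto_mono:
  assumes "L2_tendsto m f f'" "\<And>n x. x \<in> space m \<Longrightarrow> \<bar>g n x - g' x\<bar> \<le> \<bar>f n x - f' x\<bar>"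
  shows "L2_tendsto m g g'"
  using assms(1) unfolding L2_tendsto_def
  by (rule tendsto_sandwich[OF _ _ tendsto_const, rotated 2])
    (auto intro!: always_eventually L2_norm_sq_mono assms(2))

lemma ennreal_tendsto_zeroI:
  fixes f :: "'a \<Rightarrow> ennreal"
  assumes "\<And>e::real. e > 0 \<Longrightarrow> eventually (\<lambda>x. f x \<le> ennreal e) F"
  shows "(f \<longlongrightarrow> 0) F"
proof (rule order_tendstoI)
  fix a :: ennreal assume "0 < a"
  then obtain e :: real where e: "0 < e" "ennreal e < a"
    by (metis dense ennreal_cases ennreal_less_zero_iff top.not_eq_extremum not_less_iff_gr_or_eq)
  show "eventually (\<lambda>x. f x < a) F" using assms[OF e(1)] by eventually_elim (use e(2) in auto)
qed simp

text \<open>Riesz-Fischer: an \<open>L\<^sup>2\<close>-Cauchy sequence is \<open>L\<^sup>1\<close>-Cauchy, so some subsequence converges almost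
  everywhere, and Fatou's lemma turns the Cauchy bounds into bounds on the distance to its limit.\<close>

lemma (in prob_space) L2_complete:
  assumes f: "\<And>n. square_integrable M (f n)"
    and Cauchy: "\<And>e. e > 0 \<Longrightarrow> \<exists>N. \<forall>n\<ge>N. \<forall>k\<ge>N. (\<integral>x. (f n x - f k x)\<^sup>2 \<partial>M) < e"
  shows "\<exists>g. square_integrable M g \<and> L2_tendsto M f g"
proof -
  have [measurable]: "f n \<in> borel_measurable M" for n using f by measurable
  have d: "square_integrable M (\<lambda>x. f n x - f k x)" for n k using f by (auto intro: square_integrable_diff)
  have "\<exists>r. strict_mono r \<and> (AE x in M. Cauchy (\<lambda>i. f (r i) x))"
  proof -
    have "\<exists>N. \<forall>i\<ge>N. \<forall>j\<ge>N. (\<integral>x. norm (f i x - f j x) \<partial>M) < e" if e: "e > 0" for e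
    proof -
      obtain N where N: "\<And>n k. n \<ge> N \<Longrightarrow> k \<ge> N \<Longrightarrow> (\<integral>x. (f n x - f k x)\<^sup>2 \<partial>M) < e\<^sup>2"
        using Cauchy[of "e\<^sup>2"] e by auto
      have "(\<integral>x. norm (f n x - f k x) \<partial>M) < e" if "n \<ge> N" "k \<ge> N" for n k
      proof -
        have "sqrt (\<integral>x. (f n x - f k x)\<^sup>2 \<partial>M) < sqrt (e\<^sup>2)" using N[OF that] by (rule real_sqrt_less_mono)
        with integral_abs_le_L2[OF d[of n k]] e show ?thesis by simp
      qed
      then show ?thesis by blast
    qed
    moreover have "integrable M (f n)" for n
      using f[of n] by (auto simp: square_integrable_def intro: square_integrable_imp_integrable[of "f n"])
    ultimately obtain r where "strict_mono r" "AE x in M. Cauchy (\<lambda>i. f (r i) x)"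
      using cauchy_L1_AE_cauchy_subseq[of M f] by metis
    then show ?thesis by blast
  qed
  then obtain r where r: "strict_mono r" and C: "AE x in M. Cauchy (\<lambda>i. f (r i) x)" by blast
  define g where "g x = lim (\<lambda>i. f (r i) x)" for x
  have [measurable]: "g \<in> borel_measurable M" unfolding g_def by measurable
  have lim: "AE x in M. (\<lambda>i. f (r i) x) \<longlonglongrightarrow> g x"
    using C by eventually_elim (simp add: g_def Cauchy_convergent convergent_LIMSEQ_iff[symmetric])
  have bound: "L2_norm_sq M (\<lambda>x. f n x - g x) \<le> ennreal e"
    if N: "\<forall>n\<ge>N. \<forall>k\<ge>N. (\<integral>x. (f n x - f k x)\<^sup>2 \<partial>M) < e" and n: "n \<ge> N" for N n e
  proof -
    have "L2_norm_sq M (\<lambda>x. f n x - g x)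
        = (\<integral>\<^sup>+x. liminf (\<lambda>i. ennreal ((f n x - f (r i) x)\<^sup>2)) \<partial>M)"
      unfolding L2_norm_sq_def
    proof (rule nn_integral_cong_AE)
      show "AE x in M. ennreal ((f n x - g x)\<^sup>2) = liminf (\<lambda>i. ennreal ((f n x - f (r i) x)\<^sup>2))"
        using lim
      proof eventually_elim
        case (elim x)
        have "(\<lambda>i. ennreal ((f n x - f (r i) x)\<^sup>2)) \<longlonglongrightarrow> ennreal ((f n x - g x)\<^sup>2)"
          by (intro tendsto_ennrealI tendsto_intros elim)
        from lim_imp_Liminf[OF _ this] show ?case by simp
      qed
    qed
    also have "\<dots> \<le> liminf (\<lambda>i. \<integral>\<^sup>+x. ennreal ((f n x - f (r i) x)\<^sup>2) \<partial>M)"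
      by (rule nn_integral_liminf) measurable
    also have "\<dots> \<le> ennreal e"
    proof (rule Liminf_le)
      show "\<forall>\<^sub>F i in sequentially. (\<integral>\<^sup>+x. ennreal ((f n x - f (r i) x)\<^sup>2) \<partial>M) \<le> ennreal e"
        using eventually_ge_at_top[of N]
      proof eventually_elim
        case (elim i)
        then have "r i \<ge> N" using seq_suble[OF r, of i] by linarith
        then have "(\<integral>x. (f n x - f (r i) x)\<^sup>2 \<partial>M) < e" using N n by blast
        then show ?case
          using L2_norm_sq_eq_integral[OF d[of n "r i"]] unfolding L2_norm_sq_def
          by (simp add: ennreal_leI)
      qed
    qed simp
    finally show ?thesis .
  qed
  have "L2_tendsto M f g"
    unfolding L2_tendsto_def
  proof (rule ennreal_tendsto_zeroI)
    fix e :: real assume "e > 0"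
    then obtain N where "\<forall>n\<ge>N. \<forall>k\<ge>N. (\<integral>x. (f n x - f k x)\<^sup>2 \<partial>M) < e" using Cauchy by blast
    from bound[OF this] show "\<forall>\<^sub>F n in sequentially. L2_norm_sq M (\<lambda>x. f n x - g x) \<le> ennreal e"
      by (auto simp: eventually_sequentially)
  qed
  with square_integrable_L2_tendsto[of M f g] f show ?thesis by (intro exI[of _ g]) auto
qed


section \<open>Characteristic functions determine measures on generated sigma-algebras\<close>

lemma (in prob_space) integrable_bounded_mult_iexp:
  assumes [measurable]: "w \<in> borel_measurable M" "X \<in> borel_measurable M" and "\<And>x. \<bar>w x\<bar> \<le> C"
  shows "integrable M (\<lambda>x. complex_of_real (w x) * iexp (X x))"
  by (rule integrable_const_bound[where B = C]) (auto simp: norm_mult assms(3))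

text \<open>Divided by their common mass, the images under \<open>V\<close> of the measures with densities \<open>w1\<close> and \<open>w2\<close> are
  probability measures with the same characteristic function, so Levy's theorem identifies them. Allowing
  two weights instead of two measures is what makes the step below from one to several variables
  possible.\<close>

lemma (in prob_space) weights_agree_on_preimage:
  fixes w1 w2 V :: "'a \<Rightarrow> real"
  assumes [measurable]: "w1 \<in> borel_measurable M" "w2 \<in> borel_measurable M" "V \<in> borel_measurable M"
    and bnd: "\<And>x. 0 \<le> w1 x" "\<And>x. 0 \<le> w2 x" "\<And>x. w1 x \<le> C" "\<And>x. w2 x \<le> C"
    and eq: "\<And>v. (\<integral>x. complex_of_real (w1 x) * iexp (v * V x) \<partial>M)
                = (\<integral>x. complex_of_real (w2 x) * iexp (v * V x) \<partial>M)"
    and B: "B \<in> sets borel"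
  shows "(\<integral>x. w1 x * indicator B (V x) \<partial>M) = (\<integral>x. w2 x * indicator B (V x) \<partial>M)"
proof -
  have int: "integrable M w1" "integrable M w2"
    using bnd by (auto intro!: integrable_const_bound[where B = C])
  have int': "integrable M (\<lambda>x. w1 x * indicator B (V x))" "integrable M (\<lambda>x. w2 x * indicator B (V x))"
    using B integrable_mult_indicator[OF measurable_sets[OF assms(3) B] int(1)]
      integrable_mult_indicator[OF measurable_sets[OF assms(3) B] int(2)]
    by (auto simp: indicator_def mult.commute cong: Bochner_Integration.integrable_cong
        elim!: Bochner_Integration.integrable_cong[THEN iffD1, rotated -1])
  define c where "c = (\<integral>x. w1 x \<partial>M)"
  have "complex_of_real (\<integral>x. w1 x \<partial>M) = complex_of_real (\<integral>x. w2 x \<partial>M)"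
    using eq[of 0] by simp
  then have c2: "(\<integral>x. w2 x \<partial>M) = c" by (simp add: c_def)
  show ?thesis
  proof (cases "c = 0")
    case True
    then have "AE x in M. w1 x = 0" "AE x in M. w2 x = 0"
      using c2 int bnd integral_nonneg_eq_0_iff_AE[of M w1] integral_nonneg_eq_0_iff_AE[of M w2]
      by (simp_all add: c_def)
    then have "AE x in M. w1 x * indicator B (V x) = 0" "AE x in M. w2 x * indicator B (V x) = 0"
      by (auto elim: eventually_mono)
    then show ?thesis using int' by (simp cong: integral_cong_AE add: integral_eq_zero_AE)
  next
    case False
    have "c \<ge> 0" unfolding c_def using bnd by (simp add: integral_nonneg_AE)
    with False have c: "c > 0" by simp
    define N where "N w = distr (density M (\<lambda>x. ennreal (w x / c))) borel V" for w
    have N: "real_distribution (N w) \<and>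
        (\<forall>t. char (N w) t = (\<integral>x. complex_of_real (w x) * iexp (t * V x) \<partial>M) / c) \<and>
        measure (N w) B = (\<integral>x. w x * indicator B (V x) \<partial>M) / c"
      if [measurable]: "w \<in> borel_measurable M" and w: "\<And>x. 0 \<le> w x" "integrable M w" "(\<integral>x. w x \<partial>M) = c" for w
    proof (intro conjI allI)
      have "emeasure (density M (\<lambda>x. ennreal (w x / c))) (space M) = (\<integral>\<^sup>+x. ennreal (w x / c) \<partial>M)"
        by (subst emeasure_density) (auto intro!: nn_integral_cong)
      also have "\<dots> = 1"
        using c w by (subst nn_integral_eq_integral) auto
      finally interpret D: prob_space "density M (\<lambda>x. ennreal (w x / c))"
        by (intro prob_spaceI) simp
      show "real_distribution (N w)" unfolding N_def by (rule D.real_distribution_distr) simp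
      show "char (N w) t = (\<integral>x. complex_of_real (w x) * iexp (t * V x) \<partial>M) / c" for t
        unfolding N_def char_def using c w
        by (subst integral_distr; (subst integral_density)?) (auto simp: scaleR_conv_of_real)
      have "measure (N w) B = (\<integral>x. indicator B x \<partial>N w)" using B by (simp add: N_def)
      also have "\<dots> = (\<integral>x. w x * indicator B (V x) \<partial>M) / c"
        unfolding N_def using c w B
        by (subst integral_distr; (subst integral_density)?) auto
      finally show "measure (N w) B = (\<integral>x. w x * indicator B (V x) \<partial>M) / c" .
    qed
    note N1 = N[OF assms(1) bnd(1) int(1) c_def[symmetric]] and N2 = N[OF assms(2) bnd(2) int(2) c2]
    have "char (N w1) = char (N w2)" using N1 N2 eq by (intro ext) auto
    then have "N w1 = N w2" using N1 N2 by (intro Levy_uniqueness) auto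
    then show ?thesis using N1 N2 c by auto
  qed
qed

lemma one_plus_cos_mult_iexp:
  "complex_of_real (a * (1 + cos s)) * iexp v
      = of_real a * iexp v + (of_real a * iexp (v + s) + of_real a * iexp (v - s)) / 2"
  by (simp add: complex_eq_iff Re_exp Im_exp cos_add cos_diff sin_add sin_diff algebra_simps)

lemma one_plus_sin_mult_iexp:
  "complex_of_real (a * (1 + sin s)) * iexp v
      = of_real a * iexp v + (of_real a * iexp (v + s) - of_real a * iexp (v - s)) * (- \<i> / 2)"
  by (simp add: complex_eq_iff Re_exp Im_exp cos_add cos_diff sin_add sin_diff) (simp add: field_simps)

text \<open>The measures with densities \<open>w1\<close> and \<open>w2\<close> have the same joint characteristic function on \<open>L\<close>: for a
  linear space \<open>L\<close>, the values at \<open>X \<in> L\<close> include those at all linear combinations.\<close>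

definition char_agree :: "'a measure \<Rightarrow> ('a \<Rightarrow> real) set \<Rightarrow> ('a \<Rightarrow> real) \<Rightarrow> ('a \<Rightarrow> real) \<Rightarrow> bool" where
  "char_agree M L w1 w2 \<longleftrightarrow>
     w1 \<in> borel_measurable M \<and> w2 \<in> borel_measurable M \<and>
     (\<exists>C. \<forall>x. 0 \<le> w1 x \<and> w1 x \<le> C \<and> 0 \<le> w2 x \<and> w2 x \<le> C) \<and>
     (\<forall>X\<in>L. (\<integral>x. complex_of_real (w1 x) * iexp (X x) \<partial>M) = (\<integral>x. complex_of_real (w2 x) * iexp (X x) \<partial>M))"

locale linear_rv_family = prob_space M for M :: "'a measure" +
  fixes L :: "('a \<Rightarrow> real) set"
  assumes measurable_L: "X \<in> L \<Longrightarrow> X \<in> borel_measurable M"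
    and zero_L: "(\<lambda>_. 0) \<in> L"
    and lincomb_L: "X \<in> L \<Longrightarrow> Y \<in> L \<Longrightarrow> (\<lambda>\<omega>. a * X \<omega> + b * Y \<omega>) \<in> L"
begin

abbreviation weighted_char where
  "weighted_char w X \<equiv> \<integral>x. complex_of_real (w x) * iexp (X x) \<partial>M"

definition generated :: "'a set set" where
  "generated = sigma_sets (space M) {X -` B \<inter> space M | X B. X \<in> L \<and> B \<in> sets borel}"

lemma generated_subset: "generated \<subseteq> sets M"
  unfolding generated_def by (rule sets.sigma_sets_subset) (auto intro: measurable_sets[OF measurable_L])

lemma integrable_weight:
  "char_agree M L w1 w2 \<Longrightarrow> X \<in> borel_measurable M \<Longrightarrow> integrable M (\<lambda>x. complex_of_real (w1 x) * iexp (X x))"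
  "char_agree M L w1 w2 \<Longrightarrow> X \<in> borel_measurable M \<Longrightarrow> integrable M (\<lambda>x. complex_of_real (w2 x) * iexp (X x))"
  unfolding char_agree_def by (auto intro!: integrable_bounded_mult_iexp)

text \<open>The weight \<open>1 + cos X\<close> only shifts the argument of the characteristic function by \<open>\<plusminus> X\<close>, hence stays
  within the linear space; likewise for the sine.\<close>

lemma char_agree_cos_sin:
  assumes agree: "char_agree M L w1 w2" and X: "X \<in> L" and V: "V \<in> L"
  shows "weighted_char (\<lambda>x. w1 x * (1 + cos (X x))) V
       = weighted_char (\<lambda>x. w2 x * (1 + cos (X x))) V"
    and "weighted_char (\<lambda>x. w1 x * (1 + sin (X x))) V
       = weighted_char (\<lambda>x. w2 x * (1 + sin (X x))) V"
proof -
  note [measurable] = measurable_L[OF X] measurable_L[OF V]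
  have P: "(\<lambda>x. V x + X x) \<in> L" and N: "(\<lambda>x. V x - X x) \<in> L"
    using lincomb_L[OF V X, of 1 1] lincomb_L[OF V X, of 1 "- 1"] by simp_all
  have I: "integrable M (\<lambda>x. complex_of_real (w x) * iexp (V x))"
    "integrable M (\<lambda>x. complex_of_real (w x) * iexp (V x + X x))"
    "integrable M (\<lambda>x. complex_of_real (w x) * iexp (V x - X x))" if "w \<in> {w1, w2}" for w
    using that integrable_weight[OF agree measurable_L[OF V]] integrable_weight[OF agree measurable_L[OF P]]
      integrable_weight[OF agree measurable_L[OF N]] by (auto simp del: of_real_add of_real_diff)
  have C: "weighted_char (\<lambda>x. w x * (1 + cos (X x))) V
      = weighted_char w V + (weighted_char w (\<lambda>x. V x + X x) + weighted_char w (\<lambda>x. V x - X x)) / 2" if "w \<in> {w1, w2}" for w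
    unfolding one_plus_cos_mult_iexp using I[OF that] by (simp del: of_real_add of_real_diff)
  have S: "weighted_char (\<lambda>x. w x * (1 + sin (X x))) V
      = weighted_char w V + (weighted_char w (\<lambda>x. V x + X x) - weighted_char w (\<lambda>x. V x - X x)) * (- \<i> / 2)" if "w \<in> {w1, w2}" for w
    unfolding one_plus_sin_mult_iexp using I[OF that] by (simp del: of_real_add of_real_diff)
  have "weighted_char w1 Z = weighted_char w2 Z" if "Z \<in> L" for Z
    using agree that unfolding char_agree_def by blast
  from this[OF V] this[OF P] this[OF N] show
    "weighted_char (\<lambda>x. w1 x * (1 + cos (X x))) V
       = weighted_char (\<lambda>x. w2 x * (1 + cos (X x))) V"
    "weighted_char (\<lambda>x. w1 x * (1 + sin (X x))) V
       = weighted_char (\<lambda>x. w2 x * (1 + sin (X x))) V"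
    by (simp_all only: C S insertI1 insertI2)
qed

lemma char_agree_indicatorI:
  assumes agree: "char_agree M L w1 w2" and [measurable]: "A \<in> sets M"
    and eq: "\<And>X. X \<in> L \<Longrightarrow> weighted_char (\<lambda>x. w1 x * indicator A x) X
                = weighted_char (\<lambda>x. w2 x * indicator A x) X"
  shows "char_agree M L (\<lambda>x. w1 x * indicator A x) (\<lambda>x. w2 x * indicator A x)"
proof -
  from agree obtain C where [measurable]: "w1 \<in> borel_measurable M" "w2 \<in> borel_measurable M"
    and C: "\<And>x. 0 \<le> w1 x \<and> w1 x \<le> C \<and> 0 \<le> w2 x \<and> w2 x \<le> C"
    unfolding char_agree_def by blast
  have "0 \<le> w1 x * indicator A x \<and> w1 x * indicator A x \<le> C
      \<and> 0 \<le> w2 x * indicator A x \<and> w2 x * indicator A x \<le> C" for x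
    using C[of x] by (auto simp: indicator_def)
  then show ?thesis
    unfolding char_agree_def
    by (intro conjI ballI eq exI[of _ C] allI) (auto, measurable)
qed

text \<open>This is the passage to several variables. For fixed \<open>X\<close> the weights \<open>w (1 + cos X)\<close> and
  \<open>w (1 + sin X)\<close> are nonnegative, so the one-dimensional theorem applies to \<open>V\<close> under them; subtracting
  the case \<open>X = 0\<close> leaves the real and imaginary parts of \<open>E[w 1\<^sub>B(V) exp (i X)]\<close>.\<close>

lemma char_agree_preimage:
  assumes agree: "char_agree M L w1 w2" and V: "V \<in> L" and B: "B \<in> sets borel"
  shows "char_agree M L (\<lambda>x. w1 x * indicator B (V x)) (\<lambda>x. w2 x * indicator B (V x))"
proof -
  note [measurable] = measurable_L[OF V] B
  from agree obtain C where [measurable]: "w1 \<in> borel_measurable M" "w2 \<in> borel_measurable M"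
    and C: "\<And>x. 0 \<le> w1 x" "\<And>x. w1 x \<le> C" "\<And>x. 0 \<le> w2 x" "\<And>x. w2 x \<le> C"
    unfolding char_agree_def by blast
  have C0: "0 \<le> C" using C order_trans by blast
  have eq: "(\<integral>x. (w1 x * (1 + f (X x))) * indicator B (V x) \<partial>M)
      = (\<integral>x. (w2 x * (1 + f (X x))) * indicator B (V x) \<partial>M)"
    if X: "X \<in> L" and f: "f = cos \<or> f = sin" for X f
  proof (rule weights_agree_on_preimage[where C = "C * 2"])
    have [measurable]: "X \<in> borel_measurable M" by (rule measurable_L[OF X])
    have [measurable]: "f \<in> borel_measurable borel" using f by auto
    show "(\<lambda>x. w1 x * (1 + f (X x))) \<in> borel_measurable M" "(\<lambda>x. w2 x * (1 + f (X x))) \<in> borel_measurable M"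
      "V \<in> borel_measurable M" "B \<in> sets borel" by measurable
    have f1: "\<bar>f s\<bar> \<le> 1" for s using f by auto
    then have f1: "- 1 \<le> f s" "f s \<le> 1" for s by (simp_all add: abs_le_iff minus_le_iff)
    then show "0 \<le> w1 x * (1 + f (X x))" "0 \<le> w2 x * (1 + f (X x))" for x
      using C[of x] f1(1)[of "X x"] by (intro mult_nonneg_nonneg; linarith)+
    show "w1 x * (1 + f (X x)) \<le> C * 2" "w2 x * (1 + f (X x)) \<le> C * 2" for x
      using C[of x] C0 f1[of "X x"] by (auto intro!: mult_mono)
    show "(\<integral>x. complex_of_real (w1 x * (1 + f (X x))) * iexp (v * V x) \<partial>M)
        = (\<integral>x. complex_of_real (w2 x * (1 + f (X x))) * iexp (v * V x) \<partial>M)" for v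
      using char_agree_cos_sin[OF agree X, of "\<lambda>x. v * V x"] lincomb_L[OF V zero_L, of v 0] f by auto
  qed
  have int: "integrable M (\<lambda>x. w x * f x)"
    if [measurable]: "f \<in> borel_measurable M" and "w \<in> {w1, w2}" "\<And>x. \<bar>f x\<bar> \<le> 1" for f w
  proof (rule integrable_const_bound[where B = C])
    have "\<bar>w x\<bar> * \<bar>f x\<bar> \<le> C * 1" for x
      using that C[of x] C0 by (intro mult_mono) auto
    then show "AE x in M. norm (w x * f x) \<le> C" by (simp add: abs_mult)
  qed (use that in auto)
  \<comment> \<open>At \<open>X = 0\<close> the cosine weight is the constant \<open>2\<close>.\<close>
  have z: "(\<integral>x. w1 x * indicator B (V x) \<partial>M) = (\<integral>x. w2 x * indicator B (V x) \<partial>M)"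
    using eq[OF zero_L, of cos] by (simp add: mult.commute[of _ 2] mult.assoc)
  have "(\<integral>x. w1 x * (indicator B (V x) * f (X x)) \<partial>M) = (\<integral>x. w2 x * (indicator B (V x) * f (X x)) \<partial>M)"
    if X: "X \<in> L" and f: "f = cos \<or> f = sin" for X f
  proof -
    have [measurable]: "X \<in> borel_measurable M" by (rule measurable_L[OF X])
    have [measurable]: "f \<in> borel_measurable borel" using f by auto
    have f1: "\<bar>f s\<bar> \<le> 1" for s using f by auto
    have "(\<integral>x. (w x * (1 + f (X x))) * indicator B (V x) \<partial>M)
        = (\<integral>x. w x * indicator B (V x) \<partial>M) + (\<integral>x. w x * (indicator B (V x) * f (X x)) \<partial>M)" if w: "w \<in> {w1, w2}" for w
      using f1 by (subst Bochner_Integration.integral_add[symmetric])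
        (auto intro!: int w Bochner_Integration.integral_cong simp: indicator_def algebra_simps)
    then show ?thesis using eq[OF X f] z by simp
  qed
  note cs = this[of _ cos, simplified] this[of _ sin, simplified]
  have "weighted_char (\<lambda>x. w1 x * indicator B (V x)) X
      = weighted_char (\<lambda>x. w2 x * indicator B (V x)) X" if X: "X \<in> L" for X
  proof -
    have [measurable]: "X \<in> borel_measurable M" by (rule measurable_L[OF X])
    have "weighted_char (\<lambda>x. w x * indicator B (V x)) X
        = complex_of_real (\<integral>x. w x * (indicator B (V x) * cos (X x)) \<partial>M)
          + \<i> * complex_of_real (\<integral>x. w x * (indicator B (V x) * sin (X x)) \<partial>M)" if w: "w \<in> {w1, w2}" for w
    proof -
      have "weighted_char (\<lambda>x. w x * indicator B (V x)) X
        = (\<integral>x. complex_of_real (w x * (indicator B (V x) * cos (X x)))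
            + \<i> * complex_of_real (w x * (indicator B (V x) * sin (X x))) \<partial>M)"
        by (intro Bochner_Integration.integral_cong refl)
          (simp add: cis_conv_exp[symmetric] complex_eq_iff)
      also have "\<dots> = (\<integral>x. complex_of_real (w x * (indicator B (V x) * cos (X x))) \<partial>M)
            + (\<integral>x. \<i> * complex_of_real (w x * (indicator B (V x) * sin (X x))) \<partial>M)"
        by (intro Bochner_Integration.integral_add integrable_mult_right integrable_of_real int w)
          (auto simp: indicator_def)
      finally show ?thesis by (simp only: integral_mult_right_zero integral_complex_of_real)
    qed
    then show ?thesis using cs[OF X] by simp
  qed
  moreover have "w1 x * indicator B (V x) \<le> C" "w2 x * indicator B (V x) \<le> C" for x
    using C[of x] C0 by (auto simp: indicator_def)
  ultimately show ?thesis using C unfolding char_agree_def by (auto intro!: exI[of _ C])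
qed

lemma char_agree_compl:
  assumes agree: "char_agree M L w1 w2" and A[measurable]: "A \<in> sets M"
    and agreeA: "char_agree M L (\<lambda>x. w1 x * indicator A x) (\<lambda>x. w2 x * indicator A x)"
  shows "char_agree M L (\<lambda>x. w1 x * indicator (space M - A) x) (\<lambda>x. w2 x * indicator (space M - A) x)"
proof (rule char_agree_indicatorI[OF agree])
  fix X assume X: "X \<in> L"
  have "weighted_char (\<lambda>x. w x * indicator (space M - A) x) X = weighted_char w X - weighted_char (\<lambda>x. w x * indicator A x) X"
    if w: "w \<in> {w1, w2}" for w
    using integrable_weight[OF agree measurable_L[OF X]] integrable_weight[OF agreeA measurable_L[OF X]] w
    by (subst Bochner_Integration.integral_diff[symmetric])
      (auto intro!: Bochner_Integration.integral_cong simp: indicator_def)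
  moreover have "weighted_char w1 X = weighted_char w2 X" "weighted_char (\<lambda>x. w1 x * indicator A x) X = weighted_char (\<lambda>x. w2 x * indicator A x) X"
    using agree agreeA X unfolding char_agree_def by blast+
  ultimately show "weighted_char (\<lambda>x. w1 x * indicator (space M - A) x) X = weighted_char (\<lambda>x. w2 x * indicator (space M - A) x) X"
    by simp
qed simp

text \<open>Because the claim is about all pairs of weights, an intersection of events is handled by
  restricting the weights twice; complements follow by linearity, and a countable union has a
  complement that is a limit of finite intersections of complements, so induction over the generated sigma-algebra succeeds without a choice of an intersection-stable
  generator.\<close>

theorem char_agree_generated:
  assumes "A \<in> generated" "char_agree M L w1 w2"
  shows "char_agree M L (\<lambda>x. w1 x * indicator A x) (\<lambda>x. w2 x * indicator A x)"
  using assms unfolding generated_def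
proof (induction arbitrary: w1 w2 rule: sigma_sets.induct)
  case (Basic A)
  then obtain X B where X: "X \<in> L" "B \<in> sets borel" "A = X -` B \<inter> space M" by blast
  have "char_agree M L (\<lambda>x. w1 x * indicator B (X x)) (\<lambda>x. w2 x * indicator B (X x))"
    by (rule char_agree_preimage[OF Basic.prems X(1,2)])
  moreover have "indicator B (X x) = (indicator A x :: real)" if "x \<in> space M" for x
    using that X by (auto simp: indicator_def)
  moreover have "A \<in> sets M" using X measurable_L by auto
  ultimately show ?case
    by (intro char_agree_indicatorI[OF Basic.prems])
      (auto simp: char_agree_def cong: Bochner_Integration.integral_cong)
next
  case Empty
  then show ?case by (auto simp: char_agree_def)
next
  case (Compl A)
  have "A \<in> sets M" using Compl.hyps generated_subset unfolding generated_def by auto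
  then show ?case by (rule char_agree_compl[OF Compl.prems _ Compl.IH[OF Compl.prems]])
next
  case (Union A)
  let ?B = "\<lambda>n. \<Inter>i<n. space M - A i" and ?B' = "\<Inter>i. space M - A i"
  have A[measurable]: "A i \<in> sets M" for i using Union.hyps generated_subset unfolding generated_def by auto
  have fin: "char_agree M L (\<lambda>x. w1 x * indicator (?B n) x) (\<lambda>x. w2 x * indicator (?B n) x)" for n
  proof (induction n)
    case 0
    then show ?case using Union.prems by simp
  next
    case (Suc n)
    have eq: "w x * indicator (?B n) x * indicator (space M - A n) x = w x * indicator (?B (Suc n)) x"
      for w :: "'a \<Rightarrow> real" and x
      by (auto simp: indicator_def lessThan_Suc)
    show ?case using char_agree_compl[OF Suc A[of n] Union.IH[OF Suc, of n]] unfolding eq .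
  qed
  from Union.prems obtain C where C: "\<And>x. 0 \<le> w1 x \<and> w1 x \<le> C \<and> 0 \<le> w2 x \<and> w2 x \<le> C"
    unfolding char_agree_def by blast
  have lim: "(\<lambda>n. weighted_char (\<lambda>x. w x * indicator (?B n) x) X) \<longlonglongrightarrow> weighted_char (\<lambda>x. w x * indicator ?B' x) X"
    if w: "w \<in> {w1, w2}" and X: "X \<in> L" for w X
  proof (rule integral_dominated_convergence[where w = "\<lambda>_. C"])
    note [measurable] = measurable_L[OF X]
    have [measurable]: "w \<in> borel_measurable M" using Union.prems w unfolding char_agree_def by auto
    have [measurable]: "(\<lambda>x. w x * indicator (?B n) x) \<in> borel_measurable M" for n
      using fin[of n] w unfolding char_agree_def by auto
    show "(\<lambda>x. complex_of_real (w x * indicator ?B' x) * iexp (X x)) \<in> borel_measurable M"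
      "\<And>n. (\<lambda>x. complex_of_real (w x * indicator (?B n) x) * iexp (X x)) \<in> borel_measurable M"
      by measurable
    show "AE x in M. (\<lambda>n. complex_of_real (w x * indicator (?B n) x) * iexp (X x))
        \<longlonglongrightarrow> complex_of_real (w x * indicator ?B' x) * iexp (X x)"
      by (intro always_eventually allI tendsto_intros LIMSEQ_indicator_INT)
    have "\<bar>w x * indicator (?B n) x\<bar> \<le> C" for n x using w C[of x] by (auto simp: indicator_def)
    moreover have "norm (complex_of_real r * iexp y) = \<bar>r\<bar>" for r y by (simp add: norm_mult)
    ultimately show "AE x in M. norm (complex_of_real (w x * indicator (?B n) x) * iexp (X x)) \<le> C" for n
      by (intro AE_I2) (simp only:)
  qed simp
  have "weighted_char (\<lambda>x. w1 x * indicator ?B' x) X = weighted_char (\<lambda>x. w2 x * indicator ?B' x) X" if X: "X \<in> L" for X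
  proof (rule LIMSEQ_unique[OF lim[OF _ X]])
    have "weighted_char (\<lambda>x. w1 x * indicator (?B n) x) X = weighted_char (\<lambda>x. w2 x * indicator (?B n) x) X" for n
      using fin[of n] X unfolding char_agree_def by blast
    then show "(\<lambda>n. weighted_char (\<lambda>x. w1 x * indicator (?B n) x) X) \<longlonglongrightarrow> weighted_char (\<lambda>x. w2 x * indicator ?B' x) X"
      using lim[of w2, OF _ X] by simp
  qed simp
  then have "char_agree M L (\<lambda>x. w1 x * indicator ?B' x) (\<lambda>x. w2 x * indicator ?B' x)"
    by (intro char_agree_indicatorI[OF Union.prems]) simp_all
  from char_agree_compl[OF Union.prems _ this]
  have "char_agree M L (\<lambda>x. w1 x * indicator (space M - ?B') x) (\<lambda>x. w2 x * indicator (space M - ?B') x)"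
    by simp
  moreover have "space M - ?B' = (\<Union>i. A i)" using A sets.sets_into_space by blast
  ultimately show ?case by simp
qed

lemma integral_weight_generated:
  assumes A: "A \<in> generated" and agree: "char_agree M L w1 w2"
  shows "(\<integral>x. w1 x * indicator A x \<partial>M) = (\<integral>x. w2 x * indicator A x \<partial>M)"
proof -
  have "(\<integral>x. complex_of_real (w1 x * indicator A x) * iexp ((\<lambda>_. 0) x) \<partial>M)
      = (\<integral>x. complex_of_real (w2 x * indicator A x) * iexp ((\<lambda>_. 0) x) \<partial>M)"
    using char_agree_generated[OF A agree] zero_L unfolding char_agree_def by (elim conjE) (erule bspec)
  then have "complex_of_real (\<integral>x. w1 x * indicator A x \<partial>M) = complex_of_real (\<integral>x. w2 x * indicator A x \<partial>M)"
    by (simp add: integral_complex_of_real[symmetric] del: integral_complex_of_real)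
  then show ?thesis by (simp only: of_real_eq_iff)
qed

end

section \<open>The Wiener integral\<close>

lemma (in prob_space) centered_normal_rv_moments:
  assumes G: "centered_normal_rv M Y"
  shows "square_integrable M Y" and "(\<integral>\<omega>. Y \<omega> \<partial>M) = 0"
    and "(\<integral>\<omega>. iexp (Y \<omega>) \<partial>M) = exp (- (\<integral>\<omega>. (Y \<omega>)\<^sup>2 \<partial>M) / 2)"
proof -
  have [measurable]: "Y \<in> borel_measurable M" using G by (simp add: centered_normal_rv_def)
  consider (degenerate) "AE \<omega> in M. Y \<omega> = 0"
    | (normal) s where "s > 0" "distributed M lborel Y (normal_density 0 s)"
    using G by (auto simp: centered_normal_rv_def)
  then have "square_integrable M Y \<and> (\<integral>\<omega>. Y \<omega> \<partial>M) = 0 \<and>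
      (\<integral>\<omega>. iexp (Y \<omega>) \<partial>M) = exp (- (\<integral>\<omega>. (Y \<omega>)\<^sup>2 \<partial>M) / 2)"
  proof cases
    case degenerate
    have "(\<integral>\<omega>. iexp (Y \<omega>) \<partial>M) = (\<integral>\<omega>. 1 \<partial>M)"
      by (rule integral_cong_AE) (use degenerate in auto)
    moreover have "(\<integral>\<omega>. (Y \<omega>)\<^sup>2 \<partial>M) = (\<integral>\<omega>. 0 \<partial>M)" "(\<integral>\<omega>. Y \<omega> \<partial>M) = (\<integral>\<omega>. 0 \<partial>M)"
      by (rule integral_cong_AE; use degenerate in auto)+
    moreover have "integrable M (\<lambda>\<omega>. (Y \<omega>)\<^sup>2) \<longleftrightarrow> integrable M (\<lambda>\<omega>. 0 :: real)"
      by (rule integrable_cong_AE) (use degenerate in auto)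
    ultimately show ?thesis by (simp add: square_integrable_def prob_space)
  next
    case normal
    note mean = normal_distributed_expectation[OF normal]
    have var: "(\<integral>\<omega>. (Y \<omega>)\<^sup>2 \<partial>M) = s\<^sup>2" using normal_distributed_variance[OF normal] mean by simp
    have "integrable M (\<lambda>\<omega>. (Y \<omega>)\<^sup>2)"
      using distributed_integrable[OF normal(2), of "\<lambda>x. x\<^sup>2"] integrable_normal_moment[of s 0 2] normal(1) by simp
    moreover have "(\<integral>\<omega>. iexp (Y \<omega>) \<partial>M) = exp (- (s\<^sup>2) / 2)"
    proof -
      have "distributed M lborel (\<lambda>\<omega>. Y \<omega> / s) std_normal_density"
        using normal normal_standard_normal_convert[of s Y 0] by simp
      then have "distr M lborel (\<lambda>\<omega>. Y \<omega> / s) = std_normal_distribution"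
        by (rule distributed_distr_eq_density)
      then have "char std_normal_distribution s = (\<integral>\<omega>. iexp (s * (Y \<omega> / s)) \<partial>M)"
        unfolding char_def by (subst \<open>_ = std_normal_distribution\<close>[symmetric], subst integral_distr) auto
      then show ?thesis
        using normal(1) by (simp add: char_std_normal_distribution)
    qed
    ultimately show ?thesis using mean var by (simp add: square_integrable_def exp_of_real)
  qed
  then show "square_integrable M Y" and "(\<integral>\<omega>. Y \<omega> \<partial>M) = 0"
    and "(\<integral>\<omega>. iexp (Y \<omega>) \<partial>M) = exp (- (\<integral>\<omega>. (Y \<omega>)\<^sup>2 \<partial>M) / 2)" by auto
qed

text \<open>The function \<open>exp (i x)\<close> is \<open>1\<close>-Lipschitz, so the difference is at most the \<open>L\<^sup>1\<close> distance, which the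
  \<open>L\<^sup>2\<close> distance dominates.\<close>

lemma (in prob_space) L2_tendsto_char:
  assumes f: "\<And>n. square_integrable M (f n)" and g: "square_integrable M g" and lim: "L2_tendsto M f g"
    and [measurable]: "A \<in> sets M"
  shows "(\<lambda>n. \<integral>\<omega>. iexp (f n \<omega>) * indicator A \<omega> \<partial>M) \<longlonglongrightarrow> (\<integral>\<omega>. iexp (g \<omega>) * indicator A \<omega> \<partial>M)"
proof -
  note [measurable] = square_integrable_measurable[OF f] square_integrable_measurable[OF g]
  let ?d = "\<lambda>n. sqrt (\<integral>x. (f n x - g x)\<^sup>2 \<partial>M)"
  have d: "?d \<longlonglongrightarrow> 0" using lim tendsto_real_sqrt[of _ 0] by (simp add: L2_tendsto_integral[OF f g])
  have iexp_lipschitz: "cmod (iexp x - iexp y) \<le> \<bar>x - y\<bar>" for x y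
  proof -
    have "cmod (iexp x - iexp y) = cmod (iexp y * (iexp (x - y) - 1))"
      by (simp add: right_diff_distrib exp_add[symmetric])
    also have "\<dots> = cmod (iexp (x - y) - 1)" by (simp add: norm_mult)
    also have "\<dots> \<le> \<bar>x - y\<bar>" using iexp_approx1[of "x - y" 0] by simp
    finally show ?thesis .
  qed
  have int: "integrable M (\<lambda>\<omega>. iexp (h \<omega>) * indicator A \<omega>)" if [measurable]: "h \<in> borel_measurable M" for h :: "'a \<Rightarrow> real"
    by (rule integrable_const_bound[where B = 1]) (auto simp: indicator_def norm_mult)
  have "cmod ((\<integral>\<omega>. iexp (f n \<omega>) * indicator A \<omega> \<partial>M) - (\<integral>\<omega>. iexp (g \<omega>) * indicator A \<omega> \<partial>M)) \<le> ?d n" for n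
  proof -
    have dn: "square_integrable M (\<lambda>x. f n x - g x)" by (rule square_integrable_diff[OF f g])
    have "(\<integral>\<omega>. iexp (f n \<omega>) * indicator A \<omega> \<partial>M) - (\<integral>\<omega>. iexp (g \<omega>) * indicator A \<omega> \<partial>M)
        = (\<integral>\<omega>. (iexp (f n \<omega>) - iexp (g \<omega>)) * indicator A \<omega> \<partial>M)"
      by (subst Bochner_Integration.integral_diff[symmetric]) (auto intro!: int simp: left_diff_distrib)
    also have "cmod \<dots> \<le> (\<integral>\<omega>. cmod ((iexp (f n \<omega>) - iexp (g \<omega>)) * indicator A \<omega>) \<partial>M)"
      by (rule integral_norm_bound)
    also have "\<dots> \<le> (\<integral>\<omega>. \<bar>f n \<omega> - g \<omega>\<bar> \<partial>M)"
    proof (rule integral_mono)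
      show "integrable M (\<lambda>\<omega>. \<bar>f n \<omega> - g \<omega>\<bar>)"
        using dn by (intro integrable_abs square_integrable_imp_integrable[of "\<lambda>x. f n x - g x"]) (auto simp: square_integrable_def)
      show "integrable M (\<lambda>\<omega>. cmod ((iexp (f n \<omega>) - iexp (g \<omega>)) * indicator A \<omega>))"
        using int[of "f n"] int[of g] by (auto simp: left_diff_distrib)
      show "cmod ((iexp (f n \<omega>) - iexp (g \<omega>)) * indicator A \<omega>) \<le> \<bar>f n \<omega> - g \<omega>\<bar>" for \<omega>
        using iexp_lipschitz[of "f n \<omega>" "g \<omega>"] by (auto simp: indicator_def norm_mult)
    qed
    also have "\<dots> \<le> ?d n" by (rule integral_abs_le_L2[OF dn])
    finally show ?thesis .
  qed
  then have "(\<lambda>n. (\<integral>\<omega>. iexp (f n \<omega>) * indicator A \<omega> \<partial>M) - (\<integral>\<omega>. iexp (g \<omega>) * indicator A \<omega> \<partial>M)) \<longlonglongrightarrow> 0"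
    by (intro Lim_null_comparison[OF _ d] always_eventually allI)
  then show ?thesis by (rule LIM_zero_cancel)
qed

text \<open>Bookkeeping for linear combinations of step functions built on different finite families of sets:
  both are rewritten over the union, with coefficient \<open>0\<close> for absent sets.\<close>

lemma sum_coeff_union:
  fixes g :: "'e \<Rightarrow> real"
  assumes "finite I" "finite J"
  shows "(\<Sum>E\<in>I \<union> J. (a * (if E \<in> I then c E else 0) + b * (if E \<in> J then d E else 0)) * g E)
       = a * (\<Sum>E\<in>I. c E * g E) + b * (\<Sum>E\<in>J. d E * g E)"
proof -
  have "(\<Sum>E\<in>I \<union> J. (if E \<in> I then c E else 0) * g E) = (\<Sum>E\<in>I. c E * g E)"
    using assms by (intro sum.mono_neutral_cong_right) auto
  moreover have "(\<Sum>E\<in>I \<union> J. (if E \<in> J then d E else 0) * g E) = (\<Sum>E\<in>J. d E * g E)"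
    using assms by (intro sum.mono_neutral_cong_right) auto
  ultimately show ?thesis
    by (simp add: distrib_right sum.distrib mult.assoc sum_distrib_left[symmetric])
qed

locale white_noise_space = prob_space M for M :: "'w measure" +
  fixes mG :: "'g measure" and \<xi> :: "(real \<times> 'g) set \<Rightarrow> 'w \<Rightarrow> real"
  assumes sigma_finite_mG: "sigma_finite_measure mG"
    and noise: "white_noise M mG \<xi>"
begin

abbreviation T where "T \<equiv> time_space mG"
abbreviation wiener where "wiener \<equiv> wiener_integral M mG \<xi>"
abbreviation sq_norm where "sq_norm h \<equiv> \<integral>z. (h z)\<^sup>2 \<partial>T"

lemma space_T: "space T = {0..} \<times> space mG"
  by (simp add: time_space_def space_pair_measure space_restrict_space)

lemma noise_step:
  fixes c :: "(real \<times> 'g) set \<Rightarrow> real"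
  assumes J: "finite J" "J \<subseteq> finite_sets T"
  defines "h \<equiv> (\<lambda>z. \<Sum>E\<in>J. c E * indicator E z)" and "G \<equiv> (\<lambda>\<omega>. \<Sum>E\<in>J. c E * \<xi> E \<omega>)"
  shows "square_integrable T h" "square_integrable M G" "(\<integral>\<omega>. G \<omega> \<partial>M) = 0"
    "(\<integral>\<omega>. (G \<omega>)\<^sup>2 \<partial>M) = sq_norm h"
    "(\<integral>\<omega>. iexp (G \<omega>) \<partial>M) = exp (- sq_norm h / 2)"
proof -
  have gf: "centered_gaussian_field M (finite_sets T) \<xi>" using noise by (simp add: white_noise_def)
  have G: "centered_normal_rv M G" using gf J unfolding centered_gaussian_field_def G_def by blast
  have E: "square_integrable M (\<xi> E)" if "E \<in> J" for E
  proof -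
    have "centered_normal_rv M (\<lambda>\<omega>. \<Sum>j\<in>{E}. 1 * \<xi> j \<omega>)"
      using gf[unfolded centered_gaussian_field_def, rule_format, of "{E}" "\<lambda>_. 1"] that J by auto
    then show ?thesis using centered_normal_rv_moments(1) by simp
  qed
  have ind: "square_integrable T (indicator E)" if "E \<in> J" for E
  proof -
    have "E \<in> sets T" "emeasure T E < \<infinity>" using that J by (auto simp: finite_sets_def)
    moreover have "(\<lambda>z. (indicator E z)\<^sup>2) = (indicator E :: _ \<Rightarrow> real)" by (auto simp: indicator_def)
    ultimately show ?thesis by (simp add: square_integrable_def)
  qed
  show h: "square_integrable T h" unfolding h_def using ind
    by (intro square_integrable_sum square_integrable_cmult)
  note m = centered_normal_rv_moments[OF G]
  show "square_integrable M G" "(\<integral>\<omega>. G \<omega> \<partial>M) = 0" using m by auto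
  have sq: "(\<Sum>E\<in>J. c E * g E)\<^sup>2 = (\<Sum>E\<in>J. \<Sum>F\<in>J. (c E * c F) * (g E * g F))" for g :: "_ \<Rightarrow> real"
    by (simp add: power2_eq_square sum_product mult_ac)
  have "(\<integral>\<omega>. (G \<omega>)\<^sup>2 \<partial>M) = (\<Sum>E\<in>J. \<Sum>F\<in>J. (c E * c F) * (\<integral>\<omega>. \<xi> E \<omega> * \<xi> F \<omega> \<partial>M))"
    unfolding G_def sq using square_integrable_mult[OF E E]
    by (subst Bochner_Integration.integral_sum; (intro Bochner_Integration.integrable_sum integrable_mult_right)?; simp?)+
  also have "\<dots> = (\<Sum>E\<in>J. \<Sum>F\<in>J. (c E * c F) * (\<integral>z. indicator E z * indicator F z \<partial>T))"
  proof (intro sum.cong refl, rule arg_cong[where f = "\<lambda>t. _ * t"])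
    fix E F assume "E \<in> J" "F \<in> J"
    then have EF: "E \<in> finite_sets T" "F \<in> finite_sets T" using J by auto
    then have sub: "E \<inter> F \<subseteq> space T" unfolding finite_sets_def using sets.sets_into_space by blast
    have "(\<integral>\<omega>. \<xi> E \<omega> * \<xi> F \<omega> \<partial>M) = measure T (E \<inter> F)"
      using noise EF by (simp add: white_noise_def)
    also have "\<dots> = (\<integral>z. indicator (E \<inter> F) z \<partial>T)" using sub by (simp add: Int_absorb2)
    finally show "(\<integral>\<omega>. \<xi> E \<omega> * \<xi> F \<omega> \<partial>M) = (\<integral>z. indicator E z * indicator F z \<partial>T)"
      by (simp add: indicator_inter_arith)
  qed
  also have "\<dots> = sq_norm h"
    unfolding h_def sq using square_integrable_mult[OF ind ind]
    by (subst Bochner_Integration.integral_sum; (intro Bochner_Integration.integrable_sum integrable_mult_right)?; simp?)+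
  finally show "(\<integral>\<omega>. (G \<omega>)\<^sup>2 \<partial>M) = sq_norm h" .
  then show "(\<integral>\<omega>. iexp (G \<omega>) \<partial>M) = exp (- sq_norm h / 2)" using m by simp
qed

lemma wiener_iff:
  "wiener h V \<longleftrightarrow> square_integrable T h \<and> V \<in> borel_measurable M \<and>
    (\<exists>J c. (\<forall>n::nat. finite (J n) \<and> J n \<subseteq> finite_sets T) \<and>
       L2_tendsto T (\<lambda>n z. \<Sum>E\<in>J n. c n E * indicator E z) h \<and>
       L2_tendsto M (\<lambda>n \<omega>. \<Sum>E\<in>J n. c n E * \<xi> E \<omega>) V)"
  unfolding wiener_integral_def L2_tendsto_def by simp

lemma wiener_step:
  assumes J: "finite J" "J \<subseteq> finite_sets T"
  shows "wiener (\<lambda>z. \<Sum>E\<in>J. c E * indicator E z) (\<lambda>\<omega>. \<Sum>E\<in>J. c E * \<xi> E \<omega>)"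
  unfolding wiener_iff using noise_step[OF J, of c] J
  by (auto intro!: exI[of _ "\<lambda>_. J"] exI[of _ "\<lambda>_. c"] simp: L2_tendsto_def L2_norm_sq_def square_integrable_def)

text \<open>All of this holds for step functions by the covariance of the noise, and survives the \<open>L\<^sup>2\<close> limit that
  defines the integral.\<close>

lemma wiener_moments:
  assumes W: "wiener h V"
  shows "square_integrable T h" "square_integrable M V" "(\<integral>\<omega>. V \<omega> \<partial>M) = 0"
    "(\<integral>\<omega>. (V \<omega>)\<^sup>2 \<partial>M) = sq_norm h"
    "(\<integral>\<omega>. iexp (V \<omega>) \<partial>M) = exp (- sq_norm h / 2)"
proof -
  from W obtain J c where J: "\<And>n::nat. finite (J n) \<and> J n \<subseteq> finite_sets T"
    and h: "square_integrable T h" and V: "V \<in> borel_measurable M"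
    and lh: "L2_tendsto T (\<lambda>n z. \<Sum>E\<in>J n. c n E * indicator E z) h"
    and lV: "L2_tendsto M (\<lambda>n \<omega>. \<Sum>E\<in>J n. c n E * \<xi> E \<omega>) V" unfolding wiener_iff by blast
  define hn Vn where "hn n z = (\<Sum>E\<in>J n. c n E * indicator E z)" and "Vn n \<omega> = (\<Sum>E\<in>J n. c n E * \<xi> E \<omega>)" for n z \<omega>
  have step: "square_integrable T (hn n)" "square_integrable M (Vn n)" "(\<integral>\<omega>. Vn n \<omega> \<partial>M) = 0"
    "(\<integral>\<omega>. (Vn n \<omega>)\<^sup>2 \<partial>M) = (\<integral>z. (hn n z)\<^sup>2 \<partial>T)"
    "(\<integral>\<omega>. iexp (Vn n \<omega>) \<partial>M) = exp (- (\<integral>z. (hn n z)\<^sup>2 \<partial>T) / 2)" for n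
    unfolding hn_def Vn_def by (rule noise_step[OF J[THEN conjunct1] J[THEN conjunct2]])+
  have lh: "L2_tendsto T hn h" and lV: "L2_tendsto M Vn V" using lh lV unfolding hn_def Vn_def .
  show "square_integrable T h" by fact
  show sV: "square_integrable M V" by (rule square_integrable_L2_tendsto[OF step(2) V lV])
  have one: "square_integrable M (\<lambda>_. 1)" by (simp add: square_integrable_def)
  have "(\<lambda>n. \<integral>\<omega>. Vn n \<omega> * 1 \<partial>M) \<longlonglongrightarrow> (\<integral>\<omega>. V \<omega> * 1 \<partial>M)"
    by (intro L2_tendsto_inner step sV lV one) (simp add: L2_tendsto_def L2_norm_sq_def)
  then show "(\<integral>\<omega>. V \<omega> \<partial>M) = 0" using step(3) by (simp add: LIMSEQ_const_iff)
  have 1: "(\<lambda>n. \<integral>\<omega>. Vn n \<omega> * Vn n \<omega> \<partial>M) \<longlonglongrightarrow> (\<integral>\<omega>. V \<omega> * V \<omega> \<partial>M)"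
    by (intro L2_tendsto_inner step sV lV)
  have 2: "(\<lambda>n. \<integral>z. hn n z * hn n z \<partial>T) \<longlonglongrightarrow> (\<integral>z. h z * h z \<partial>T)"
    by (intro L2_tendsto_inner step h lh)
  show "(\<integral>\<omega>. (V \<omega>)\<^sup>2 \<partial>M) = sq_norm h"
    using LIMSEQ_unique[OF 1] 2 step(4) by (simp add: power2_eq_square)
  have "(\<lambda>n. \<integral>\<omega>. iexp (Vn n \<omega>) * indicator (space M) \<omega> \<partial>M) \<longlonglongrightarrow> (\<integral>\<omega>. iexp (V \<omega>) * indicator (space M) \<omega> \<partial>M)"
    by (intro L2_tendsto_char step sV lV) simp
  moreover have "(\<integral>\<omega>. iexp (W \<omega>) * indicator (space M) \<omega> \<partial>M) = (\<integral>\<omega>. iexp (W \<omega>) \<partial>M)" for W :: "'w \<Rightarrow> real"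
    by (intro Bochner_Integration.integral_cong) auto
  ultimately have 3: "(\<lambda>n. \<integral>\<omega>. iexp (Vn n \<omega>) \<partial>M) \<longlonglongrightarrow> (\<integral>\<omega>. iexp (V \<omega>) \<partial>M)" by simp
  have "(\<lambda>n. complex_of_real (exp (- (\<integral>z. (hn n z)\<^sup>2 \<partial>T) / 2))) \<longlonglongrightarrow> complex_of_real (exp (- sq_norm h / 2))"
    using 2 by (intro tendsto_intros) (simp_all add: power2_eq_square)
  then show "(\<integral>\<omega>. iexp (V \<omega>) \<partial>M) = exp (- sq_norm h / 2)"
    using 3 unfolding step(5) by (rule LIMSEQ_unique[rotated])
qed

lemma wiener_lincomb:
  assumes 1: "wiener h V" and 2: "wiener k W"
  shows "wiener (\<lambda>z. a * h z + b * k z) (\<lambda>\<omega>. a * V \<omega> + b * W \<omega>)"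
proof -
  from 1 obtain J c where J: "\<And>n::nat. finite (J n) \<and> J n \<subseteq> finite_sets T"
    and h: "square_integrable T h" and V: "V \<in> borel_measurable M"
    and lh: "L2_tendsto T (\<lambda>n z. \<Sum>E\<in>J n. c n E * indicator E z) h"
    and lV: "L2_tendsto M (\<lambda>n \<omega>. \<Sum>E\<in>J n. c n E * \<xi> E \<omega>) V" unfolding wiener_iff by blast
  from 2 obtain I d where I: "\<And>n::nat. finite (I n) \<and> I n \<subseteq> finite_sets T"
    and k: "square_integrable T k" and W: "W \<in> borel_measurable M"
    and lk: "L2_tendsto T (\<lambda>n z. \<Sum>E\<in>I n. d n E * indicator E z) k"
    and lW: "L2_tendsto M (\<lambda>n \<omega>. \<Sum>E\<in>I n. d n E * \<xi> E \<omega>) W" unfolding wiener_iff by blast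
  let ?c = "\<lambda>n E. a * (if E \<in> J n then c n E else 0) + b * (if E \<in> I n then d n E else 0)"
  note mJ = noise_step(1,2)[OF J[THEN conjunct1] J[THEN conjunct2], THEN square_integrable_measurable]
  note mI = noise_step(1,2)[OF I[THEN conjunct1] I[THEN conjunct2], THEN square_integrable_measurable]
  show ?thesis
    unfolding wiener_iff
  proof (intro conjI exI[of _ "\<lambda>n. J n \<union> I n"] exI[of _ ?c] allI)
    show "square_integrable T (\<lambda>z. a * h z + b * k z)"
      by (intro square_integrable_add square_integrable_cmult h k)
    show "(\<lambda>\<omega>. a * V \<omega> + b * W \<omega>) \<in> borel_measurable M" using V W by measurable
    show "finite (J n \<union> I n)" "J n \<union> I n \<subseteq> finite_sets T" for n using J[of n] I[of n] by auto
    show "L2_tendsto T (\<lambda>n z. \<Sum>E\<in>J n \<union> I n. ?c n E * indicator E z) (\<lambda>z. a * h z + b * k z)"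
      using J I mJ mI h k unfolding sum_coeff_union[OF J[THEN conjunct1] I[THEN conjunct1]]
      by (intro L2_tendsto_add L2_tendsto_cmult lh lk) (auto intro!: borel_measurable_times square_integrable_measurable)
    show "L2_tendsto M (\<lambda>n \<omega>. \<Sum>E\<in>J n \<union> I n. ?c n E * \<xi> E \<omega>) (\<lambda>\<omega>. a * V \<omega> + b * W \<omega>)"
      using J I mJ mI V W unfolding sum_coeff_union[OF J[THEN conjunct1] I[THEN conjunct1]]
      by (intro L2_tendsto_add L2_tendsto_cmult lV lW) (auto intro!: borel_measurable_times)
  qed
qed

lemma wiener_cong:
  assumes "wiener h V" "\<And>z. z \<in> space T \<Longrightarrow> h z = k z"
  shows "wiener k V"
proof -
  have "square_integrable T k \<longleftrightarrow> square_integrable T h"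
    unfolding square_integrable_def using assms(2)
    by (intro conj_cong measurable_cong Bochner_Integration.integrable_cong) auto
  moreover have "L2_tendsto T f k \<longleftrightarrow> L2_tendsto T f h" for f
    unfolding L2_tendsto_def L2_norm_sq_def using assms(2) by (simp cong: nn_integral_cong)
  ultimately show ?thesis using assms(1) unfolding wiener_iff by simp
qed

text \<open>Cutting the sets of the approximating step functions down to \<open>R\<close> gives step functions converging to
  the restriction. By the isometry their integrals form a Cauchy sequence, and completeness supplies the
  integral \<open>V'\<close>.\<close>

lemma wiener_restrict:
  assumes W: "wiener h V" and R: "R \<in> sets T"
  shows "\<exists>V'. wiener (\<lambda>z. indicator R z * h z) V'"
proof -
  from W obtain J c where J: "\<And>n::nat. finite (J n) \<and> J n \<subseteq> finite_sets T"
    and h: "square_integrable T h" and V: "V \<in> borel_measurable M"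
    and lh: "L2_tendsto T (\<lambda>n z. \<Sum>E\<in>J n. c n E * indicator E z) h" unfolding wiener_iff by blast
  define J' where "J' n = (\<lambda>E. E \<inter> R) ` J n" for n
  define c' where "c' n F = (\<Sum>E\<in>{E \<in> J n. E \<inter> R = F}. c n E)" for n F
  have J': "finite (J' n) \<and> J' n \<subseteq> finite_sets T" for n
  proof -
    have "emeasure T (E \<inter> R) < \<infinity>" if "E \<in> finite_sets T" for E
      using that R emeasure_mono[of "E \<inter> R" E T] unfolding finite_sets_def by (auto intro: order.strict_trans1)
    then show ?thesis using J[of n] R unfolding J'_def finite_sets_def by auto
  qed
  \<comment> \<open>Distinct sets may have the same trace on \<open>R\<close>; their coefficients are added in \<open>c'\<close>.\<close>
  have regroup: "(\<Sum>F\<in>J' n. c' n F * g F) = (\<Sum>E\<in>J n. c n E * g (E \<inter> R))" for n and g :: "_ \<Rightarrow> real"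
  proof -
    have "(\<Sum>E\<in>J n. c n E * g (E \<inter> R)) = (\<Sum>F\<in>J' n. \<Sum>E\<in>{E \<in> J n. E \<inter> R = F}. c n E * g (E \<inter> R))"
      unfolding J'_def using J by (intro sum.image_gen) auto
    also have "\<dots> = (\<Sum>F\<in>J' n. c' n F * g F)"
      unfolding c'_def sum_distrib_right by (intro sum.cong refl) auto
    finally show ?thesis by simp
  qed
  define hn where "hn n z = (\<Sum>E\<in>J n. c n E * indicator E z)" for n z
  define kn where "kn n z = (\<Sum>F\<in>J' n. c' n F * indicator F z)" for n z
  define Vn where "Vn n \<omega> = (\<Sum>F\<in>J' n. c' n F * \<xi> F \<omega>)" for n \<omega>
  have kn: "kn n z = indicator R z * hn n z" for n z
    unfolding kn_def hn_def regroup by (simp add: sum_distrib_left indicator_inter_arith mult_ac)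
  have wn: "wiener (kn n) (Vn n)" for n
    unfolding kn_def[abs_def] Vn_def[abs_def] using J'[of n] by (intro wiener_step) auto
  have sh: "square_integrable T (hn n)" for n
    unfolding hn_def[abs_def] using noise_step(1) J by blast
  have lh: "L2_tendsto T hn h" using lh unfolding hn_def[abs_def] .
  have Rh: "square_integrable T (\<lambda>z. indicator R z * h z)"
    using h R by (intro square_integrable_bounded_by[OF h]) (auto simp: indicator_def)
  have lk: "L2_tendsto T kn (\<lambda>z. indicator R z * h z)"
    by (rule L2_tendsto_mono[OF lh]) (auto simp: kn indicator_def)
  have diff: "wiener (\<lambda>z. kn n z - kn m z) (\<lambda>\<omega>. Vn n \<omega> - Vn m \<omega>)" for n m
    using wiener_lincomb[OF wn[of n] wn[of m], of 1 "- 1"] by simp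
  have "\<exists>V'. square_integrable M V' \<and> L2_tendsto M Vn V'"
  proof (rule L2_complete)
    show "square_integrable M (Vn n)" for n using wiener_moments(2)[OF wn] .
    fix e :: real assume "e > 0"
    have "(\<lambda>n. \<integral>z. (kn n z - indicator R z * h z)\<^sup>2 \<partial>T) \<longlonglongrightarrow> 0"
      using lk L2_tendsto_integral[OF wiener_moments(1)[OF wn] Rh] by simp
    from order_tendstoD(2)[OF this, of "e / 4"] \<open>e > 0\<close>
    obtain N where N: "\<And>n. n \<ge> N \<Longrightarrow> (\<integral>z. (kn n z - indicator R z * h z)\<^sup>2 \<partial>T) < e / 4"
      by (auto simp: eventually_sequentially)
    have "(\<integral>\<omega>. (Vn n \<omega> - Vn m \<omega>)\<^sup>2 \<partial>M) < e" if "n \<ge> N" "m \<ge> N" for n m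
    proof -
      let ?h = "\<lambda>z. indicator R z * h z"
      have d: "square_integrable T (\<lambda>z. kn n z - ?h z)" for n
        by (rule square_integrable_diff[OF wiener_moments(1)[OF wn] Rh])
      have "(\<integral>\<omega>. (Vn n \<omega> - Vn m \<omega>)\<^sup>2 \<partial>M) = (\<integral>z. (kn n z - kn m z)\<^sup>2 \<partial>T)"
        by (rule wiener_moments(4)[OF diff])
      also have "\<dots> \<le> (\<integral>z. 2 * (kn n z - ?h z)\<^sup>2 + 2 * (kn m z - ?h z)\<^sup>2 \<partial>T)"
      proof (rule integral_mono)
        show "integrable T (\<lambda>z. (kn n z - kn m z)\<^sup>2)" using wiener_moments(1)[OF diff[of n m]] by (simp add: square_integrable_def)
        show "integrable T (\<lambda>z. 2 * (kn n z - ?h z)\<^sup>2 + 2 * (kn m z - ?h z)\<^sup>2)"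
          using d[of n] d[of m] by (auto simp: square_integrable_def)
        have "(x - y)\<^sup>2 \<le> 2 * (x - w)\<^sup>2 + 2 * (y - w)\<^sup>2" for x y w :: real
          using zero_le_power2[of "(x - w) + (y - w)"] by (simp add: power2_eq_square algebra_simps)
        then show "(kn n z - kn m z)\<^sup>2 \<le> 2 * (kn n z - ?h z)\<^sup>2 + 2 * (kn m z - ?h z)\<^sup>2" for z .
      qed
      also have "\<dots> = 2 * (\<integral>z. (kn n z - ?h z)\<^sup>2 \<partial>T) + 2 * (\<integral>z. (kn m z - ?h z)\<^sup>2 \<partial>T)"
        using d[of n] d[of m] by (auto simp: square_integrable_def)
      also have "\<dots> < e" using N[OF that(1)] N[OF that(2)] by linarith
      finally show ?thesis .
    qed
    then show "\<exists>N. \<forall>n\<ge>N. \<forall>m\<ge>N. (\<integral>\<omega>. (Vn n \<omega> - Vn m \<omega>)\<^sup>2 \<partial>M) < e" by blast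
  qed
  then obtain V' where V': "square_integrable M V'" "L2_tendsto M Vn V'" by blast
  have "wiener (\<lambda>z. indicator R z * h z) V'"
    unfolding wiener_iff using J' Rh V' lk square_integrable_measurable[OF V'(1)] unfolding kn_def[abs_def] Vn_def[abs_def] by blast
  then show ?thesis by blast
qed

text \<open>Indicators of null sets are versions of the integral of \<open>0\<close>, so the null sets that complete the
  filtration need no separate treatment.\<close>

lemma wiener_null: "N \<in> null_sets M \<Longrightarrow> wiener (\<lambda>_. 0) (indicator N)"
  unfolding wiener_iff
proof (intro conjI exI[of _ "\<lambda>_. {}"] exI[of _ "\<lambda>_ _. 0"] allI)
  assume N: "N \<in> null_sets M"
  have "L2_norm_sq M (\<lambda>\<omega>. 0 - indicator N \<omega>) = (\<integral>\<^sup>+\<omega>. indicator N \<omega> \<partial>M)"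
    unfolding L2_norm_sq_def by (intro nn_integral_cong) (auto simp: indicator_def)
  also have "\<dots> = 0" using N by (simp add: null_setsD1 null_setsD2)
  finally show "L2_tendsto M (\<lambda>n \<omega>. \<Sum>E\<in>{}. 0 * \<xi> E \<omega>) (indicator N)"
    by (simp add: L2_tendsto_def)
qed (auto simp: square_integrable_def L2_tendsto_def L2_norm_sq_def)

end

section \<open>Independence of the past and the future of the noise\<close>

context white_noise_space
begin

text \<open>All Wiener integrals over times before \<open>r\<close>, not only those of products of a time interval and a
  function on the group. The larger family contains the generators of the noise filtration, and it makes
  the early part of an arbitrary Wiener integral measurable with respect to the past by definition.\<close>

definition noise_before :: "real \<Rightarrow> ('w \<Rightarrow> real) set" where
  "noise_before r = {V. \<exists>h. wiener h V \<and> (\<forall>s y. s \<ge> r \<longrightarrow> h (s, y) = 0)}"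

lemma linear_noise_before: "linear_rv_family M (noise_before r)"
proof
  show "X \<in> borel_measurable M" if "X \<in> noise_before r" for X
    using that by (auto simp: noise_before_def wiener_iff)
  have "wiener (\<lambda>_. 0) (indicator {})" by (rule wiener_null) simp
  moreover have "indicator {} = (\<lambda>_ :: 'w. 0 :: real)" by (simp add: fun_eq_iff)
  ultimately have "wiener (\<lambda>_. 0) (\<lambda>_. 0)" by simp
  then show "(\<lambda>_. 0) \<in> noise_before r" by (auto simp: noise_before_def)
  fix X Y a b assume "X \<in> noise_before r" "Y \<in> noise_before r"
  then obtain h k where hk: "wiener h X" "wiener k Y"
      "\<And>s y. s \<ge> r \<Longrightarrow> h (s, y) = 0" "\<And>s y. s \<ge> r \<Longrightarrow> k (s, y) = 0"
    unfolding noise_before_def by blast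
  then have "a * h (s, y) + b * k (s, y) = 0" if "s \<ge> r" for s y using that by simp
  with wiener_lincomb[OF hk(1,2), of a b] show "(\<lambda>\<omega>. a * X \<omega> + b * Y \<omega>) \<in> noise_before r"
    unfolding noise_before_def by blast
qed

abbreviation events_before :: "real \<Rightarrow> 'w set set" where
  "events_before r \<equiv> linear_rv_family.generated M (noise_before r)"

lemmas events_before_def = linear_rv_family.generated_def[OF linear_noise_before]
lemmas events_before_subset = linear_rv_family.generated_subset[OF linear_noise_before]

text \<open>Right continuous, as the noise filtration is.\<close>

definition past_events :: "real \<Rightarrow> 'w set set" where
  "past_events a = (\<Inter>r\<in>{a<..}. events_before r)"

definition past :: "real \<Rightarrow> 'w measure" where
  "past a = sigma (space M) (past_events a)"

lemma past_events_subset: "past_events a \<subseteq> sets M"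
  unfolding past_events_def using events_before_subset[of "a + 1"] by auto

lemma sigma_sets_past_events:
  assumes "\<And>r. r > a \<Longrightarrow> G \<subseteq> events_before r"
  shows "sigma_sets (space M) G \<subseteq> past_events a"
proof -
  have "sigma_sets (space M) G \<subseteq> events_before r" if "r > a" for r
  proof -
    have "sigma_algebra (space M) (events_before r)"
      unfolding events_before_def by (rule sigma_algebra_sigma_sets) auto
    then show ?thesis using assms[OF that] by (rule sigma_algebra.sigma_sets_subset)
  qed
  then show ?thesis by (auto simp: past_events_def)
qed

lemma space_past [simp]: "space (past a) = space M"
  by (simp add: past_def space_measure_of_conv)

lemma sets_past: "sets (past a) = past_events a"
proof -
  have "past_events a \<subseteq> Pow (space M)" using past_events_subset sets.sets_into_space by blast
  moreover have "sigma_sets (space M) (past_events a) \<subseteq> past_events a"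
    by (rule sigma_sets_past_events) (auto simp: past_events_def)
  ultimately show ?thesis unfolding past_def by (auto simp: sets_measure_of)
qed

lemma measurable_past:
  fixes Y :: "'w \<Rightarrow> real"
  assumes "Y \<in> borel_measurable (past a)"
  shows "Y \<in> borel_measurable M"
proof -
  have "measurable (past a) borel \<subseteq> (measurable M borel :: ('w \<Rightarrow> real) set)"
    using past_events_subset by (intro measurable_mono) (auto simp: sets_past)
  then show ?thesis using assms by auto
qed

lemma measurable_past_mono:
  fixes Y :: "'w \<Rightarrow> real"
  assumes "a \<le> b" "Y \<in> borel_measurable (past a)"
  shows "Y \<in> borel_measurable (past b)"
proof -
  have "past_events a \<subseteq> past_events b" using assms(1) unfolding past_events_def by auto
  then have "sets (past a) \<subseteq> sets (past b)" by (simp add: sets_past)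
  then have "measurable (past a) borel \<subseteq> (measurable (past b) borel :: ('w \<Rightarrow> real) set)"
    by (intro measurable_mono) auto
  then show ?thesis using assms(2) by auto
qed

lemma noise_measurable_past:
  assumes W: "wiener h V" and h: "\<And>s y. s \<ge> a \<Longrightarrow> h (s, y) = 0"
  shows "V \<in> borel_measurable (past a)"
proof (rule measurableI)
  fix B :: "real set" assume B: "B \<in> sets borel"
  have "V -` B \<inter> space M \<in> events_before r" if "r > a" for r
  proof -
    have "V \<in> noise_before r" unfolding noise_before_def using W h that by force
    then show ?thesis unfolding events_before_def using B by (intro sigma_sets.Basic) auto
  qed
  then show "V -` B \<inter> space (past a) \<in> sets (past a)" by (auto simp: sets_past past_events_def)
qed simp

text \<open>A null set \<open>N\<close> enters as the event that \<open>1\<^sub>N\<close>, a version of the integral of \<open>0\<close>, equals \<open>1\<close>.\<close>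

lemma noise_filtration_measurable_past:
  fixes Y :: "'w \<Rightarrow> real"
  assumes Y: "Y \<in> borel_measurable (noise_filtration M mG \<xi> a)"
  shows "Y \<in> borel_measurable (past a)"
proof -
  let ?A = "\<lambda>r. augmented_noise_algebra M mG \<xi> r"
  have sub: "?A r \<subseteq> events_before r" for r
    unfolding augmented_noise_algebra_def events_before_def
  proof (rule sigma_sets_mono, rule subsetI)
    fix E
    assume "E \<in> {V -` B \<inter> space M | V B s \<phi>. s \<in> {0..r} \<and> square_integrable mG \<phi> \<and> B \<in> sets borel \<and>
         wiener_integral M mG \<xi> (\<lambda>(r, y). indicator {0<..<s} r * \<phi> y) V} \<union> null_sets M"
    then consider V B s \<phi> where "E = V -` B \<inter> space M" "s \<in> {0..r}" "B \<in> sets borel"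
        "wiener (\<lambda>(r, y). indicator {0<..<s} r * \<phi> y) V"
      | "E \<in> null_sets M" by blast
    then have "\<exists>V B. E = V -` B \<inter> space M \<and> V \<in> noise_before r \<and> B \<in> sets borel"
    proof cases
      case 1
      then have "V \<in> noise_before r" unfolding noise_before_def by force
      with 1 show ?thesis by blast
    next
      case 2
      have "indicator E \<in> noise_before r"
        using wiener_null[OF 2] unfolding noise_before_def by auto
      moreover have "E = indicator E -` {1 :: real} \<inter> space M"
      proof -
        have "E \<subseteq> space M" using 2 sets.sets_into_space[of E M] by (simp add: null_sets_def)
        moreover have "(indicator E x :: real) = 1 \<longleftrightarrow> x \<in> E" for x by (simp add: indicator_def)
        ultimately show ?thesis by auto
      qed
      ultimately show ?thesis by (intro exI[of _ "indicator E"] exI[of _ "{1}"] conjI) auto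
    qed
    then show "E \<in> sigma_sets (space M) {X -` B \<inter> space M |X B. X \<in> noise_before r \<and> B \<in> sets borel}"
      by (intro sigma_sets.Basic) blast
  qed
  have "sets (noise_filtration M mG \<xi> a) \<subseteq> sets (past a)"
  proof -
    have *: "(\<Inter>r\<in>{a<..}. ?A r) \<subseteq> events_before r" if "r > a" for r using sub[of r] that by auto
    then have "(\<Inter>r\<in>{a<..}. ?A r) \<subseteq> Pow (space M)"
      using events_before_subset[of "a + 1"] sets.sets_into_space[of _ M] by (meson PowI less_add_one subset_iff)
    then show ?thesis
      unfolding noise_filtration_def sets_past
      using sigma_sets_past_events[OF *] by (simp add: sets_measure_of)
  qed
  then have "measurable (noise_filtration M mG \<xi> a) borel \<subseteq> (measurable (past a) borel :: ('w \<Rightarrow> real) set)"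
    by (intro measurable_mono) (auto simp: noise_filtration_def space_measure_of_conv)
  then show ?thesis using Y by auto
qed

lemma AE_T_time_neq: "AE z in T. fst z \<noteq> a"
proof -
  interpret mG: sigma_finite_measure mG by (rule sigma_finite_mG)
  let ?N = "({a} \<inter> {0..}) \<times> space mG"
  have 1: "{a} \<inter> {0..} \<in> sets (restrict_space lborel {0..})"
    unfolding sets_restrict_space by (rule image_eqI[of _ _ "{a}"]) auto
  have "emeasure T ?N = emeasure (restrict_space lborel {0..}) ({a} \<inter> {0..}) * emeasure mG (space mG)"
    unfolding time_space_def by (rule mG.emeasure_pair_measure_Times[OF 1]) simp
  also have "\<dots> = 0" by (subst emeasure_restrict_space) (auto simp: Int_insert_left)
  finally have "?N \<in> null_sets T" using 1 unfolding time_space_def by (auto simp: null_sets_def)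
  then show ?thesis by (rule AE_I') (auto simp: space_T)
qed

lemma time_set_measurable: "A \<in> sets borel \<Longrightarrow> {z \<in> space T. fst z \<in> A} \<in> sets T"
proof -
  assume [measurable]: "A \<in> sets borel"
  have [measurable]: "fst \<in> measurable T borel"
  proof -
    have "id \<in> measurable (restrict_space lborel {0..}) (borel :: real measure)"
      by (rule measurable_restrict_space1) (simp add: measurable_ident_sets)
    from measurable_compose[OF measurable_fst this] show ?thesis by (simp add: time_space_def)
  qed
  show ?thesis by measurable
qed

lemma wiener_restrict_time:
  assumes W: "wiener h V" and A: "A \<in> sets borel"
  shows "\<exists>V'. wiener (\<lambda>z. indicator A (fst z) * h z) V'"
proof -
  obtain V' where "wiener (\<lambda>z. indicator {z \<in> space T. fst z \<in> A} z * h z) V'"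
    using wiener_restrict[OF W time_set_measurable[OF A]] by blast
  then have "wiener (\<lambda>z. indicator A (fst z) * h z) V'"
    by (rule wiener_cong) (auto simp: indicator_def)
  then show ?thesis by blast
qed

text \<open>If \<open>X\<close> integrates over times before \<open>r\<close> and \<open>V\<close> over later ones, then the variance of \<open>X \<plusminus> V\<close> is the sum
  of the variances. Hence \<open>1 + cos V\<close> and the constant equal to its mean have the same characteristic
  function on the past, and so the same integral over every past event; likewise for the sine, whose
  mean is \<open>0\<close>.\<close>

lemma char_future_given_strict_past:
  assumes W: "wiener h V" and h: "\<And>s y. s < r \<Longrightarrow> h (s, y) = 0" and A: "A \<in> events_before r"
  shows "(\<integral>\<omega>. iexp (V \<omega>) * indicator A \<omega> \<partial>M) = prob A * exp (- sq_norm h / 2)"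
proof -
  interpret L: linear_rv_family M "noise_before r" by (rule linear_noise_before)
  have [measurable]: "A \<in> sets M" using A L.generated_subset by auto
  have [measurable]: "V \<in> borel_measurable M" using wiener_moments(2)[OF W] by measurable
  define e where "e = exp (- sq_norm h / 2)"
  have e: "0 \<le> e" "e \<le> 1" unfolding e_def by auto
  have shifted: "(\<integral>\<omega>. iexp (X \<omega> + V \<omega>) \<partial>M) = (\<integral>\<omega>. iexp (X \<omega>) \<partial>M) * e"
      "(\<integral>\<omega>. iexp (X \<omega> - V \<omega>) \<partial>M) = (\<integral>\<omega>. iexp (X \<omega>) \<partial>M) * e"
    if X: "X \<in> noise_before r" for X
  proof -
    obtain k where k: "wiener k X" "\<And>s y. s \<ge> r \<Longrightarrow> k (s, y) = 0"
      using X unfolding noise_before_def by blast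
    have int: "integrable T (\<lambda>z. (k z)\<^sup>2)" "integrable T (\<lambda>z. (h z)\<^sup>2)"
      using wiener_moments(1)[OF k(1)] wiener_moments(1)[OF W] by (auto simp: square_integrable_def)
    have disj: "k z * h z = 0" for z using h[of "fst z" "snd z"] k(2)[of "fst z" "snd z"] by force
    have "(1 * k z + c * h z)\<^sup>2 = (k z)\<^sup>2 + c\<^sup>2 * (h z)\<^sup>2" for c z
    proof -
      have "(1 * k z + c * h z)\<^sup>2 = (k z)\<^sup>2 + c\<^sup>2 * (h z)\<^sup>2 + 2 * c * (k z * h z)"
        by (simp add: power2_eq_square algebra_simps)
      then show ?thesis using disj[of z] by simp
    qed
    then have "(\<integral>z. (1 * k z + c * h z)\<^sup>2 \<partial>T) = sq_norm k + c\<^sup>2 * sq_norm h" for c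
      using int by simp
    then have "(\<integral>\<omega>. iexp (1 * X \<omega> + c * V \<omega>) \<partial>M)
        = (\<integral>\<omega>. iexp (X \<omega>) \<partial>M) * exp (- (c\<^sup>2 * sq_norm h) / 2)" for c
      using wiener_moments(5)[OF wiener_lincomb[OF k(1) W, of 1 c]] wiener_moments(5)[OF k(1)]
      by (simp add: exp_add[symmetric] diff_divide_distrib del: of_real_add of_real_mult of_real_exp
          flip: of_real_mult)
    from this[of 1] this[of "- 1"] show
      "(\<integral>\<omega>. iexp (X \<omega> + V \<omega>) \<partial>M) = (\<integral>\<omega>. iexp (X \<omega>) \<partial>M) * e"
      "(\<integral>\<omega>. iexp (X \<omega> - V \<omega>) \<partial>M) = (\<integral>\<omega>. iexp (X \<omega>) \<partial>M) * e"
      by (simp_all add: e_def)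
  qed
  have int: "integrable M (\<lambda>\<omega>. iexp (Z \<omega>))" if [measurable]: "Z \<in> borel_measurable M" for Z :: "'w \<Rightarrow> real"
    by (rule integrable_const_bound[where B = 1]) auto
  have agree: "char_agree M (noise_before r) (\<lambda>\<omega>. 1 * (1 + cos (V \<omega>))) (\<lambda>_. 1 + e)"
    "char_agree M (noise_before r) (\<lambda>\<omega>. 1 * (1 + sin (V \<omega>))) (\<lambda>_. 1)"
  proof -
    have b: "0 \<le> 1 + cos x \<and> 1 + cos x \<le> 2" "0 \<le> 1 + sin x \<and> 1 + sin x \<le> 2" for x :: real
      using cos_ge_minus_one[of x] cos_le_one[of x] sin_ge_minus_one[of x] sin_le_one[of x] by linarith+
    have C: "(\<integral>\<omega>. complex_of_real (1 * (1 + cos (V \<omega>))) * iexp (X \<omega>) \<partial>M)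
        = (\<integral>\<omega>. complex_of_real (1 + e) * iexp (X \<omega>) \<partial>M)"
      and S: "(\<integral>\<omega>. complex_of_real (1 * (1 + sin (V \<omega>))) * iexp (X \<omega>) \<partial>M)
        = (\<integral>\<omega>. complex_of_real 1 * iexp (X \<omega>) \<partial>M)" if X: "X \<in> noise_before r" for X
    proof -
      have [measurable]: "X \<in> borel_measurable M" by (rule L.measurable_L[OF X])
      have i: "integrable M (\<lambda>\<omega>. iexp (X \<omega>))" "integrable M (\<lambda>\<omega>. iexp (X \<omega> + V \<omega>))" "integrable M (\<lambda>\<omega>. iexp (X \<omega> - V \<omega>))"
        by (intro int; measurable)+
      show "(\<integral>\<omega>. complex_of_real (1 * (1 + cos (V \<omega>))) * iexp (X \<omega>) \<partial>M)
        = (\<integral>\<omega>. complex_of_real (1 + e) * iexp (X \<omega>) \<partial>M)"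
        unfolding one_plus_cos_mult_iexp using i shifted[OF X]
        by (simp del: of_real_add of_real_diff) (simp add: algebra_simps)
      show "(\<integral>\<omega>. complex_of_real (1 * (1 + sin (V \<omega>))) * iexp (X \<omega>) \<partial>M)
        = (\<integral>\<omega>. complex_of_real 1 * iexp (X \<omega>) \<partial>M)"
        unfolding one_plus_sin_mult_iexp using i shifted[OF X]
        by (simp del: of_real_add of_real_diff)
    qed
    show "char_agree M (noise_before r) (\<lambda>\<omega>. 1 * (1 + cos (V \<omega>))) (\<lambda>_. 1 + e)"
      unfolding char_agree_def using b e C by (intro conjI ballI exI[of _ 2] allI) auto
    show "char_agree M (noise_before r) (\<lambda>\<omega>. 1 * (1 + sin (V \<omega>))) (\<lambda>_. 1)"
      unfolding char_agree_def using b S by (intro conjI ballI exI[of _ 2] allI) auto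
  qed
  have ind: "(\<integral>\<omega>. indicator A \<omega> \<partial>M) = prob A" using A L.generated_subset sets.sets_into_space by (simp add: Int_absorb2)
  have intr: "integrable M (\<lambda>\<omega>. indicator A \<omega> * f (V \<omega>))" if [measurable]: "f \<in> borel_measurable borel" and "\<And>x. \<bar>f x\<bar> \<le> 1"
    for f :: "real \<Rightarrow> real"
    by (rule integrable_const_bound[where B = 1]) (use that in \<open>auto simp: indicator_def\<close>)
  have "(\<integral>\<omega>. (1 * (1 + f (V \<omega>))) * indicator A \<omega> \<partial>M) = prob A + (\<integral>\<omega>. indicator A \<omega> * f (V \<omega>) \<partial>M)"
    if [measurable]: "f \<in> borel_measurable borel" and "\<And>x. \<bar>f x\<bar> \<le> 1" for f :: "real \<Rightarrow> real"
  proof -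
    have "(\<integral>\<omega>. (1 * (1 + f (V \<omega>))) * indicator A \<omega> \<partial>M) = (\<integral>\<omega>. indicator A \<omega> + indicator A \<omega> * f (V \<omega>) \<partial>M)"
      by (intro Bochner_Integration.integral_cong) (auto simp: algebra_simps)
    also have "\<dots> = (\<integral>\<omega>. indicator A \<omega> \<partial>M) + (\<integral>\<omega>. indicator A \<omega> * f (V \<omega>) \<partial>M)"
      by (intro Bochner_Integration.integral_add intr that) (auto simp: emeasure_eq_measure)
    finally show ?thesis by (simp add: ind)
  qed
  from this[of cos] this[of sin]
  have "(\<integral>\<omega>. indicator A \<omega> * cos (V \<omega>) \<partial>M) = prob A * e" "(\<integral>\<omega>. indicator A \<omega> * sin (V \<omega>) \<partial>M) = 0"
    using L.integral_weight_generated[OF A agree(1)] L.integral_weight_generated[OF A agree(2)]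
    by (simp_all add: ind distrib_left[of "prob A"] mult.commute[of "1 + e"])
  moreover have "(\<integral>\<omega>. iexp (V \<omega>) * indicator A \<omega> \<partial>M)
      = (\<integral>\<omega>. complex_of_real (indicator A \<omega> * cos (V \<omega>)) + \<i> * complex_of_real (indicator A \<omega> * sin (V \<omega>)) \<partial>M)"
    by (intro Bochner_Integration.integral_cong) (auto simp: complex_eq_iff Re_exp Im_exp indicator_def)
  moreover have "\<dots> = complex_of_real (\<integral>\<omega>. indicator A \<omega> * cos (V \<omega>) \<partial>M) + \<i> * complex_of_real (\<integral>\<omega>. indicator A \<omega> * sin (V \<omega>) \<partial>M)"
    using intr[of cos] intr[of sin]
    by (subst Bochner_Integration.integral_add)
      (simp_all only: integral_mult_right_zero integral_complex_of_real integrable_of_real integrable_mult_right abs_cos_le_one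
        abs_sin_le_one borel_measurable_cos borel_measurable_sin, measurable)
  ultimately show ?thesis unfolding e_def by simp
qed

text \<open>An event known immediately after \<open>a\<close> is known at \<open>a + 1/(n+1)\<close>, so the previous lemma applies to the
  part of \<open>V\<close> after that time. Those parts converge to \<open>V\<close>, because the time slice \<open>{a}\<close> that is lost in
  the limit is a null set.\<close>

lemma char_future_given_past:
  assumes W: "wiener h V" and h: "\<And>s y. s < a \<Longrightarrow> h (s, y) = 0" and A: "A \<in> past_events a"
  shows "(\<integral>\<omega>. iexp (V \<omega>) * indicator A \<omega> \<partial>M) = prob A * exp (- sq_norm h / 2)"
proof -
  have AM: "A \<in> sets M" using A past_events_subset by auto
  define r where "r n = a + 1 / real (Suc n)" for n
  define k where "k n z = indicator {r n..} (fst z) * h z" for n z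
  have "\<forall>n. \<exists>V'. wiener (k n) V'" unfolding k_def using wiener_restrict_time[OF W] by simp
  then obtain Vn where Vn: "\<And>n. wiener (k n) (Vn n)" by metis
  note sh = wiener_moments(1)[OF W] and sk = wiener_moments(1)[OF Vn] and sV = wiener_moments(2)[OF W]
    and sVn = wiener_moments(2)[OF Vn]
  note [measurable] = square_integrable_measurable[OF sh] square_integrable_measurable[OF sk]
  have r: "r \<longlonglongrightarrow> a"
    unfolding r_def using tendsto_add[OF tendsto_const[of a] LIMSEQ_inverse_real_of_nat]
    by (simp add: inverse_eq_divide)
  have "(\<lambda>n. \<integral>z. (k n z - h z)\<^sup>2 \<partial>T) \<longlonglongrightarrow> (\<integral>z. 0 \<partial>T)"
  proof (rule integral_dominated_convergence)
    show "integrable T (\<lambda>z. (h z)\<^sup>2)" using sh by (simp add: square_integrable_def)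
    show "AE z in T. (\<lambda>n. (k n z - h z)\<^sup>2) \<longlonglongrightarrow> 0"
      using AE_T_time_neq[of a]
    proof eventually_elim
      case (elim z)
      have "eventually (\<lambda>n. (k n z - h z)\<^sup>2 = 0) sequentially"
      proof (cases "fst z < a")
        case True
        then show ?thesis using h[of "fst z" "snd z"] by (auto simp: k_def)
      next
        case False
        with elim have "a < fst z" by simp
        from order_tendstoD(2)[OF r this] show ?thesis
          by eventually_elim (auto simp: k_def indicator_def)
      qed
      then show ?case by (rule tendsto_eventually)
    qed
    show "AE z in T. norm ((k n z - h z)\<^sup>2) \<le> (h z)\<^sup>2" for n
      by (auto simp: k_def indicator_def)
  qed simp_all
  then have lk: "L2_tendsto T k h" by (simp add: L2_tendsto_integral[OF sk sh])
  have "(\<integral>\<omega>. (Vn n \<omega> - V \<omega>)\<^sup>2 \<partial>M) = (\<integral>z. (k n z - h z)\<^sup>2 \<partial>T)" for n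
    using wiener_moments(4)[OF wiener_lincomb[OF Vn[of n] W, of 1 "- 1"]] by simp
  then have lV: "L2_tendsto M Vn V"
    using lk by (simp add: L2_tendsto_integral[OF sk sh] L2_tendsto_integral[OF sVn sV])
  have "(\<integral>\<omega>. iexp (Vn n \<omega>) * indicator A \<omega> \<partial>M) = prob A * exp (- (\<integral>z. (k n z)\<^sup>2 \<partial>T) / 2)" for n
  proof (rule char_future_given_strict_past[OF Vn])
    show "k n (s, y) = 0" if "s < r n" for s y using that by (simp add: k_def)
    have "r n > a" by (simp add: r_def)
    then show "A \<in> events_before (r n)" using A by (auto simp: past_events_def)
  qed
  moreover have "(\<lambda>n. \<integral>\<omega>. iexp (Vn n \<omega>) * indicator A \<omega> \<partial>M) \<longlonglongrightarrow> (\<integral>\<omega>. iexp (V \<omega>) * indicator A \<omega> \<partial>M)"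
    by (rule L2_tendsto_char[OF sVn sV lV AM])
  moreover have "(\<lambda>n. complex_of_real (prob A * exp (- (\<integral>z. (k n z)\<^sup>2 \<partial>T) / 2)))
      \<longlonglongrightarrow> complex_of_real (prob A * exp (- sq_norm h / 2))"
    using L2_tendsto_inner[OF sk sh lk sk sh lk]
    by (intro tendsto_intros) (simp_all add: power2_eq_square)
  ultimately show ?thesis using LIMSEQ_unique by simp
qed

text \<open>By the preceding lemma for all multiples of \<open>V\<close>, the weight \<open>1\<^sub>A\<close> and the constant \<open>P(A)\<close> give \<open>V\<close>
  the same characteristic function, so they give \<open>V\<close> the same distribution.\<close>

theorem past_indep_future:
  assumes W: "wiener h V" and h: "\<And>s y. s < a \<Longrightarrow> h (s, y) = 0"
    and Y: "Y \<in> borel_measurable (past a)"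
  shows "indep_var borel Y borel V"
proof -
  have [measurable]: "V \<in> borel_measurable M" using wiener_moments(2)[OF W] by measurable
  have prob_eq: "prob (A \<inter> (V -` B \<inter> space M)) = prob A * prob (V -` B \<inter> space M)"
    if A: "A \<in> past_events a" and B[measurable]: "B \<in> sets borel" for A B
  proof -
    have [measurable]: "A \<in> sets M" using A past_events_subset by auto
    have "(\<integral>\<omega>. indicator A \<omega> * indicator B (V \<omega>) \<partial>M) = (\<integral>\<omega>. prob A * indicator B (V \<omega>) \<partial>M)"
    proof (rule weights_agree_on_preimage[where C = 1])
      fix v
      have *: "wiener (\<lambda>z. v * h z) (\<lambda>\<omega>. v * V \<omega>)" using wiener_lincomb[OF W W, of v 0] by simp
      have "space M \<in> past_events a" unfolding past_events_def events_before_def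
        by (auto intro: sigma_sets_top)
      from char_future_given_past[OF * _ this] char_future_given_past[OF * _ A] h
      have "(\<integral>\<omega>. iexp (v * V \<omega>) * indicator A \<omega> \<partial>M)
          = prob A * (\<integral>\<omega>. iexp (v * V \<omega>) * indicator (space M) \<omega> \<partial>M)"
        by (simp add: prob_space)
      also have "(\<integral>\<omega>. iexp (v * V \<omega>) * indicator (space M) \<omega> \<partial>M) = (\<integral>\<omega>. iexp (v * V \<omega>) \<partial>M)"
        by (intro Bochner_Integration.integral_cong) auto
      finally show "(\<integral>\<omega>. complex_of_real (indicator A \<omega>) * iexp (v * V \<omega>) \<partial>M)
          = (\<integral>\<omega>. complex_of_real (prob A) * iexp (v * V \<omega>) \<partial>M)"
        by (simp add: mult.commute indicator_def of_bool_def if_distrib[of complex_of_real] cong: if_cong)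
    qed (auto simp: indicator_def)
    moreover have "(\<integral>\<omega>. indicator A \<omega> * indicator B (V \<omega>) \<partial>M) = (\<integral>\<omega>. indicat_real (A \<inter> (V -` B \<inter> space M)) \<omega> \<partial>M)"
      by (intro Bochner_Integration.integral_cong) (auto simp: indicator_def)
    moreover have "(\<integral>\<omega>. indicator B (V \<omega>) \<partial>M) = (\<integral>\<omega>. indicat_real (V -` B \<inter> space M) \<omega> \<partial>M)"
      by (intro Bochner_Integration.integral_cong) (auto simp: indicator_def)
    moreover have "A \<inter> (V -` B \<inter> space M) \<inter> space M = A \<inter> (V -` B \<inter> space M)"
      "V -` B \<inter> space M \<inter> space M = V -` B \<inter> space M" by auto
    ultimately show ?thesis by simp
  qed
  have "sigma_sets (space M) {Y -` B \<inter> space M | B. B \<in> sets borel} \<subseteq> past_events a"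
  proof (rule sigma_sets_past_events)
    have "Y -` B \<inter> space M \<in> past_events a" if "B \<in> sets borel" for B
      using measurable_sets[OF Y that] by (simp add: sets_past)
    then show "{Y -` B \<inter> space M | B. B \<in> sets borel} \<subseteq> events_before r" if "r > a" for r
      using that by (auto simp: past_events_def)
  qed
  moreover have "sigma_sets (space M) {V -` B \<inter> space M | B. B \<in> sets borel} = {V -` B \<inter> space M | B. B \<in> sets borel}"
    unfolding sets_vimage_algebra[symmetric] by (rule sets_vimage_algebra2) auto
  ultimately have "indep_set (sigma_sets (space M) {Y -` B \<inter> space M | B. B \<in> sets borel})
      (sigma_sets (space M) {V -` B \<inter> space M | B. B \<in> sets borel})"
    using prob_eq past_events_subset[of a] by (intro indep_setI) auto
  then show ?thesis unfolding indep_var_eq using measurable_past[OF Y] by simp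
qed

lemma past_mult_future:
  assumes W: "wiener h V" and h: "\<And>s y. s < a \<Longrightarrow> h (s, y) = 0"
    and Y: "Y \<in> borel_measurable (past a)"
  shows "integrable M Y \<Longrightarrow> integrable M (\<lambda>\<omega>. Y \<omega> * (V \<omega>)\<^sup>2)"
    and "integrable M Y \<Longrightarrow> (\<integral>\<omega>. Y \<omega> * (V \<omega>)\<^sup>2 \<partial>M) = (\<integral>\<omega>. Y \<omega> \<partial>M) * sq_norm h"
    and "integrable M Y \<Longrightarrow> (\<integral>\<omega>. Y \<omega> * V \<omega> \<partial>M) = 0"
    and "square_integrable M Y \<Longrightarrow> square_integrable M (\<lambda>\<omega>. Y \<omega> * V \<omega>)"
proof -
  note ind = past_indep_future[OF assms]
  have sV: "square_integrable M V" by (rule wiener_moments(2)[OF W])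
  then have iV2: "integrable M (\<lambda>\<omega>. (V \<omega>)\<^sup>2)" by (simp add: square_integrable_def)
  have iV1: "integrable M V"
    by (rule square_integrable_imp_integrable[OF square_integrable_measurable[OF sV] iV2])
  note iV = iV1 iV2
  have ind2: "indep_var borel Y borel (\<lambda>\<omega>. (V \<omega>)\<^sup>2)"
    using indep_var_compose[OF ind, of "\<lambda>x. x" borel "\<lambda>x. x\<^sup>2" borel] by (simp add: comp_def)
  have ind22: "indep_var borel (\<lambda>\<omega>. (Y \<omega>)\<^sup>2) borel (\<lambda>\<omega>. (V \<omega>)\<^sup>2)"
    using indep_var_compose[OF ind, of "\<lambda>x. x\<^sup>2" borel "\<lambda>x. x\<^sup>2" borel] by (simp add: comp_def)
  show "integrable M (\<lambda>\<omega>. Y \<omega> * (V \<omega>)\<^sup>2)" if "integrable M Y"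
    by (rule indep_var_integrable[OF ind2 that iV(2)])
  show "(\<integral>\<omega>. Y \<omega> * (V \<omega>)\<^sup>2 \<partial>M) = (\<integral>\<omega>. Y \<omega> \<partial>M) * sq_norm h" if "integrable M Y"
    using indep_var_lebesgue_integral[OF ind2 that iV(2)] wiener_moments(4)[OF W] by simp
  show "(\<integral>\<omega>. Y \<omega> * V \<omega> \<partial>M) = 0" if "integrable M Y"
    using indep_var_lebesgue_integral[OF ind that iV(1)] wiener_moments(3)[OF W] by simp
  show "square_integrable M (\<lambda>\<omega>. Y \<omega> * V \<omega>)" if "square_integrable M Y"
  proof -
    have "integrable M (\<lambda>\<omega>. (Y \<omega>)\<^sup>2 * (V \<omega>)\<^sup>2)"
      using that by (intro indep_var_integrable[OF ind22 _ iV(2)]) (simp add: square_integrable_def)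
    then show ?thesis using that sV by (auto simp: square_integrable_def power_mult_distrib)
  qed
qed

text \<open>Split \<open>V = A + B\<close> at time \<open>b\<close>. The part \<open>A\<close> belongs to the past of \<open>b\<close>, so \<open>Y A Y'\<close> is independent of the
  centred \<open>V'\<close> and contributes nothing. The pair \<open>(B, V')\<close> belongs to the future, and polarisation reduces
  its contribution to second moments of \<open>B \<plusminus> V'\<close>.\<close>

lemma isometry_ordered:
  assumes ab: "a \<le> b"
    and Y: "Y \<in> borel_measurable (past a)" "square_integrable M Y"
    and Y': "Y' \<in> borel_measurable (past b)" "square_integrable M Y'"
    and W: "wiener h V" "\<And>s y. s < a \<Longrightarrow> h (s, y) = 0"
    and W': "wiener h' V'" "\<And>s y. s < b \<Longrightarrow> h' (s, y) = 0"
  shows "(\<integral>\<omega>. (Y \<omega> * V \<omega>) * (Y' \<omega> * V' \<omega>) \<partial>M) = (\<integral>\<omega>. Y \<omega> * Y' \<omega> \<partial>M) * (\<integral>z. h z * h' z \<partial>T)"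
proof -
  define k where "k z = indicator {..<b} (fst z) * h z" for z
  obtain A where A: "wiener k A" unfolding k_def using wiener_restrict_time[OF W(1), of "{..<b}"] by auto
  define B where "B \<omega> = V \<omega> - A \<omega>" for \<omega>
  define l where "l z = h z - k z" for z
  have B: "wiener l B" using wiener_lincomb[OF W(1) A, of 1 "- 1"] unfolding l_def[abs_def] B_def[abs_def] by simp
  have k0: "k (s, y) = 0" if "s < a \<or> s \<ge> b" for s y using that W(2) by (auto simp: k_def)
  have l0: "l (s, y) = 0" if "s < b" for s y using that by (simp add: l_def k_def)
  have lh: "l z * h' z = h z * h' z" for z using W'(2)[of "fst z" "snd z"] by (cases "fst z < b") (auto simp: l_def k_def)
  have Yb: "Y \<in> borel_measurable (past b)" by (rule measurable_past_mono[OF ab Y(1)])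
  have Ab: "A \<in> borel_measurable (past b)" by (rule noise_measurable_past[OF A]) (simp add: k0)
  have sYA: "square_integrable M (\<lambda>\<omega>. Y \<omega> * A \<omega>)"
    by (rule past_mult_future(4)[OF A _ Y]) (simp add: k0)
  have sYV: "square_integrable M (\<lambda>\<omega>. Y \<omega> * V \<omega>)" by (rule past_mult_future(4)[OF W Y])
  have sYV': "square_integrable M (\<lambda>\<omega>. Y' \<omega> * V' \<omega>)" by (rule past_mult_future(4)[OF W' Y'])
  \<comment> \<open>\<open>Y A Y'\<close> is integrable because \<open>Y A\<close> is in \<open>L\<^sup>2\<close>, by independence at the earlier time \<open>a\<close>.\<close>
  have iYAY: "integrable M (\<lambda>\<omega>. (Y \<omega> * A \<omega>) * Y' \<omega>)" by (rule square_integrable_mult[OF sYA Y'(2)])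
  have "(\<integral>\<omega>. ((Y \<omega> * A \<omega>) * Y' \<omega>) * V' \<omega> \<partial>M) = 0"
  proof (rule past_mult_future(3)[OF W'(1), where a = b])
    show "(\<lambda>\<omega>. (Y \<omega> * A \<omega>) * Y' \<omega>) \<in> borel_measurable (past b)" by (intro borel_measurable_times Yb Ab Y')
  qed (use W'(2) iYAY in auto)
  then have A0: "(\<integral>\<omega>. (Y \<omega> * A \<omega>) * (Y' \<omega> * V' \<omega>) \<partial>M) = 0" by (simp add: mult_ac)
  have YY: "(\<lambda>\<omega>. Y \<omega> * Y' \<omega>) \<in> borel_measurable (past b)" by (intro borel_measurable_times Yb Y')
  have iYY: "integrable M (\<lambda>\<omega>. Y \<omega> * Y' \<omega>)" by (rule square_integrable_mult[OF Y(2) Y'(2)])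
  define e where "e c \<omega> = 1 * B \<omega> + c * V' \<omega>" for c \<omega>
  define g where "g c z = 1 * l z + c * h' z" for c z
  have eg: "wiener (g c) (e c)" for c
    unfolding e_def[abs_def] g_def[abs_def] by (rule wiener_lincomb[OF B W'(1)])
  have g0: "g c (s, y) = 0" if "s < b" for c s y using that l0 W'(2) by (simp add: g_def)
  note P = past_mult_future(1,2)[OF eg g0 YY iYY]
  have sl: "square_integrable T l" and sh: "square_integrable T h'" using wiener_moments(1)[OF B] wiener_moments(1)[OF W'(1)] .
  have sg: "square_integrable T (g c)" for c by (rule wiener_moments(1)[OF eg])
  have "(\<integral>\<omega>. (Y \<omega> * B \<omega>) * (Y' \<omega> * V' \<omega>) \<partial>M)
      = (\<integral>\<omega>. ((Y \<omega> * Y' \<omega>) * (e 1 \<omega>)\<^sup>2 - (Y \<omega> * Y' \<omega>) * (e (- 1) \<omega>)\<^sup>2) / 4 \<partial>M)"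
    by (intro Bochner_Integration.integral_cong refl) (simp add: e_def power2_eq_square algebra_simps)
  also have "\<dots> = ((\<integral>\<omega>. (Y \<omega> * Y' \<omega>) * (e 1 \<omega>)\<^sup>2 \<partial>M) - (\<integral>\<omega>. (Y \<omega> * Y' \<omega>) * (e (- 1) \<omega>)\<^sup>2 \<partial>M)) / 4"
    using P(1)[of 1] P(1)[of "- 1"] by simp
  also have "\<dots> = (\<integral>\<omega>. Y \<omega> * Y' \<omega> \<partial>M) * (((\<integral>z. (g 1 z)\<^sup>2 \<partial>T) - (\<integral>z. (g (- 1) z)\<^sup>2 \<partial>T)) / 4)"
    by (simp only: P(2) right_diff_distrib times_divide_eq_right)
  also have "((\<integral>z. (g 1 z)\<^sup>2 \<partial>T) - (\<integral>z. (g (- 1) z)\<^sup>2 \<partial>T)) / 4 = (\<integral>z. ((g 1 z)\<^sup>2 - (g (- 1) z)\<^sup>2) / 4 \<partial>T)"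
    using sg[of 1] sg[of "- 1"] by (simp add: square_integrable_def)
  also have "\<dots> = (\<integral>z. h z * h' z \<partial>T)"
    unfolding lh[symmetric] by (intro Bochner_Integration.integral_cong refl) (simp add: g_def power2_eq_square algebra_simps)
  finally have B1: "(\<integral>\<omega>. (Y \<omega> * B \<omega>) * (Y' \<omega> * V' \<omega>) \<partial>M) = (\<integral>\<omega>. Y \<omega> * Y' \<omega> \<partial>M) * (\<integral>z. h z * h' z \<partial>T)" .
  have sYB: "square_integrable M (\<lambda>\<omega>. Y \<omega> * B \<omega>)"
    using square_integrable_diff[OF sYV sYA] by (simp add: B_def algebra_simps)
  have "(\<integral>\<omega>. (Y \<omega> * V \<omega>) * (Y' \<omega> * V' \<omega>) \<partial>M)
      = (\<integral>\<omega>. (Y \<omega> * A \<omega>) * (Y' \<omega> * V' \<omega>) + (Y \<omega> * B \<omega>) * (Y' \<omega> * V' \<omega>) \<partial>M)"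
    by (intro Bochner_Integration.integral_cong refl) (simp add: B_def algebra_simps)
  also have "\<dots> = (\<integral>\<omega>. (Y \<omega> * A \<omega>) * (Y' \<omega> * V' \<omega>) \<partial>M) + (\<integral>\<omega>. (Y \<omega> * B \<omega>) * (Y' \<omega> * V' \<omega>) \<partial>M)"
    by (intro Bochner_Integration.integral_add square_integrable_mult sYA sYB sYV')
  finally show ?thesis using A0 B1 by simp
qed

lemma isometry_pair:
  assumes Y: "Y \<in> borel_measurable (past a)" "square_integrable M Y"
    and Y': "Y' \<in> borel_measurable (past b)" "square_integrable M Y'"
    and W: "wiener h V" "\<And>s y. s < a \<Longrightarrow> h (s, y) = 0"
    and W': "wiener h' V'" "\<And>s y. s < b \<Longrightarrow> h' (s, y) = 0"
  shows "(\<integral>\<omega>. (Y \<omega> * V \<omega>) * (Y' \<omega> * V' \<omega>) \<partial>M) = (\<integral>\<omega>. Y \<omega> * Y' \<omega> \<partial>M) * (\<integral>z. h z * h' z \<partial>T)"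
proof (cases "a \<le> b")
  case True
  then show ?thesis using isometry_ordered[OF True Y Y' W W'] by simp
next
  case False
  then have "b \<le> a" by simp
  from isometry_ordered[OF this Y' Y W' W] show ?thesis by (simp add: mult.commute)
qed

text \<open>Both sides expand into the same double sum over pairs, by \<open>isometry_pair\<close> on the left and by
  exchanging the finite sums with the integral on the right.\<close>

theorem isometry_sum:
  fixes n :: nat
  assumes Y: "\<And>i. i < n \<Longrightarrow> Y i \<in> borel_measurable (past (a i))" "\<And>i. i < n \<Longrightarrow> square_integrable M (Y i)"
    and W: "\<And>i. i < n \<Longrightarrow> wiener (h i) (V i)" "\<And>i s y. i < n \<Longrightarrow> s < a i \<Longrightarrow> h i (s, y) = 0"
  shows "L2_norm_sq M (\<lambda>\<omega>. \<Sum>i<n. Y i \<omega> * V i \<omega>) = (\<integral>\<^sup>+z. L2_norm_sq M (\<lambda>\<omega>. \<Sum>i<n. Y i \<omega> * h i z) \<partial>T)"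
proof -
  let ?c = "\<lambda>i j. \<integral>\<omega>. Y i \<omega> * Y j \<omega> \<partial>M"
  have sh: "square_integrable T (h i)" if "i < n" for i using wiener_moments(1)[OF W(1)[OF that]] .
  have sYV: "square_integrable M (\<lambda>\<omega>. Y i \<omega> * V i \<omega>)" if "i < n" for i
    by (rule past_mult_future(4)[OF W(1)[OF that] W(2)[OF that] Y(1)[OF that] Y(2)[OF that]])
  have sq: "(\<Sum>i<n. x i)\<^sup>2 = (\<Sum>i<n. \<Sum>j<n. x i * x j)" for x :: "nat \<Rightarrow> real"
    by (simp add: power2_eq_square sum_product)
  have "L2_norm_sq M (\<lambda>\<omega>. \<Sum>i<n. Y i \<omega> * V i \<omega>) = ennreal (\<integral>\<omega>. (\<Sum>i<n. Y i \<omega> * V i \<omega>)\<^sup>2 \<partial>M)"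
    using sYV by (intro L2_norm_sq_eq_integral square_integrable_sum) auto
  also have "(\<integral>\<omega>. (\<Sum>i<n. Y i \<omega> * V i \<omega>)\<^sup>2 \<partial>M) = (\<Sum>i<n. \<Sum>j<n. \<integral>\<omega>. (Y i \<omega> * V i \<omega>) * (Y j \<omega> * V j \<omega>) \<partial>M)"
    unfolding sq using square_integrable_mult[OF sYV sYV]
    by (subst Bochner_Integration.integral_sum; (intro Bochner_Integration.integrable_sum)?; simp?)+
  also have "\<dots> = (\<Sum>i<n. \<Sum>j<n. ?c i j * (\<integral>z. h i z * h j z \<partial>T))"
    by (intro sum.cong refl isometry_pair) (use Y W in auto)
  also have "\<dots> = (\<integral>z. (\<Sum>i<n. \<Sum>j<n. ?c i j * (h i z * h j z)) \<partial>T)"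
    using square_integrable_mult[OF sh sh]
    by (subst Bochner_Integration.integral_sum; (intro Bochner_Integration.integrable_sum)?; simp?)+
  finally have 1: "L2_norm_sq M (\<lambda>\<omega>. \<Sum>i<n. Y i \<omega> * V i \<omega>)
    = ennreal (\<integral>z. (\<Sum>i<n. \<Sum>j<n. ?c i j * (h i z * h j z)) \<partial>T)" .
  have 2: "L2_norm_sq M (\<lambda>\<omega>. \<Sum>i<n. Y i \<omega> * h i z) = ennreal (\<Sum>i<n. \<Sum>j<n. ?c i j * (h i z * h j z))"
    and 3: "0 \<le> (\<Sum>i<n. \<Sum>j<n. ?c i j * (h i z * h j z))" for z
  proof -
    have sY: "square_integrable M (\<lambda>\<omega>. Y i \<omega> * h i z)" if "i < n" for i
      using square_integrable_cmult[OF Y(2)[OF that], of "h i z"] by (simp add: mult.commute)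
    have "(\<integral>\<omega>. (\<Sum>i<n. Y i \<omega> * h i z)\<^sup>2 \<partial>M) = (\<Sum>i<n. \<Sum>j<n. \<integral>\<omega>. (Y i \<omega> * h i z) * (Y j \<omega> * h j z) \<partial>M)"
      unfolding sq using square_integrable_mult[OF sY sY]
      by (subst Bochner_Integration.integral_sum; (intro Bochner_Integration.integrable_sum)?; simp?)+
    also have "\<dots> = (\<Sum>i<n. \<Sum>j<n. ?c i j * (h i z * h j z))"
    proof (intro sum.cong refl)
      fix i j
      have "(\<integral>\<omega>. (Y i \<omega> * h i z) * (Y j \<omega> * h j z) \<partial>M) = (\<integral>\<omega>. (Y i \<omega> * Y j \<omega>) * (h i z * h j z) \<partial>M)"
        by (intro Bochner_Integration.integral_cong refl) (simp add: mult_ac)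
      then show "(\<integral>\<omega>. (Y i \<omega> * h i z) * (Y j \<omega> * h j z) \<partial>M) = ?c i j * (h i z * h j z)"
        by (simp only: integral_mult_left_zero)
    qed
    finally have eq: "(\<integral>\<omega>. (\<Sum>i<n. Y i \<omega> * h i z)\<^sup>2 \<partial>M) = (\<Sum>i<n. \<Sum>j<n. ?c i j * (h i z * h j z))" .
    have "0 \<le> (\<integral>\<omega>. (\<Sum>i<n. Y i \<omega> * h i z)\<^sup>2 \<partial>M)" by (rule integral_nonneg_AE) simp
    then show "0 \<le> (\<Sum>i<n. \<Sum>j<n. ?c i j * (h i z * h j z))" by (simp only: eq)
    have "square_integrable M (\<lambda>\<omega>. \<Sum>i<n. Y i \<omega> * h i z)" using sY by (intro square_integrable_sum) auto
    from L2_norm_sq_eq_integral[OF this]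
    show "L2_norm_sq M (\<lambda>\<omega>. \<Sum>i<n. Y i \<omega> * h i z) = ennreal (\<Sum>i<n. \<Sum>j<n. ?c i j * (h i z * h j z))"
      by (simp only: eq)
  qed
  have "integrable T (\<lambda>z. \<Sum>i<n. \<Sum>j<n. ?c i j * (h i z * h j z))"
    using square_integrable_mult[OF sh sh] by (intro Bochner_Integration.integrable_sum integrable_mult_right) auto
  from nn_integral_eq_integral[OF this] show ?thesis using 1 2 3 by simp
qed

end

section \<open>Energy of the stochastic convolution\<close>

lemma esqrt_squared: "esqrt a * esqrt a = a"
  by (cases a) (auto simp: esqrt_def ennreal_mult[symmetric] ennreal_mult_eq_top_iff)

lemma expected_L2_norm_sq_le_field_norm:
  assumes "t \<ge> 0"
  shows "expected_L2_norm_sq M mG Z t \<le> ennreal (exp (2 * \<beta> * t)) * (field_norm M mG \<beta> Z * field_norm M mG \<beta> Z)"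
proof -
  let ?E = "expected_L2_norm_sq M mG Z t"
  have "esqrt (ennreal (exp (- 2 * \<beta> * t)) * ?E) \<le> field_norm M mG \<beta> Z"
    unfolding field_norm_def using assms by (intro SUP_upper) simp
  then have "ennreal (exp (- 2 * \<beta> * t)) * ?E \<le> field_norm M mG \<beta> Z * field_norm M mG \<beta> Z"
    using mult_mono[of "esqrt (ennreal (exp (- 2 * \<beta> * t)) * ?E)" "field_norm M mG \<beta> Z"
        "esqrt (ennreal (exp (- 2 * \<beta> * t)) * ?E)" "field_norm M mG \<beta> Z"] by (simp add: esqrt_squared)
  then have "ennreal (exp (2 * \<beta> * t)) * (ennreal (exp (- 2 * \<beta> * t)) * ?E)
      \<le> ennreal (exp (2 * \<beta> * t)) * (field_norm M mG \<beta> Z * field_norm M mG \<beta> Z)"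
    by (rule mult_left_mono) simp
  then show ?thesis by (simp add: mult.assoc[symmetric] ennreal_mult[symmetric] exp_add[symmetric])
qed

context white_noise_space
begin

abbreviation mean_sq where "mean_sq \<equiv> expected_L2_norm_sq M mG"
abbreviation time where "time \<equiv> restrict_space lborel {0::real..}"

lemma random_field_iff:
  "random_field M mG Z \<longleftrightarrow> (\<lambda>(\<omega>, t, x). Z t x \<omega>) \<in> borel_measurable (M \<Otimes>\<^sub>M time \<Otimes>\<^sub>M mG)"
proof -
  have "sets (restrict_space borel {0::real..}) = sets time" by (simp add: sets_restrict_space)
  then show ?thesis
    unfolding random_field_def by (intro arg_cong2[where f = "(\<in>)"] measurable_cong_sets sets_pair_measure_cong refl)
qed

text \<open>The product measurability of a random field, rearranged for the orders of integration used later.\<close>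

lemma random_field_measurable:
  assumes Z: "random_field M mG Z"
  shows "(\<lambda>((s, \<omega>), x). Z s x \<omega>) \<in> borel_measurable ((time \<Otimes>\<^sub>M M) \<Otimes>\<^sub>M mG)"
    and "(\<lambda>((s, x), \<omega>). Z s x \<omega>) \<in> borel_measurable ((time \<Otimes>\<^sub>M mG) \<Otimes>\<^sub>M M)"
    and "t \<ge> 0 \<Longrightarrow> (\<lambda>(\<omega>, x). Z t x \<omega>) \<in> borel_measurable (M \<Otimes>\<^sub>M mG)"
    and "t \<ge> 0 \<Longrightarrow> \<omega> \<in> space M \<Longrightarrow> (\<lambda>x. Z t x \<omega>) \<in> borel_measurable mG"
    and "t \<ge> 0 \<Longrightarrow> x \<in> space mG \<Longrightarrow> Z t x \<in> borel_measurable M"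
proof -
  note rf = Z[unfolded random_field_iff]
  have "(\<lambda>p. (snd (fst p), fst (fst p), snd p)) \<in> (time \<Otimes>\<^sub>M M) \<Otimes>\<^sub>M mG \<rightarrow>\<^sub>M M \<Otimes>\<^sub>M time \<Otimes>\<^sub>M mG" by measurable
  from measurable_compose[OF this rf]
  show "(\<lambda>((s, \<omega>), x). Z s x \<omega>) \<in> borel_measurable ((time \<Otimes>\<^sub>M M) \<Otimes>\<^sub>M mG)" by (simp add: case_prod_unfold)
  have "(\<lambda>p. (snd p, fst (fst p), snd (fst p))) \<in> (time \<Otimes>\<^sub>M mG) \<Otimes>\<^sub>M M \<rightarrow>\<^sub>M M \<Otimes>\<^sub>M time \<Otimes>\<^sub>M mG" by measurable
  from measurable_compose[OF this rf]
  show "(\<lambda>((s, x), \<omega>). Z s x \<omega>) \<in> borel_measurable ((time \<Otimes>\<^sub>M mG) \<Otimes>\<^sub>M M)" by (simp add: case_prod_unfold)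
  assume "t \<ge> 0"
  then have t: "t \<in> space time" by (simp add: space_restrict_space)
  then have "(\<lambda>p. (fst p, t, snd p)) \<in> M \<Otimes>\<^sub>M mG \<rightarrow>\<^sub>M M \<Otimes>\<^sub>M time \<Otimes>\<^sub>M mG" by measurable
  from measurable_compose[OF this rf]
  show m: "(\<lambda>(\<omega>, x). Z t x \<omega>) \<in> borel_measurable (M \<Otimes>\<^sub>M mG)" by (simp add: case_prod_unfold)
  show "(\<lambda>x. Z t x \<omega>) \<in> borel_measurable mG" if "\<omega> \<in> space M"
    using measurable_compose[OF measurable_Pair1'[OF that] m] by simp
  show "Z t x \<in> borel_measurable M" if "x \<in> space mG"
    using measurable_compose[OF measurable_Pair2'[OF that] m] by simp
qed

lemma random_field_L2_measurable:
  assumes Z: "random_field M mG Z"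
  shows "(\<lambda>s. mean_sq Z s) \<in> borel_measurable time"
    and "t \<ge> 0 \<Longrightarrow> (\<lambda>\<omega>. L2_norm_sq mG (\<lambda>x. Z t x \<omega>)) \<in> borel_measurable M"
proof -
  interpret mG: sigma_finite_measure mG by (rule sigma_finite_mG)
  have "(\<lambda>(p, x). ennreal ((Z (fst p) x (snd p))\<^sup>2)) \<in> borel_measurable ((time \<Otimes>\<^sub>M M) \<Otimes>\<^sub>M mG)"
    using measurable_compose[OF random_field_measurable(1)[OF Z], of "\<lambda>r. ennreal (r\<^sup>2)" borel]
    by (simp add: case_prod_unfold)
  from mG.borel_measurable_nn_integral[OF this]
  have "(\<lambda>(s, \<omega>). \<integral>\<^sup>+x. ennreal ((Z s x \<omega>)\<^sup>2) \<partial>mG) \<in> borel_measurable (time \<Otimes>\<^sub>M M)"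
    by (simp add: case_prod_unfold)
  from borel_measurable_nn_integral[OF this]
  show "(\<lambda>s. mean_sq Z s) \<in> borel_measurable time"
    unfolding expected_L2_norm_sq_def L2_norm_sq_def .
  assume t: "t \<ge> 0"
  have "(\<lambda>(\<omega>, x). ennreal ((Z t x \<omega>)\<^sup>2)) \<in> borel_measurable (M \<Otimes>\<^sub>M mG)"
    using measurable_compose[OF random_field_measurable(3)[OF Z t], of "\<lambda>r. ennreal (r\<^sup>2)" borel]
    by (simp add: case_prod_unfold)
  from mG.borel_measurable_nn_integral[OF this]
  show "(\<lambda>\<omega>. L2_norm_sq mG (\<lambda>x. Z t x \<omega>)) \<in> borel_measurable M"
    unfolding L2_norm_sq_def .
qed

lemma random_field_diff:
  assumes "random_field M mG Z" "random_field M mG Y"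
  shows "random_field M mG (\<lambda>t x \<omega>. Z t x \<omega> - Y t x \<omega>)"
  using borel_measurable_diff[OF assms[unfolded random_field_def]]
  unfolding random_field_def by (simp add: case_prod_unfold)

lemma random_field_sum:
  assumes "\<And>i. i \<in> I \<Longrightarrow> random_field M mG (Z i)"
  shows "random_field M mG (\<lambda>t x \<omega>. \<Sum>i\<in>I. Z i t x \<omega>)"
  using borel_measurable_sum[of I "\<lambda>i (\<omega>, t, x). Z i t x \<omega>" "M \<Otimes>\<^sub>M restrict_space borel {0..} \<Otimes>\<^sub>M mG"] assms
  unfolding random_field_def by (simp add: case_prod_unfold)

lemma expected_L2_norm_sq_triangle:
  assumes Z: "random_field M mG Z" and Y: "random_field M mG Y" and t: "t \<ge> 0"
  shows "mean_sq Y t \<le> 2 * mean_sq (\<lambda>t x \<omega>. Z t x \<omega> - Y t x \<omega>) t + 2 * mean_sq Z t"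
    and "mean_sq Z t \<le> 2 * mean_sq (\<lambda>t x \<omega>. Z t x \<omega> - Y t x \<omega>) t + 2 * mean_sq Y t"
proof -
  note m[measurable] = random_field_L2_measurable(2)[OF Z t] random_field_L2_measurable(2)[OF Y t]
    random_field_L2_measurable(2)[OF random_field_diff[OF Z Y] t]
  note tri = L2_norm_sq_triangle[OF random_field_measurable(4)[OF Z t] random_field_measurable(4)[OF Y t]]
  show "mean_sq Y t \<le> 2 * mean_sq (\<lambda>t x \<omega>. Z t x \<omega> - Y t x \<omega>) t + 2 * mean_sq Z t"
  proof -
    have "mean_sq Y t
        \<le> (\<integral>\<^sup>+\<omega>. 2 * L2_norm_sq mG (\<lambda>x. Z t x \<omega> - Y t x \<omega>) + 2 * L2_norm_sq mG (\<lambda>x. Z t x \<omega>) \<partial>M)"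
      unfolding expected_L2_norm_sq_def by (intro nn_integral_mono tri(1))
    then show ?thesis
      unfolding expected_L2_norm_sq_def by (simp add: nn_integral_add nn_integral_cmult)
  qed
  show "mean_sq Z t \<le> 2 * mean_sq (\<lambda>t x \<omega>. Z t x \<omega> - Y t x \<omega>) t + 2 * mean_sq Y t"
  proof -
    have "mean_sq Z t
        \<le> (\<integral>\<^sup>+\<omega>. 2 * L2_norm_sq mG (\<lambda>x. Z t x \<omega> - Y t x \<omega>) + 2 * L2_norm_sq mG (\<lambda>x. Y t x \<omega>) \<partial>M)"
      unfolding expected_L2_norm_sq_def by (intro nn_integral_mono tri(2))
    then show ?thesis
      unfolding expected_L2_norm_sq_def by (simp add: nn_integral_add nn_integral_cmult)
  qed
qed

lemma expected_L2_norm_sq_swap: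
  assumes Z: "random_field M mG Z" and t: "t \<ge> 0"
  shows "mean_sq Z t = (\<integral>\<^sup>+x. L2_norm_sq M (Z t x) \<partial>mG)"
proof -
  interpret mG: sigma_finite_measure mG by (rule sigma_finite_mG)
  interpret P: pair_sigma_finite M mG ..
  note [measurable] = random_field_measurable(3)[OF Z t]
  show ?thesis
    unfolding expected_L2_norm_sq_def L2_norm_sq_def
    by (rule P.Fubini'[symmetric]) measurable
qed

end

text \<open>Joint measurability of the kernel is assumed for the product of the Borel algebras, which may be
  smaller than the Borel algebra of the product. The indicator fixes the value \<open>0\<close> at times without a
  kernel.\<close>

locale stochastic_convolution_space = white_noise_space M mG \<xi>
  for M :: "'w measure" and mG :: "'g::{topological_ab_group_add, t2_space} measure" and \<xi> +
  fixes K :: "real \<Rightarrow> 'g \<Rightarrow> real"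
  assumes sets_mG: "sets mG = sets borel"
    and translation_invariant: "\<And>f y. f \<in> borel_measurable mG \<Longrightarrow> (\<integral>\<^sup>+x. f (x + y) \<partial>mG) = (\<integral>\<^sup>+x. f x \<partial>mG)"
    and kernel_measurable:
      "(\<lambda>((s, y), x). indicator {0<..} s * K s (y - x)) \<in> borel_measurable ((borel \<Otimes>\<^sub>M mG) \<Otimes>\<^sub>M mG)"
begin

lemma space_mG: "space mG = UNIV"
  using sets_eq_imp_space_eq[OF sets_mG] by simp

definition kernel_energy :: "real \<Rightarrow> ennreal" where
  "kernel_energy s = (\<integral>\<^sup>+x. ennreal ((indicator {0<..} s * K s (- x))\<^sup>2) \<partial>mG)"

lemma kernel_energy_shift:
  "(\<integral>\<^sup>+x. ennreal ((indicator {0<..} s * K s (y - x))\<^sup>2) \<partial>mG) = kernel_energy s"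
proof -
  have "(\<lambda>x. ((s, y), x)) \<in> mG \<rightarrow>\<^sub>M (borel \<Otimes>\<^sub>M mG) \<Otimes>\<^sub>M mG"
    by (intro measurable_Pair1') (simp add: space_pair_measure space_mG)
  from measurable_compose[OF this kernel_measurable]
  have [measurable]: "(\<lambda>x. indicator {0<..} s * K s (y - x)) \<in> borel_measurable mG" by simp
  have "(\<integral>\<^sup>+x. ennreal ((indicator {0<..} s * K s (y - x))\<^sup>2) \<partial>mG)
      = (\<integral>\<^sup>+x. ennreal ((indicator {0<..} s * K s (y - (x + y)))\<^sup>2) \<partial>mG)"
    by (rule translation_invariant[symmetric]) measurable
  then show ?thesis by (simp add: kernel_energy_def)
qed

lemma kernel_energy_measurable [measurable]: "kernel_energy \<in> borel_measurable borel"
proof -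
  interpret mG: sigma_finite_measure mG by (rule sigma_finite_mG)
  have "(\<lambda>p. ((fst p, 0), snd p)) \<in> borel \<Otimes>\<^sub>M mG \<rightarrow>\<^sub>M (borel \<Otimes>\<^sub>M mG) \<Otimes>\<^sub>M mG"
    by (intro measurable_Pair measurable_fst measurable_snd measurable_const) (simp add: space_mG)
  from measurable_compose[OF this kernel_measurable]
  have [measurable]: "(\<lambda>(s, x). indicator {0<..} s * K s (- x)) \<in> borel_measurable (borel \<Otimes>\<^sub>M mG)"
    by (simp add: case_prod_unfold)
  show ?thesis unfolding kernel_energy_def[abs_def] by measurable
qed

text \<open>The right-hand side of the isometry; the factor \<open>kernel_energy (t - s)\<close> vanishes for \<open>s \<ge> t\<close>.\<close>

definition convolution_energy :: "real \<Rightarrow> (real \<Rightarrow> 'g \<Rightarrow> 'w \<Rightarrow> real) \<Rightarrow> ennreal" where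
  "convolution_energy t Z = (\<integral>\<^sup>+s. kernel_energy (t - s) * mean_sq Z s \<partial>time)"

lemma elementary_random_field:
  assumes "elementary_data M mG \<xi> Y a b \<psi>"
  shows "random_field M mG (elementary_field Y a b \<psi>)"
proof -
  have [measurable]: "Y \<in> borel_measurable M" using assms by (auto simp: elementary_data_def square_integrable_def)
  have "\<psi> \<in> borel_measurable borel"
    using assms by (auto simp: elementary_data_def intro: borel_measurable_continuous_onI)
  then have [measurable]: "\<psi> \<in> borel_measurable mG" using sets_mG by (simp cong: measurable_cong_sets)
  have [measurable]: "(\<lambda>s. indicat_real {a..<b} s) \<in> borel_measurable time"
    by (intro measurable_restrict_space1) simp
  show ?thesis unfolding random_field_iff elementary_field_def by measurable
qed

text \<open>For each \<open>x\<close> the sum of the integrands is the kernel times the simple field, so \<open>isometry_sum\<close> gives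
  the second moment at \<open>x\<close>. Integrating over \<open>x\<close> first replaces the squared kernel by its energy, which
  by translation invariance is the same for every \<open>y\<close>.\<close>

lemma convolution_isometry:
  assumes conv: "simple_convolution M mG \<xi> K S W" and t: "t \<ge> 0"
  shows "random_field M mG S" "random_field M mG W" "mean_sq W t = convolution_energy t S"
proof -
  interpret mG: sigma_finite_measure mG by (rule sigma_finite_mG)
  interpret tm: sigma_finite_measure time
    by (rule sigma_finite_measure_restrict_space[OF sigma_finite_lborel]) simp
  interpret MG: pair_sigma_finite M mG ..
  interpret tG: pair_sigma_finite time mG ..
  interpret TG: pair_sigma_finite T mG unfolding time_space_def by unfold_locales
  from conv obtain n Y a b \<psi> Wi where
    data: "\<And>i. i < (n::nat) \<Longrightarrow> elementary_data M mG \<xi> (Y i) (a i) (b i) (\<psi> i)"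
    and Wi: "\<And>i. i < n \<Longrightarrow> elementary_convolution M mG \<xi> K (Y i) (a i) (b i) (\<psi> i) (Wi i)"
    and S: "S = (\<lambda>t x \<omega>. \<Sum>i<n. elementary_field (Y i) (a i) (b i) (\<psi> i) t x \<omega>)"
    and W: "W = (\<lambda>t x \<omega>. \<Sum>i<n. Wi i t x \<omega>)"
    unfolding simple_convolution_def by blast
  show rS: "random_field M mG S"
    unfolding S using data by (intro random_field_sum elementary_random_field) auto
  show rW: "random_field M mG W"
    unfolding W using Wi by (intro random_field_sum) (auto simp: elementary_convolution_def)
  have Y: "Y i \<in> borel_measurable (past (a i))" "square_integrable M (Y i)" if "i < n" for i
    using data[OF that] by (auto simp: elementary_data_def intro: noise_filtration_measurable_past)
  define k where "k z x = indicator {0<..} (t - fst z) * K (t - fst z) (snd z - x)" for z :: "real \<times> 'g" and x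
  define q where "q z = L2_norm_sq M (S (fst z) (snd z))" for z :: "real \<times> 'g"
  \<comment> \<open>The indicators of \<open>{0<..<t}\<close> and \<open>{..<t}\<close> differ at time \<open>0\<close>, a null set.\<close>
  have pointwise: "L2_norm_sq M (W t x) = (\<integral>\<^sup>+z. ennreal ((k z x)\<^sup>2) * q z \<partial>T)" for x
  proof -
    define h where "h i = (\<lambda>(s, y). indicator {0<..<t} s * indicator {a i..<b i} s * K (t - s) (y - x) * \<psi> i y)" for i
    have "\<forall>i<n. \<exists>V. wiener (h i) V \<and> (AE \<omega> in M. Wi i t x \<omega> = Y i \<omega> * V \<omega>)"
      using Wi t unfolding elementary_convolution_def h_def by blast
    then obtain V where V: "\<And>i. i < n \<Longrightarrow> wiener (h i) (V i)"
      and WV: "\<And>i. i < n \<Longrightarrow> AE \<omega> in M. Wi i t x \<omega> = Y i \<omega> * V i \<omega>" by metis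
    have "AE \<omega> in M. \<forall>i\<in>{..<n}. Wi i t x \<omega> = Y i \<omega> * V i \<omega>"
      using WV by (intro AE_finite_allI) auto
    then have "AE \<omega> in M. W t x \<omega> = (\<Sum>i<n. Y i \<omega> * V i \<omega>)"
      by eventually_elim (simp add: W)
    then have "L2_norm_sq M (W t x) = L2_norm_sq M (\<lambda>\<omega>. \<Sum>i<n. Y i \<omega> * V i \<omega>)"
      unfolding L2_norm_sq_def by (intro nn_integral_cong_AE) auto
    also have "\<dots> = (\<integral>\<^sup>+z. L2_norm_sq M (\<lambda>\<omega>. \<Sum>i<n. Y i \<omega> * h i z) \<partial>T)"
      by (rule isometry_sum[of n Y a h V]) (use Y V in \<open>auto simp: h_def\<close>)
    also have "\<dots> = (\<integral>\<^sup>+z. ennreal ((k z x)\<^sup>2) * q z \<partial>T)"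
    proof (rule nn_integral_cong_AE)
      have "AE z in T. z \<in> space T" by simp
      with AE_T_time_neq[of 0]
      show "AE z in T. L2_norm_sq M (\<lambda>\<omega>. \<Sum>i<n. Y i \<omega> * h i z) = ennreal ((k z x)\<^sup>2) * q z"
      proof eventually_elim
        case (elim z)
        then have z: "fst z > 0" by (cases z) (auto simp: space_T)
        then have k: "indicator {0<..<t} (fst z) * K (t - fst z) (snd z - x) = k z x"
          by (simp add: k_def indicator_def)
        have "(\<Sum>i<n. Y i \<omega> * h i z) = k z x * S (fst z) (snd z) \<omega>" for \<omega>
          unfolding k[symmetric] S elementary_field_def h_def sum_distrib_left
          by (cases z) (auto intro!: sum.cong)
        moreover have "S (fst z) (snd z) \<in> borel_measurable M"
          using z by (intro random_field_measurable(5)[OF rS]) (auto simp: space_mG)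
        ultimately show ?case by (simp add: q_def L2_norm_sq_cmult)
      qed
    qed
    finally show ?thesis .
  qed
  have "(\<lambda>(z, \<omega>). ennreal ((S (fst z) (snd z) \<omega>)\<^sup>2)) \<in> borel_measurable ((time \<Otimes>\<^sub>M mG) \<Otimes>\<^sub>M M)"
    using measurable_compose[OF random_field_measurable(2)[OF rS], of "\<lambda>r. ennreal (r\<^sup>2)" borel]
    by (simp add: case_prod_unfold)
  from borel_measurable_nn_integral[OF this]
  have q[measurable]: "q \<in> borel_measurable (time \<Otimes>\<^sub>M mG)"
    unfolding q_def L2_norm_sq_def .
  have k[measurable]: "(\<lambda>(z, x). k z x) \<in> borel_measurable ((time \<Otimes>\<^sub>M mG) \<Otimes>\<^sub>M mG)"
  proof -
    have [measurable]: "(\<lambda>s. t - s) \<in> time \<rightarrow>\<^sub>M borel"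
      by (intro measurable_restrict_space1) simp
    have "(\<lambda>p. ((t - fst (fst p), snd (fst p)), snd p)) \<in> (time \<Otimes>\<^sub>M mG) \<Otimes>\<^sub>M mG \<rightarrow>\<^sub>M (borel \<Otimes>\<^sub>M mG) \<Otimes>\<^sub>M mG"
      by measurable
    from measurable_compose[OF this kernel_measurable] show ?thesis
      unfolding k_def by (simp add: case_prod_unfold)
  qed
  have "mean_sq W t = (\<integral>\<^sup>+x. (\<integral>\<^sup>+z. ennreal ((k z x)\<^sup>2) * q z \<partial>T) \<partial>mG)"
    unfolding expected_L2_norm_sq_swap[OF rW t] pointwise ..
  also have "\<dots> = (\<integral>\<^sup>+z. (\<integral>\<^sup>+x. ennreal ((k z x)\<^sup>2) * q z \<partial>mG) \<partial>T)"
    by (rule TG.Fubini') (unfold time_space_def, measurable)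
  also have "\<dots> = (\<integral>\<^sup>+z. kernel_energy (t - fst z) * q z \<partial>(time \<Otimes>\<^sub>M mG))"
    unfolding time_space_def
  proof (rule nn_integral_cong)
    fix z assume z: "z \<in> space (time \<Otimes>\<^sub>M mG)"
    have "(\<lambda>x. k z x) \<in> borel_measurable mG"
      using measurable_compose[OF measurable_Pair1'[OF z] k] by simp
    then show "(\<integral>\<^sup>+x. ennreal ((k z x)\<^sup>2) * q z \<partial>mG) = kernel_energy (t - fst z) * q z"
      using kernel_energy_shift[of "t - fst z" "snd z"] by (subst nn_integral_multc) (auto simp: k_def)
  qed
  also have "\<dots> = (\<integral>\<^sup>+s. (\<integral>\<^sup>+y. kernel_energy (t - s) * q (s, y) \<partial>mG) \<partial>time)"
  proof -
    have [measurable]: "(\<lambda>s. kernel_energy (t - s)) \<in> borel_measurable time"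
      by (intro measurable_restrict_space1) simp
    show ?thesis by (subst mG.nn_integral_fst[symmetric]) auto
  qed
  also have "\<dots> = (\<integral>\<^sup>+s. kernel_energy (t - s) * mean_sq S s \<partial>time)"
  proof (rule nn_integral_cong)
    fix s assume s: "s \<in> space time"
    then have s0: "s \<ge> 0" by (simp add: space_restrict_space)
    have "(\<lambda>y. q (s, y)) \<in> borel_measurable mG"
      using measurable_compose[OF measurable_Pair1'[OF s] q] by simp
    then show "(\<integral>\<^sup>+y. kernel_energy (t - s) * q (s, y) \<partial>mG) = kernel_energy (t - s) * mean_sq S s"
      unfolding expected_L2_norm_sq_swap[OF rS s0] by (subst nn_integral_cmult) (auto simp: q_def)
  qed
  finally show "mean_sq W t = convolution_energy t S" by (simp add: convolution_energy_def)
qed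

lemma kernel_energy_time_measurable: "(\<lambda>s. kernel_energy (t - s)) \<in> borel_measurable time"
  by (intro measurable_restrict_space1) simp

lemma convolution_energy_triangle:
  assumes Z: "random_field M mG Z" and Y: "random_field M mG Y"
  shows "convolution_energy t Y \<le> 2 * convolution_energy t (\<lambda>t x \<omega>. Z t x \<omega> - Y t x \<omega>) + 2 * convolution_energy t Z"
    and "convolution_energy t Z \<le> 2 * convolution_energy t (\<lambda>t x \<omega>. Z t x \<omega> - Y t x \<omega>) + 2 * convolution_energy t Y"
proof -
  note [measurable] = kernel_energy_time_measurable random_field_L2_measurable(1)[OF Z] random_field_L2_measurable(1)[OF Y]
    random_field_L2_measurable(1)[OF random_field_diff[OF Z Y]]
  note tri = expected_L2_norm_sq_triangle[OF Z Y]
  let ?D = "\<lambda>t x \<omega>. Z t x \<omega> - Y t x \<omega>"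
  have *: "convolution_energy t A \<le> 2 * convolution_energy t ?D + 2 * convolution_energy t B"
    if tri: "\<And>s. s \<ge> 0 \<Longrightarrow> mean_sq A s \<le> 2 * mean_sq ?D s + 2 * mean_sq B s"
      and [measurable]: "(\<lambda>s. mean_sq B s) \<in> borel_measurable time" for A B
  proof -
    have "convolution_energy t A \<le> (\<integral>\<^sup>+s. 2 * (kernel_energy (t - s) * mean_sq ?D s)
        + 2 * (kernel_energy (t - s) * mean_sq B s) \<partial>time)"
      unfolding convolution_energy_def
    proof (rule nn_integral_mono)
      fix s assume "s \<in> space time"
      then have "s \<ge> 0" by (simp add: space_restrict_space)
      from mult_left_mono[OF tri[OF this], of "kernel_energy (t - s)"]
      show "kernel_energy (t - s) * mean_sq A s \<le> 2 * (kernel_energy (t - s) * mean_sq ?D s)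
        + 2 * (kernel_energy (t - s) * mean_sq B s)"
        by (simp add: distrib_left mult.left_commute)
    qed
    also have "\<dots> = 2 * convolution_energy t ?D + 2 * convolution_energy t B"
      unfolding convolution_energy_def by (subst nn_integral_add) (auto simp: nn_integral_cmult)
    finally show ?thesis .
  qed
  show "convolution_energy t Y \<le> 2 * convolution_energy t ?D + 2 * convolution_energy t Z"
    by (rule *[OF tri(1)]) auto
  show "convolution_energy t Z \<le> 2 * convolution_energy t ?D + 2 * convolution_energy t Y"
    by (rule *[OF tri(2)]) auto
qed

definition kernel_mass :: "real \<Rightarrow> ennreal" where
  "kernel_mass t = (\<integral>\<^sup>+s. kernel_energy (t - s) \<partial>time)"

lemma kernel_energy_nonpos: "s \<le> 0 \<Longrightarrow> kernel_energy s = 0"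
  by (simp add: kernel_energy_def)

lemma convolution_energy_le_mass:
  assumes "\<And>s. 0 \<le> s \<Longrightarrow> s < t \<Longrightarrow> mean_sq Z s \<le> c"
  shows "convolution_energy t Z \<le> c * kernel_mass t"
proof -
  note [measurable] = kernel_energy_time_measurable
  have "convolution_energy t Z \<le> (\<integral>\<^sup>+s. c * kernel_energy (t - s) \<partial>time)"
    unfolding convolution_energy_def
  proof (rule nn_integral_mono)
    fix s assume "s \<in> space time"
    then have "0 \<le> s" by (simp add: space_restrict_space)
    then show "kernel_energy (t - s) * mean_sq Z s \<le> c * kernel_energy (t - s)"
      using assms[of s] by (cases "s < t") (auto simp: kernel_energy_nonpos mult.commute[of "kernel_energy (t - s)"] intro: mult_right_mono)
  qed
  also have "\<dots> = c * kernel_mass t"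
    unfolding kernel_mass_def by (rule nn_integral_cmult) measurable
  finally show ?thesis .
qed

lemma convolution_energy_ge_mass:
  assumes "\<And>s. 0 \<le> s \<Longrightarrow> s < t \<Longrightarrow> c \<le> mean_sq Z s"
  shows "c * kernel_mass t \<le> convolution_energy t Z"
proof -
  note [measurable] = kernel_energy_time_measurable
  have "c * kernel_mass t = (\<integral>\<^sup>+s. c * kernel_energy (t - s) \<partial>time)"
    unfolding kernel_mass_def by (rule nn_integral_cmult[symmetric]) measurable
  also have "\<dots> \<le> convolution_energy t Z"
    unfolding convolution_energy_def
  proof (rule nn_integral_mono)
    fix s assume "s \<in> space time"
    then have "0 \<le> s" by (simp add: space_restrict_space)
    then show "c * kernel_energy (t - s) \<le> kernel_energy (t - s) * mean_sq Z s"
      using assms[of s] by (cases "s < t") (auto simp: kernel_energy_nonpos mult.commute[of "kernel_energy (t - s)"] intro: mult_right_mono)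
  qed
  finally show ?thesis .
qed

text \<open>The isometry for the approximating simple fields, combined with
  \<open>(x + y)\<^sup>2 \<le> 2 x\<^sup>2 + 2 y\<^sup>2\<close> on either side, and a passage to the limit. Convergence in the field norm
  makes the error terms vanish because the kernel mass up to time \<open>t\<close> is finite.\<close>

theorem stochastic_convolution_energy:
  assumes conv: "stochastic_convolution M mG \<xi> \<beta> K Z W" and t: "t \<ge> 0" and \<beta>: "\<beta> \<ge> 0"
    and mass: "kernel_mass t < \<infinity>"
  shows "mean_sq W t \<le> 4 * convolution_energy t Z"
    and "convolution_energy t Z \<le> 4 * mean_sq W t"
proof -
  have rZ: "random_field M mG Z" and rW: "random_field M mG W"
    using conv by (auto simp: stochastic_convolution_def predictable_fields_def)
  from conv obtain S V where SV: "\<And>n::nat. simple_convolution M mG \<xi> K (S n) (V n)"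
    and lS: "(\<lambda>n. field_norm M mG \<beta> (\<lambda>t x \<omega>. S n t x \<omega> - Z t x \<omega>)) \<longlonglongrightarrow> 0"
    and lV: "(\<lambda>n. field_norm M mG \<beta> (\<lambda>t x \<omega>. V n t x \<omega> - W t x \<omega>)) \<longlonglongrightarrow> 0"
    unfolding stochastic_convolution_def by blast
  note iso = convolution_isometry[OF SV t]
  define d where "d n = convolution_energy t (\<lambda>t x \<omega>. S n t x \<omega> - Z t x \<omega>)" for n
  define e where "e n = mean_sq (\<lambda>t x \<omega>. V n t x \<omega> - W t x \<omega>) t" for n
  let ?NS = "\<lambda>n. field_norm M mG \<beta> (\<lambda>t x \<omega>. S n t x \<omega> - Z t x \<omega>)"
  let ?NV = "\<lambda>n. field_norm M mG \<beta> (\<lambda>t x \<omega>. V n t x \<omega> - W t x \<omega>)"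
  have "e \<longlonglongrightarrow> 0"
  proof (rule tendsto_sandwich[OF _ _ tendsto_const])
    show "\<forall>\<^sub>F n in sequentially. e n \<le> ennreal (exp (2 * \<beta> * t)) * (?NV n * ?NV n)"
      unfolding e_def using expected_L2_norm_sq_le_field_norm[OF t] by (intro always_eventually allI)
    have "(\<lambda>n. ennreal (exp (2 * \<beta> * t)) * (?NV n * ?NV n)) \<longlonglongrightarrow> ennreal (exp (2 * \<beta> * t)) * (0 * 0)"
      by (intro ennreal_tendsto_cmult tendsto_mult_ennreal lV) auto
    then show "(\<lambda>n. ennreal (exp (2 * \<beta> * t)) * (?NV n * ?NV n)) \<longlonglongrightarrow> 0" by simp
  qed simp
  have "d \<longlonglongrightarrow> 0"
  proof (rule tendsto_sandwich[OF _ _ tendsto_const])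
    let ?b = "\<lambda>n. (ennreal (exp (2 * \<beta> * t)) * (?NS n * ?NS n)) * kernel_mass t"
    have "d n \<le> ?b n" for n
      unfolding d_def
    proof (rule convolution_energy_le_mass)
      fix s assume s: "0 \<le> s" "s < t"
      have "ennreal (exp (2 * \<beta> * s)) \<le> ennreal (exp (2 * \<beta> * t))"
        using s \<beta> by (intro ennreal_leI) (simp add: mult_left_mono)
      then show "mean_sq (\<lambda>t x \<omega>. S n t x \<omega> - Z t x \<omega>) s \<le> ennreal (exp (2 * \<beta> * t)) * (?NS n * ?NS n)"
        using expected_L2_norm_sq_le_field_norm[OF s(1)] by (meson mult_right_mono order_trans zero_le)
    qed
    then show "\<forall>\<^sub>F n in sequentially. d n \<le> ?b n" by simp
    have "(\<lambda>n. kernel_mass t * (ennreal (exp (2 * \<beta> * t)) * (?NS n * ?NS n)))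
        \<longlonglongrightarrow> kernel_mass t * (ennreal (exp (2 * \<beta> * t)) * (0 * 0))"
      using mass by (intro ennreal_tendsto_cmult tendsto_mult_ennreal lS) auto
    then show "?b \<longlonglongrightarrow> 0" by (simp add: mult.commute)
  qed simp
  have up: "mean_sq W t \<le> 2 * e n + 2 * (2 * d n + 2 * convolution_energy t Z)" for n
  proof -
    have "mean_sq W t \<le> 2 * e n + 2 * mean_sq (V n) t"
      unfolding e_def by (rule expected_L2_norm_sq_triangle(1)[OF iso(2) rW t])
    also have "mean_sq (V n) t \<le> 2 * d n + 2 * convolution_energy t Z"
      unfolding d_def iso(3) by (rule convolution_energy_triangle(2)[OF iso(1) rZ])
    finally show ?thesis by (simp add: add_left_mono mult_left_mono)
  qed
  have down: "convolution_energy t Z \<le> 2 * d n + 2 * (2 * e n + 2 * mean_sq W t)" for n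
  proof -
    have "convolution_energy t Z \<le> 2 * d n + 2 * convolution_energy t (S n)"
      unfolding d_def by (rule convolution_energy_triangle(1)[OF iso(1) rZ])
    also have "convolution_energy t (S n) \<le> 2 * e n + 2 * mean_sq W t"
      unfolding e_def iso(3)[symmetric] by (rule expected_L2_norm_sq_triangle(2)[OF iso(2) rW t])
    finally show ?thesis by (simp add: add_left_mono mult_left_mono)
  qed
  have lim: "(\<lambda>n. 2 * x n + 2 * (2 * y n + 2 * c)) \<longlonglongrightarrow> 4 * c" if "x \<longlonglongrightarrow> 0" "y \<longlonglongrightarrow> 0" for x y and c :: ennreal
  proof -
    have "(\<lambda>n. 2 * x n + 2 * (2 * y n + 2 * c)) \<longlonglongrightarrow> 2 * 0 + 2 * (2 * 0 + 2 * c)"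
      by (intro tendsto_add ennreal_tendsto_cmult tendsto_const that) auto
    then show ?thesis by (simp add: mult.assoc[symmetric])
  qed
  show "mean_sq W t \<le> 4 * convolution_energy t Z"
    by (rule tendsto_lowerbound[OF lim[OF \<open>e \<longlonglongrightarrow> 0\<close> \<open>d \<longlonglongrightarrow> 0\<close>]]) (use up in auto)
  show "convolution_energy t Z \<le> 4 * mean_sq W t"
    by (rule tendsto_lowerbound[OF lim[OF \<open>d \<longlonglongrightarrow> 0\<close> \<open>e \<longlonglongrightarrow> 0\<close>]]) (use down in auto)
qed

end

section \<open>Haar measure and the dual of a compact group\<close>

lemma haar_measure_emeasure_translate:
  "haar_measure m \<Longrightarrow> A \<in> sets m \<Longrightarrow> emeasure m ((\<lambda>x. a + x) ` A) = emeasure m A"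
  unfolding haar_measure_def by (elim conjE) (erule allE, erule bspec)

lemma haar_measure_translate:
  fixes m :: "'g::{topological_ab_group_add, t2_space} measure"
  assumes m: "haar_measure m"
  shows "distr m m (\<lambda>x. x + y) = m"
proof (rule measure_eqI)
  have sm: "sets m = sets borel" using m by (simp add: haar_measure_def)
  have meas: "(\<lambda>x. x + y) \<in> m \<rightarrow>\<^sub>M m"
  proof -
    have "(\<lambda>x :: 'g. x + y) \<in> borel \<rightarrow>\<^sub>M borel"
      by (intro borel_measurable_continuous_onI continuous_intros)
    then show ?thesis using sm by (simp cong: measurable_cong_sets)
  qed
  fix A assume "A \<in> sets (distr m m (\<lambda>x. x + y))"
  then have A: "A \<in> sets m" by simp
  have "(\<lambda>x. x + y) -` A \<inter> space m = (\<lambda>x. - y + x) ` A"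
    using sets_eq_imp_space_eq[OF sm] by (auto simp: image_iff intro!: bexI[of _ "_ + y"])
  then show "emeasure (distr m m (\<lambda>x. x + y)) A = emeasure m A"
    using haar_measure_emeasure_translate[OF m A] by (simp only: emeasure_distr[OF meas A])
qed simp

lemma haar_measure_nn_integral_translate:
  fixes m :: "'g::{topological_ab_group_add, t2_space} measure"
  assumes m: "haar_measure m" and f: "f \<in> borel_measurable m"
  shows "(\<integral>\<^sup>+x. f (x + y) \<partial>m) = (\<integral>\<^sup>+x. f x \<partial>m)"
proof -
  have sm: "sets m = sets borel" using m by (simp add: haar_measure_def)
  have "(\<lambda>x :: 'g. x + y) \<in> borel \<rightarrow>\<^sub>M borel"
    by (intro borel_measurable_continuous_onI continuous_intros)
  then have "(\<lambda>x. x + y) \<in> m \<rightarrow>\<^sub>M m" using sm by (simp cong: measurable_cong_sets)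
  then show ?thesis
    using f haar_measure_translate[OF m, of y] nn_integral_distr[of "\<lambda>x. x + y" m m f] by simp
qed

lemma char_eval_props:
  "continuous_on UNIV (char_eval \<gamma>)" "cmod (char_eval \<gamma> x) = 1"
  "char_eval \<gamma> (x + y) = char_eval \<gamma> x * char_eval \<gamma> y"
  using char_eval[of \<gamma>] by auto

lemma char_eval_uminus: "char_eval \<gamma> (- x) = char_eval (- \<gamma>) x"
proof -
  have "char_eval \<gamma> 0 * char_eval \<gamma> 0 = char_eval \<gamma> 0" using char_eval_props(3)[of \<gamma> 0 0] by simp
  then have "char_eval \<gamma> 0 = 1" using char_eval_props(2)[of \<gamma> 0] by (auto simp: mult_cancel_right1)
  then have "char_eval \<gamma> x * char_eval \<gamma> (- x) = char_eval \<gamma> x * cnj (char_eval \<gamma> x)"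
    using char_eval_props(3)[of \<gamma> x "- x"] char_eval_props(2)[of \<gamma> x]
    by (simp add: complex_norm_square[symmetric])
  moreover have "char_eval \<gamma> x \<noteq> 0" using char_eval_props(2)[of \<gamma> x] by auto
  ultimately show ?thesis by (simp add: uminus_character.rep_eq)
qed

locale compact_group_measure = prob_space mG
  for mG :: "'g::{topological_ab_group_add, t2_space} measure" +
  assumes haar: "haar_measure mG"
begin

lemma sets_eq_borel: "sets mG = sets borel"
  using haar by (simp add: haar_measure_def)

lemma space_eq_UNIV: "space mG = UNIV"
  using sets_eq_imp_space_eq[OF sets_eq_borel] by simp

lemma char_eval_measurable [measurable]: "char_eval \<gamma> \<in> borel_measurable mG"
proof -
  have "char_eval \<gamma> \<in> borel_measurable borel"
    using char_eval_props(1) by (rule borel_measurable_continuous_onI)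
  then show ?thesis using sets_eq_borel by (simp cong: measurable_cong_sets)
qed

text \<open>Translation by \<open>a\<close> multiplies the integral by \<open>\<gamma> a\<close>, which forces it to vanish unless \<open>\<gamma>\<close> is trivial.\<close>

lemma integral_char_eval: "(\<integral>x. char_eval \<gamma> x \<partial>mG) = (if \<gamma> = 0 then 1 else 0)"
proof (cases "\<gamma> = 0")
  case True
  then show ?thesis by (simp add: zero_character.rep_eq prob_space)
next
  case False
  then have "char_eval \<gamma> \<noteq> char_eval 0" by (simp add: char_eval_inject)
  then obtain a where a: "char_eval \<gamma> a \<noteq> 1" by (auto simp: zero_character.rep_eq fun_eq_iff)
  have "(\<lambda>x :: 'g. x + a) \<in> borel \<rightarrow>\<^sub>M borel"
    by (intro borel_measurable_continuous_onI continuous_intros)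
  then have m: "(\<lambda>x. x + a) \<in> mG \<rightarrow>\<^sub>M mG" using sets_eq_borel by (simp cong: measurable_cong_sets)
  have "(\<integral>x. char_eval \<gamma> x \<partial>mG) = (\<integral>x. char_eval \<gamma> x \<partial>distr mG mG (\<lambda>x. x + a))"
    by (simp add: haar_measure_translate[OF haar])
  also have "\<dots> = (\<integral>x. char_eval \<gamma> (x + a) \<partial>mG)"
    by (rule integral_distr[OF m]) simp
  also have "\<dots> = (\<integral>x. char_eval \<gamma> x \<partial>mG) * char_eval \<gamma> a" by (simp add: char_eval_props(3))
  finally show ?thesis using a False by (auto simp: mult_cancel_left1)
qed

text \<open>The Fourier transform of the constant \<open>1\<close> is the indicator of the trivial character, so the
  Plancherel identity normalises its mass; translation invariance does the rest.\<close>

lemma dual_haar_singleton: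
  assumes dual: "dual_haar_measure mG mD"
  shows "emeasure mD {\<gamma>} = 1"
proof -
  have hD: "haar_measure mD" using dual by (simp add: dual_haar_measure_def)
  then have sD: "sets mD = sets borel" by (simp add: haar_measure_def)
  have "(\<integral>\<^sup>+\<gamma>. ennreal ((cmod (fourier mG (\<lambda>_. 1) \<gamma>))\<^sup>2) \<partial>mD) = (\<integral>\<^sup>+x. ennreal ((cmod ((\<lambda>_. 1) x))\<^sup>2) \<partial>mG)"
    using dual unfolding dual_haar_measure_def by (elim conjE allE[of _ "\<lambda>_. 1"]) simp
  moreover have "ennreal ((cmod (fourier mG (\<lambda>_. 1) \<gamma>))\<^sup>2) = indicator {0} \<gamma>" for \<gamma>
    by (simp add: fourier_def integral_char_eval)
  ultimately have "emeasure mD {0} = 1" using sD by (simp add: emeasure_space_1)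
  moreover have "emeasure mD ((\<lambda>x. \<gamma> + x) ` {0}) = emeasure mD {0}"
    by (rule haar_measure_emeasure_translate[OF hD]) (simp add: sD)
  ultimately show ?thesis by simp
qed

end

section \<open>The transition density\<close>

text \<open>Singletons have mass \<open>1\<close>, so the hypothesis is a convergent series: each level set \<open>{f \<le> n}\<close> is finite,
  and these sets exhaust the group. On a countable space with closed points the unit masses determine
  the measure.\<close>

lemma countable_discrete_haar:
  fixes mD :: "'d::{topological_ab_group_add, t2_space} measure"
  assumes sD: "sets mD = sets borel" and single: "\<And>\<gamma>. emeasure mD {\<gamma>} = 1"
    and f: "continuous_on UNIV f" "\<And>\<gamma>. 0 \<le> f \<gamma>" and b: "b > (0 :: real)"
    and fin: "(\<integral>\<^sup>+\<gamma>. ennreal (1 / (b + f \<gamma>)) \<partial>mD) < \<infinity>"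
  shows "countable (UNIV :: 'd set)" and "mD = count_space UNIV"
proof -
  let ?I = "\<integral>\<^sup>+\<gamma>. ennreal (1 / (b + f \<gamma>)) \<partial>mD"
  have [measurable]: "{\<gamma>} \<in> sets mD" for \<gamma> using sD by simp
  have fm[measurable]: "f \<in> borel_measurable mD"
    using borel_measurable_continuous_onI[OF f(1)] sD by (simp cong: measurable_cong_sets)
  have finite_level: "finite {\<gamma>. f \<gamma> \<le> real n}" for n
  proof (rule ccontr)
    assume inf: "infinite {\<gamma>. f \<gamma> \<le> real n}"
    have bound: "ennreal (real k) \<le> ennreal (b + real n) * ?I" for k
    proof -
      obtain F where F: "finite F" "card F = k" "F \<subseteq> {\<gamma>. f \<gamma> \<le> real n}"
        using infinite_arbitrarily_large[OF inf] by blast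
      have [measurable]: "F \<in> sets mD" using F(1) sD by (simp add: finite_imp_closed)
      have "ennreal (real k) = emeasure mD F"
        using emeasure_eq_sum_singleton[OF F(1), of mD] single F(2) by (simp add: ennreal_of_nat_eq_real_of_nat)
      also have "\<dots> = (\<integral>\<^sup>+\<gamma>. indicator F \<gamma> \<partial>mD)" by simp
      also have "\<dots> \<le> (\<integral>\<^sup>+\<gamma>. ennreal (b + real n) * ennreal (1 / (b + f \<gamma>)) \<partial>mD)"
      proof (rule nn_integral_mono)
        fix \<gamma>
        have "1 \<le> (b + real n) * (1 / (b + f \<gamma>))" if "\<gamma> \<in> F"
          using that F(3) f(2)[of \<gamma>] b by (auto simp: field_simps)
        then have "indicator F \<gamma> \<le> ennreal ((b + real n) * (1 / (b + f \<gamma>)))"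
          by (auto simp: indicator_def)
        also have "\<dots> = ennreal (b + real n) * ennreal (1 / (b + f \<gamma>))"
          using b f(2)[of \<gamma>] by (intro ennreal_mult) auto
        finally show "indicator F \<gamma> \<le> ennreal (b + real n) * ennreal (1 / (b + f \<gamma>))" .
      qed
      also have "\<dots> = ennreal (b + real n) * ?I" by (rule nn_integral_cmult) measurable
      finally show ?thesis .
    qed
    have "ennreal (b + real n) * ?I < \<infinity>" using fin by (simp add: ennreal_mult_less_top)
    then obtain r where r: "ennreal (b + real n) * ?I = ennreal r" "r \<ge> 0"
      by (cases "ennreal (b + real n) * ?I") auto
    have "real k \<le> r" for k using bound[of k] r by (simp add: ennreal_le_iff)
    then show False using reals_Archimedean2[of r] by (auto simp: not_le[symmetric])
  qed
  have "UNIV = (\<Union>n. {\<gamma>. f \<gamma> \<le> real n})" using real_arch_simple by auto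
  also have "countable \<dots>" by (rule countable_UN) (auto intro: countable_finite finite_level)
  finally show c: "countable (UNIV :: 'd set)" .
  show "mD = count_space UNIV"
    by (rule measure_eqI_countable'[OF _ _ _ _ c])
      (use sets_eq_imp_space_eq[OF sD] single in auto)
qed

locale levy_kernel = compact_group_measure mG
  for mG :: "'g::{topological_ab_group_add, t2_space} measure" +
  fixes mD :: "'g character measure" and N :: "'x measure" and X :: "real \<Rightarrow> 'x \<Rightarrow> 'g"
    and \<Psi> :: "'g character \<Rightarrow> complex"
  assumes dual: "dual_haar_measure mG mD" and levy: "levy_process N X"
    and exponent: "characteristic_exponent N X \<Psi>" and dalang: "dalang_condition mD \<Psi>"
begin

lemma exponent_props: "continuous_on UNIV \<Psi>" "Re (\<Psi> \<gamma>) \<ge> 0" "t \<ge> 0 \<Longrightarrow> exp (- (of_real t * \<Psi> 0)) = 1"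
proof -
  interpret N: prob_space N using levy by (simp add: levy_process_def)
  have e: "(\<integral>\<omega>. char_eval \<gamma> (X t \<omega>) \<partial>N) = exp (- (of_real t * \<Psi> \<gamma>))" if "t \<ge> 0" for t \<gamma>
    using exponent that by (simp add: characteristic_exponent_def)
  show "continuous_on UNIV \<Psi>" using exponent by (simp add: characteristic_exponent_def)
  show "exp (- (of_real t * \<Psi> 0)) = 1" if "t \<ge> 0"
    using e[OF that, of 0] by (simp add: zero_character.rep_eq N.prob_space)
  have "cmod (\<integral>\<omega>. char_eval \<gamma> (X 1 \<omega>) \<partial>N) \<le> (\<integral>\<omega>. cmod (char_eval \<gamma> (X 1 \<omega>)) \<partial>N)"
    by (rule integral_norm_bound)
  then have "exp (- Re (\<Psi> \<gamma>)) \<le> 1" using e[of 1 \<gamma>] by (simp add: char_eval_props N.prob_space)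
  then show "Re (\<Psi> \<gamma>) \<ge> 0" by simp
qed

lemma dual_countable: "countable (UNIV :: 'g character set)"
  and dual_count_space: "mD = count_space UNIV"
proof -
  obtain b where b: "b > 0" "(\<integral>\<^sup>+\<gamma>. ennreal (1 / (b + Re (\<Psi> \<gamma>))) \<partial>mD) < \<infinity>"
    using dalang by (auto simp: dalang_condition_def)
  have sD: "sets mD = sets borel" using dual by (simp add: dual_haar_measure_def haar_measure_def)
  note * = sD dual_haar_singleton[OF dual] continuous_on_Re[OF exponent_props(1)] exponent_props(2) b
  show "countable (UNIV :: 'g character set)" "mD = count_space UNIV"
    by (rule countable_discrete_haar[OF *])+
qed

sublocale D: sigma_finite_measure mD
  unfolding dual_count_space by (rule sigma_finite_measure_count_space_countable[OF dual_countable])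

lemma measurable_pair_dual:
  assumes "\<And>\<gamma>. (\<lambda>x. f (x, \<gamma>)) \<in> measurable L K"
  shows "f \<in> measurable (L \<Otimes>\<^sub>M mD) K"
proof -
  have 1: "(\<lambda>p. f (snd p, fst p)) \<in> measurable (count_space UNIV \<Otimes>\<^sub>M L) K"
    by (rule measurable_pair_measure_countable1[OF dual_countable]) (use assms in simp)
  have "(\<lambda>p. (snd p, fst p)) \<in> L \<Otimes>\<^sub>M mD \<rightarrow>\<^sub>M count_space UNIV \<Otimes>\<^sub>M L"
    unfolding dual_count_space by measurable
  from measurable_compose[OF this 1] show ?thesis by simp
qed

abbreviation p where "p \<equiv> transition_density mD \<Psi>"

text \<open>With \<open>s = Re (\<Psi> \<gamma>) \<ge> 0\<close> one has \<open>exp (- t s) (b + s) \<le> b + 1 / t\<close>, so the terms are dominated by those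
  of Dalang's series.\<close>

lemma density_integrable:
  assumes t: "t > 0"
  shows "integrable mD (\<lambda>\<gamma>. exp (- (t * Re (\<Psi> \<gamma>))))"
proof -
  obtain b where b: "b > 0" "(\<integral>\<^sup>+\<gamma>. ennreal (1 / (b + Re (\<Psi> \<gamma>))) \<partial>mD) < \<infinity>"
    using dalang by (auto simp: dalang_condition_def)
  have "integrable mD (\<lambda>\<gamma>. (b + 1 / t) * (1 / (b + Re (\<Psi> \<gamma>))))"
    using b exponent_props(2) unfolding dual_count_space
    by (intro integrable_mult_right) (auto simp: integrable_iff_bounded abs_of_nonneg add_nonneg_nonneg)
  then show ?thesis
  proof (rule Bochner_Integration.integrable_bound)
    show "AE \<gamma> in mD. norm (exp (- (t * Re (\<Psi> \<gamma>)))) \<le> norm ((b + 1 / t) * (1 / (b + Re (\<Psi> \<gamma>))))"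
    proof (rule AE_I2)
      fix \<gamma>
      define s where "s = Re (\<Psi> \<gamma>)"
      have s: "s \<ge> 0" by (simp add: s_def exponent_props)
      have "t * s \<le> exp (t * s)" using exp_ge_add_one_self[of "t * s"] by linarith
      then have "exp (- (t * s)) * (t * s) \<le> 1" by (simp add: exp_minus field_simps)
      then have 1: "exp (- (t * s)) * s \<le> 1 / t" using t by (simp add: field_simps)
      have "exp (- (t * s)) * b \<le> 1 * b" using b t s by (intro mult_right_mono) auto
      with 1 have "exp (- (t * s)) * (b + s) \<le> b + 1 / t" by (simp add: distrib_left)
      then have "exp (- (t * s)) \<le> (b + 1 / t) * (1 / (b + s))" using b s by (simp add: field_simps)
      then show "norm (exp (- (t * Re (\<Psi> \<gamma>)))) \<le> norm ((b + 1 / t) * (1 / (b + Re (\<Psi> \<gamma>))))"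
        using b s t by (simp add: s_def)
    qed
  qed (simp add: dual_count_space)
qed

lemma norm_density_term: "cmod (char_eval \<gamma> x * exp (- (of_real t * \<Psi> \<gamma>))) = exp (- (t * Re (\<Psi> \<gamma>)))"
  by (simp add: norm_mult char_eval_props)

text \<open>After writing \<open>\<gamma>(x - y) = \<gamma>(x) (- \<gamma>)(y)\<close> each term is a product of functions of one variable, and
  measurability in the countable variable \<open>\<gamma>\<close> is automatic.\<close>

lemma density_measurable:
  "(\<lambda>((s, y), x). indicator {0<..} s * p s (y - x)) \<in> borel_measurable ((borel \<Otimes>\<^sub>M mG) \<Otimes>\<^sub>M mG)"
proof -
  have eq: "p s (y - x) = Re (\<integral>\<gamma>. char_eval \<gamma> x * char_eval (- \<gamma>) y * exp (- (of_real s * \<Psi> \<gamma>)) \<partial>mD)" for s x y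
  proof -
    have "char_eval \<gamma> (- (y - x)) = char_eval \<gamma> x * char_eval (- \<gamma>) y" for \<gamma>
      using char_eval_props(3)[of \<gamma> x "- y"] by (simp add: char_eval_uminus)
    then show ?thesis unfolding transition_density_def by simp
  qed
  have "(\<lambda>(q, \<gamma>). char_eval \<gamma> (snd q) * char_eval (- \<gamma>) (snd (fst q)) * exp (- (of_real (fst (fst q)) * \<Psi> \<gamma>)))
      \<in> borel_measurable (((borel \<Otimes>\<^sub>M mG) \<Otimes>\<^sub>M mG) \<Otimes>\<^sub>M mD)"
    by (rule measurable_pair_dual) simp
  from D.borel_measurable_lebesgue_integral[OF this]
  have [measurable]: "(\<lambda>q. \<integral>\<gamma>. char_eval \<gamma> (snd q) * char_eval (- \<gamma>) (snd (fst q)) * exp (- (of_real (fst (fst q)) * \<Psi> \<gamma>)) \<partial>mD)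
      \<in> borel_measurable ((borel \<Otimes>\<^sub>M mG) \<Otimes>\<^sub>M mG)" .
  show ?thesis unfolding eq case_prod_unfold by measurable
qed

text \<open>The mass of \<open>p\<^sub>t\<close> is the sum of \<open>exp (- t \<Psi> \<gamma>)\<close> over the characters, each weighted with the
  integral of the character;
  only the trivial character survives and gives \<open>1\<close>. Cauchy-Schwarz bounds the mass by the \<open>L\<^sup>2\<close> norm.\<close>

lemma density_L2_ge_1:
  assumes t: "t > 0"
  shows "L2_norm_sq mG (p t) \<ge> 1"
proof (cases "square_integrable mG (p t)")
  case False
  have "p t \<in> borel_measurable mG"
  proof -
    have "(\<lambda>y. ((t, y), 0)) \<in> mG \<rightarrow>\<^sub>M (borel \<Otimes>\<^sub>M mG) \<Otimes>\<^sub>M mG"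
      by (intro measurable_Pair measurable_const measurable_ident) (simp_all add: space_eq_UNIV)
    from measurable_compose[OF this density_measurable] show ?thesis using t by simp
  qed
  then show ?thesis using False by (simp add: square_integrable_iff_L2_norm_sq not_less top_unique)
next
  case True
  interpret GD: pair_sigma_finite mG mD ..
  let ?f = "\<lambda>x \<gamma>. char_eval \<gamma> (- x) * exp (- (of_real t * \<Psi> \<gamma>))"
  have fm: "(\<lambda>(x, \<gamma>). ?f x \<gamma>) \<in> borel_measurable (mG \<Otimes>\<^sub>M mD)"
    by (rule measurable_pair_dual) (simp add: char_eval_uminus)
  have int: "integrable (mG \<Otimes>\<^sub>M mD) (\<lambda>(x, \<gamma>). ?f x \<gamma>)"
  proof (rule GD.Fubini_integrable[OF fm])
    show "integrable mG (\<lambda>x. \<integral>\<gamma>. norm (case (x, \<gamma>) of (x, \<gamma>) \<Rightarrow> ?f x \<gamma>) \<partial>mD)"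
      by (simp add: norm_density_term)
    have "integrable mD (?f x)" for x
      by (rule Bochner_Integration.integrable_bound[OF density_integrable[OF t]])
        (simp_all add: norm_density_term dual_count_space)
    then show "AE x in mG. integrable mD (\<lambda>\<gamma>. case (x, \<gamma>) of (x, \<gamma>) \<Rightarrow> ?f x \<gamma>)" by simp
  qed
  have "(\<integral>x. (\<integral>\<gamma>. ?f x \<gamma> \<partial>mD) \<partial>mG) = (\<integral>\<gamma>. (\<integral>x. ?f x \<gamma> \<partial>mG) \<partial>mD)"
    using GD.Fubini_integral[OF int] by simp
  also have "\<dots> = (\<integral>\<gamma>. indicator {0} \<gamma> \<partial>mD)"
  proof (intro Bochner_Integration.integral_cong refl)
    fix \<gamma>
    have "(\<integral>x. ?f x \<gamma> \<partial>mG) = (if - \<gamma> = 0 then 1 else 0) * exp (- (of_real t * \<Psi> \<gamma>))"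
      unfolding char_eval_uminus integral_char_eval[symmetric] by simp
    also have "\<dots> = indicator {0} \<gamma>"
      using exponent_props(3)[of t] t by (auto simp: indicator_def)
    finally show "(\<integral>x. ?f x \<gamma> \<partial>mG) = indicator {0} \<gamma>" .
  qed
  also have "\<dots> = 1"
    unfolding dual_count_space
    by (subst lebesgue_integral_count_space_finite_support) (auto simp: indicator_def)
  finally have one: "(\<integral>x. (\<integral>\<gamma>. ?f x \<gamma> \<partial>mD) \<partial>mG) = 1" .
  have "integrable mG (\<lambda>x. \<integral>\<gamma>. ?f x \<gamma> \<partial>mD)" using GD.integrable_fst'[OF int] by simp
  then have "(\<integral>x. p t x \<partial>mG) = Re (\<integral>x. (\<integral>\<gamma>. ?f x \<gamma> \<partial>mD) \<partial>mG)"
    unfolding transition_density_def by (rule integral_Re)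
  then have "1 = (\<integral>x. p t x \<partial>mG)" using one by simp
  also have "\<dots> \<le> (\<integral>x. \<bar>p t x\<bar> \<partial>mG)" using integral_abs_bound[of mG "p t"] by linarith
  also have "\<dots> \<le> sqrt (\<integral>x. (p t x)\<^sup>2 \<partial>mG)" by (rule integral_abs_le_L2[OF True])
  finally have "1 \<le> (\<integral>x. (p t x)\<^sup>2 \<partial>mG)" by simp
  then show ?thesis using L2_norm_sq_eq_integral[OF True] by simp
qed

end

context stochastic_convolution_space
begin

text \<open>Reflection invariance of the measure, obtained from translation invariance by integrating
  \<open>K\<^sub>s(y - x)\<^sup>2\<close> over both variables in either order.\<close>

lemma kernel_energy_eq_L2_norm_sq:
  assumes one: "emeasure mG UNIV = 1" and s: "s > 0"
  shows "kernel_energy s = L2_norm_sq mG (K s)"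
proof -
  interpret mG: sigma_finite_measure mG by (rule sigma_finite_mG)
  interpret GG: pair_sigma_finite mG mG ..
  let ?k = "\<lambda>y x. indicator {0<..} s * K s (y - x)"
  have "(\<lambda>p. ((s, fst p), snd p)) \<in> mG \<Otimes>\<^sub>M mG \<rightarrow>\<^sub>M (borel \<Otimes>\<^sub>M mG) \<Otimes>\<^sub>M mG" by measurable
  from measurable_compose[OF this kernel_measurable]
  have k[measurable]: "(\<lambda>(y, x). ?k y x) \<in> borel_measurable (mG \<Otimes>\<^sub>M mG)" by (simp add: case_prod_unfold)
  have kx: "(\<lambda>y. ?k y x) \<in> borel_measurable mG" for x
    using measurable_compose[OF measurable_Pair2'[of x mG mG] k] by (simp add: space_mG)
  have "kernel_energy s = (\<integral>\<^sup>+y. (\<integral>\<^sup>+x. ennreal ((?k y x)\<^sup>2) \<partial>mG) \<partial>mG)"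
    using one by (simp add: kernel_energy_shift space_mG)
  also have "\<dots> = (\<integral>\<^sup>+x. (\<integral>\<^sup>+y. ennreal ((?k y x)\<^sup>2) \<partial>mG) \<partial>mG)"
    by (rule GG.Fubini'[symmetric]) measurable
  also have "\<dots> = (\<integral>\<^sup>+x. L2_norm_sq mG (K s) \<partial>mG)"
  proof (rule nn_integral_cong)
    fix x
    have "(\<integral>\<^sup>+y. ennreal ((?k y x)\<^sup>2) \<partial>mG) = (\<integral>\<^sup>+y. ennreal ((?k (y + x) x)\<^sup>2) \<partial>mG)"
    proof (rule translation_invariant[symmetric])
      note [measurable] = kx[of x]
      show "(\<lambda>y. ennreal ((?k y x)\<^sup>2)) \<in> borel_measurable mG" by measurable
    qed
    then show "(\<integral>\<^sup>+y. ennreal ((?k y x)\<^sup>2) \<partial>mG) = L2_norm_sq mG (K s)"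
      using s by (simp add: L2_norm_sq_def)
  qed
  also have "\<dots> = L2_norm_sq mG (K s)" using one by (simp add: space_mG)
  finally show ?thesis .
qed

lemma kernel_mass_eq: "kernel_mass t = (\<integral>\<^sup>+s. kernel_energy s * indicator {0<..t} s \<partial>lborel)"
proof -
  have "kernel_mass t = (\<integral>\<^sup>+s. kernel_energy (t - s) * indicator {0..} s \<partial>lborel)"
    unfolding kernel_mass_def by (rule nn_integral_restrict_space) simp
  also have "\<dots> = ennreal \<bar>- 1\<bar> * (\<integral>\<^sup>+s. kernel_energy (t - (t + - 1 * s)) * indicator {0..} (t + - 1 * s) \<partial>lborel)"
    by (rule nn_integral_real_affine) auto
  also have "\<dots> = (\<integral>\<^sup>+s. kernel_energy s * indicator {0<..t} s \<partial>lborel)"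
    by (simp, intro nn_integral_cong) (auto simp: indicator_def kernel_energy_nonpos)
  finally show ?thesis .
qed

lemma kernel_mass_finite:
  assumes one: "emeasure mG UNIV = 1" and K: "K \<in> kernel_space mG \<beta>" and \<beta>: "\<beta> \<ge> 0"
  shows "kernel_mass t < \<infinity>"
proof -
  let ?I = "\<integral>\<^sup>+s\<in>{0<..}. ennreal (exp (- 2 * \<beta> * s)) * L2_norm_sq mG (K s) \<partial>lborel"
  have I: "?I = (\<integral>\<^sup>+s. ennreal (exp (- 2 * \<beta> * s)) * kernel_energy s \<partial>lborel)"
    by (intro nn_integral_cong) (auto simp: indicator_def kernel_energy_eq_L2_norm_sq[OF one] kernel_energy_nonpos not_less)
  have "kernel_mass t \<le> (\<integral>\<^sup>+s. ennreal (exp (2 * \<beta> * t)) * (ennreal (exp (- 2 * \<beta> * s)) * kernel_energy s) \<partial>lborel)"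
    unfolding kernel_mass_eq
  proof (rule nn_integral_mono)
    fix s
    show "kernel_energy s * indicator {0<..t} s \<le> ennreal (exp (2 * \<beta> * t)) * (ennreal (exp (- 2 * \<beta> * s)) * kernel_energy s)"
    proof (cases "s \<in> {0<..t}")
      case True
      have "1 \<le> exp (2 * \<beta> * t) * exp (- 2 * \<beta> * s)"
        using True \<beta> by (simp add: exp_add[symmetric] mult_left_mono)
      then have "1 \<le> ennreal (exp (2 * \<beta> * t)) * ennreal (exp (- 2 * \<beta> * s))"
        by (simp add: ennreal_mult[symmetric])
      from mult_right_mono[OF this, of "kernel_energy s"] show ?thesis
        using True by (simp add: mult.assoc)
    qed simp
  qed
  also have "\<dots> = ennreal (exp (2 * \<beta> * t)) * ?I" unfolding I by (rule nn_integral_cmult) measurable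
  also have "\<dots> < \<infinity>" using K by (simp add: kernel_space_def ennreal_mult_less_top)
  finally show ?thesis .
qed

lemma kernel_mass_ge:
  assumes one: "emeasure mG UNIV = 1" and K: "\<And>s. s > 0 \<Longrightarrow> c \<le> L2_norm_sq mG (K s)" and t: "t \<ge> 0"
  shows "c * ennreal t \<le> kernel_mass t"
proof -
  have "c * ennreal t = (\<integral>\<^sup>+s. c * indicator {0<..t} s \<partial>lborel)"
    using t by (simp add: nn_integral_cmult_indicator)
  also have "\<dots> \<le> kernel_mass t"
    unfolding kernel_mass_eq using K
    by (intro nn_integral_mono) (auto simp: indicator_def kernel_energy_eq_L2_norm_sq[OF one])
  finally show ?thesis .
qed

end

section \<open>Growth of the energy in the noise level\<close>

text \<open>A continuous function exceeds an essential bound on an open null set, which is empty.\<close>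

lemma lipschitz_AE_bounded:
  fixes \<sigma> :: "real \<Rightarrow> real"
  assumes lip: "C-lipschitz_on UNIV \<sigma>" and bnd: "AE z in lborel. \<bar>\<sigma> z\<bar> \<le> B"
  shows "\<bar>\<sigma> z\<bar> \<le> B"
proof -
  define S where "S = {z. B < \<bar>\<sigma> z\<bar>}"
  have c: "continuous_on UNIV \<sigma>" by (rule lipschitz_on_continuous_on[OF lip])
  have o: "open S" unfolding S_def by (intro open_Collect_less continuous_intros c)
  have "AE z in lborel. z \<notin> S" using bnd by eventually_elim (simp add: S_def)
  then have "S \<in> null_sets lborel" using o AE_iff_null_sets[of S lborel] by simp
  then have "negligible S" by (simp add: negligible_iff_null_sets null_sets_completionI)
  then have "S = {}" using open_not_negligible[OF o] by blast
  then show ?thesis by (auto simp: S_def not_less)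
qed

lemma esqrt_mono: "a \<le> b \<Longrightarrow> esqrt a \<le> esqrt b"
  by (cases a; cases b) (auto simp: esqrt_def ennreal_le_iff top_unique intro: ennreal_leI)

lemma esqrt_ennreal: "r \<ge> 0 \<Longrightarrow> esqrt (ennreal r) = ennreal (sqrt r)"
  by (simp add: esqrt_def)

lemma esqrt_over_le:
  assumes "E \<le> ennreal (c * l\<^sup>2)" "c \<ge> 0" "l > 0"
  shows "esqrt E / ennreal l \<le> ennreal (sqrt c)"
proof -
  have "esqrt E \<le> ennreal (sqrt c * l)"
    using esqrt_mono[OF assms(1)] assms(2,3) by (simp add: esqrt_ennreal real_sqrt_mult)
  then have "esqrt E / ennreal l \<le> ennreal (sqrt c * l) / ennreal l"
    by (rule divide_right_mono_ennreal)
  then show ?thesis using assms(2,3) by (simp add: divide_ennreal)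
qed

lemma esqrt_over_ge:
  assumes "ennreal (c * l\<^sup>2) \<le> E" "c \<ge> 0" "l > 0"
  shows "ennreal (sqrt c) \<le> esqrt E / ennreal l"
proof -
  have "ennreal (sqrt c * l) \<le> esqrt E"
    using esqrt_mono[OF assms(1)] assms(2,3) by (simp add: esqrt_ennreal real_sqrt_mult)
  then have "ennreal (sqrt c * l) / ennreal l \<le> esqrt E / ennreal l"
    by (rule divide_right_mono_ennreal)
  then show ?thesis using assms(2,3) by (simp add: divide_ennreal)
qed

context white_noise_space
begin

lemma expected_L2_norm_sq_le:
  assumes "\<And>x \<omega>. \<bar>Z t x \<omega>\<bar> \<le> c" and one: "emeasure mG (space mG) = 1"
  shows "mean_sq Z t \<le> ennreal (c\<^sup>2)"
proof -
  have "mean_sq Z t \<le> (\<integral>\<^sup>+\<omega>. (\<integral>\<^sup>+x. ennreal (c\<^sup>2) \<partial>mG) \<partial>M)"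
    unfolding expected_L2_norm_sq_def L2_norm_sq_def
  proof (intro nn_integral_mono ennreal_leI)
    show "(Z t x \<omega>)\<^sup>2 \<le> c\<^sup>2" for x \<omega>
      using assms(1)[of x \<omega>] by (metis abs_ge_zero abs_of_nonneg abs_le_square_iff order_trans)
  qed
  then show ?thesis using one by (simp add: emeasure_space_1)
qed

lemma expected_L2_norm_sq_ge:
  assumes "\<And>x \<omega>. c \<le> \<bar>Z t x \<omega>\<bar>" and c: "0 \<le> c" and one: "emeasure mG (space mG) = 1"
  shows "ennreal (c\<^sup>2) \<le> mean_sq Z t"
proof -
  have "(\<integral>\<^sup>+\<omega>. (\<integral>\<^sup>+x. ennreal (c\<^sup>2) \<partial>mG) \<partial>M) \<le> mean_sq Z t"
    unfolding expected_L2_norm_sq_def L2_norm_sq_def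
  proof (intro nn_integral_mono ennreal_leI)
    show "c\<^sup>2 \<le> (Z t x \<omega>)\<^sup>2" for x \<omega>
      using assms(1)[of x \<omega>] c abs_le_square_iff[of c "Z t x \<omega>"] by simp
  qed
  then show ?thesis using one by (simp add: emeasure_space_1)
qed

lemma expected_L2_norm_sq_affine:
  assumes u: "random_field M mG u" and W: "random_field M mG W" and g: "g \<in> borel_measurable mG" and t: "t \<ge> 0"
    and eq: "AE \<omega> in M. AE x in mG. u t x \<omega> = g x + l * W t x \<omega>"
  shows "mean_sq u t \<le> 2 * L2_norm_sq mG g + 2 * (ennreal (l\<^sup>2) * mean_sq W t)"
    and "ennreal (l\<^sup>2) * mean_sq W t \<le> 2 * mean_sq u t + 2 * L2_norm_sq mG g"
proof -
  note [measurable] = random_field_L2_measurable(2)[OF u t] random_field_L2_measurable(2)[OF W t]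
  note mW = random_field_measurable(4)[OF W t] and mu = random_field_measurable(4)[OF u t]
  have eq': "AE \<omega> in M. \<omega> \<in> space M \<and> (AE x in mG. u t x \<omega> = g x + l * W t x \<omega>)"
    using eq by simp
  have L: "L2_norm_sq mG (\<lambda>x. u t x \<omega>) = L2_norm_sq mG (\<lambda>x. g x + l * W t x \<omega>)"
    if "AE x in mG. u t x \<omega> = g x + l * W t x \<omega>" for \<omega>
    unfolding L2_norm_sq_def using that by (intro nn_integral_cong_AE) auto
  have "mean_sq u t
      \<le> (\<integral>\<^sup>+\<omega>. 2 * L2_norm_sq mG g + 2 * (ennreal (l\<^sup>2) * L2_norm_sq mG (\<lambda>x. W t x \<omega>)) \<partial>M)"
    unfolding expected_L2_norm_sq_def
  proof (rule nn_integral_mono_AE, use eq' in eventually_elim)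
    fix \<omega> assume *: "\<omega> \<in> space M \<and> (AE x in mG. u t x \<omega> = g x + l * W t x \<omega>)"
    then show "L2_norm_sq mG (\<lambda>x. u t x \<omega>) \<le> 2 * L2_norm_sq mG g + 2 * (ennreal (l\<^sup>2) * L2_norm_sq mG (\<lambda>x. W t x \<omega>))"
      using L2_norm_sq_add_le[OF g borel_measurable_times[OF borel_measurable_const[of l] mW], of \<omega>]
      by (simp add: L L2_norm_sq_cmult mW)
  qed
  also have "\<dots> = 2 * L2_norm_sq mG g + 2 * (ennreal (l\<^sup>2) * mean_sq W t)"
    unfolding expected_L2_norm_sq_def by (subst nn_integral_add) (auto simp: nn_integral_cmult emeasure_space_1)
  finally show "mean_sq u t \<le> 2 * L2_norm_sq mG g + 2 * (ennreal (l\<^sup>2) * mean_sq W t)" .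
  have "ennreal (l\<^sup>2) * mean_sq W t = (\<integral>\<^sup>+\<omega>. ennreal (l\<^sup>2) * L2_norm_sq mG (\<lambda>x. W t x \<omega>) \<partial>M)"
    unfolding expected_L2_norm_sq_def by (rule nn_integral_cmult[symmetric]) measurable
  also have "\<dots> \<le> (\<integral>\<^sup>+\<omega>. 2 * L2_norm_sq mG (\<lambda>x. u t x \<omega>) + 2 * L2_norm_sq mG g \<partial>M)"
  proof (rule nn_integral_mono_AE, use eq' in eventually_elim)
    fix \<omega> assume *: "\<omega> \<in> space M \<and> (AE x in mG. u t x \<omega> = g x + l * W t x \<omega>)"
    then have "ennreal (l\<^sup>2) * L2_norm_sq mG (\<lambda>x. W t x \<omega>) = L2_norm_sq mG (\<lambda>x. l * W t x \<omega>)"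
      by (simp add: L2_norm_sq_cmult mW)
    also have "\<dots> = L2_norm_sq mG (\<lambda>x. u t x \<omega> - g x)"
      unfolding L2_norm_sq_def using * by (intro nn_integral_cong_AE) auto
    also have "\<dots> \<le> 2 * L2_norm_sq mG (\<lambda>x. u t x \<omega>) + 2 * L2_norm_sq mG g"
      using L2_norm_sq_add_le[OF mu, of \<omega> "\<lambda>x. - 1 * g x"] L2_norm_sq_cmult[OF g, of "- 1"] * g by simp
    finally show "ennreal (l\<^sup>2) * L2_norm_sq mG (\<lambda>x. W t x \<omega>) \<le> 2 * L2_norm_sq mG (\<lambda>x. u t x \<omega>) + 2 * L2_norm_sq mG g" .
  qed
  also have "\<dots> = 2 * mean_sq u t + 2 * L2_norm_sq mG g"
    unfolding expected_L2_norm_sq_def by (subst nn_integral_add) (auto simp: nn_integral_cmult emeasure_space_1)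
  finally show "ennreal (l\<^sup>2) * mean_sq W t \<le> 2 * mean_sq u t + 2 * L2_norm_sq mG g" .
qed

text \<open>A path \<open>\<omega>\<close> with finite norms exhibits the deterministic function \<open>f\<close> as a difference of two square
  integrable functions, up to a null set. Applied at one level, this yields the square integrability of
  \<open>P\<^sub>t u\<^sub>0\<close> needed at all levels.\<close>

lemma deterministic_part_square_integrable:
  assumes u: "random_field M mG u" "mean_sq u t < \<infinity>"
    and W: "random_field M mG W" "mean_sq W t < \<infinity>" and t: "t \<ge> 0"
    and eq: "AE \<omega> in M. AE x in mG. u t x \<omega> = f x + l * W t x \<omega>"
  shows "\<exists>g. square_integrable mG g \<and> (AE x in mG. f x = g x)"
proof -
  have "AE \<omega> in M. L2_norm_sq mG (\<lambda>x. Z t x \<omega>) \<noteq> \<infinity>"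
    if "random_field M mG Z" "mean_sq Z t < \<infinity>" for Z
    using that random_field_L2_measurable(2)[OF that(1) t] unfolding expected_L2_norm_sq_def
    by (intro nn_integral_PInf_AE) auto
  from this[OF u] this[OF W] eq AE_space[of M]
  have "AE \<omega> in M. \<omega> \<in> space M \<and> L2_norm_sq mG (\<lambda>x. u t x \<omega>) \<noteq> \<infinity> \<and> L2_norm_sq mG (\<lambda>x. W t x \<omega>) \<noteq> \<infinity>
      \<and> (AE x in mG. u t x \<omega> = f x + l * W t x \<omega>)" by eventually_elim simp
  from eventually_happens[OF this] ae_filter_bot
  obtain \<omega> where \<omega>: "\<omega> \<in> space M" "L2_norm_sq mG (\<lambda>x. u t x \<omega>) \<noteq> \<infinity>" "L2_norm_sq mG (\<lambda>x. W t x \<omega>) \<noteq> \<infinity>"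
    "AE x in mG. u t x \<omega> = f x + l * W t x \<omega>" by auto
  have "square_integrable mG (\<lambda>x. u t x \<omega>)" "square_integrable mG (\<lambda>x. W t x \<omega>)"
    using \<omega> random_field_measurable(4)[OF u(1) t \<omega>(1)] random_field_measurable(4)[OF W(1) t \<omega>(1)]
    by (auto simp: square_integrable_iff_L2_norm_sq less_top)
  then have "square_integrable mG (\<lambda>x. u t x \<omega> - l * W t x \<omega>)"
    by (intro square_integrable_diff square_integrable_cmult)
  moreover have "AE x in mG. f x = u t x \<omega> - l * W t x \<omega>" using \<omega>(4) by eventually_elim simp
  ultimately show ?thesis by blast
qed

end

theorem proposition2p3:
  fixes mG :: "'g::{topological_ab_group_add, t2_space} measure"
    and mD :: "'g character measure"
    and N :: "'x measure" and X :: "real \<Rightarrow> 'x \<Rightarrow> 'g"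
    and \<Psi> :: "'g character \<Rightarrow> complex"
    and \<L> :: "(('g \<Rightarrow> real) \<times> ('g \<Rightarrow> real)) set"
    and M :: "'w measure" and \<xi> :: "(real \<times> 'g) set \<Rightarrow> 'w \<Rightarrow> real"
    and \<sigma> :: "real \<Rightarrow> real" and u0 :: "'g \<Rightarrow> real"
    and u :: "real \<Rightarrow> real \<Rightarrow> 'g \<Rightarrow> 'w \<Rightarrow> real"
  assumes "compact (UNIV :: 'g set)"
    and "haar_measure mG" and "emeasure mG UNIV = 1" and "dual_haar_measure mG mD"
    and "levy_process N X" and "\<L> = L2_generator mG (levy_semigroup N X)"
    and "characteristic_exponent N X \<Psi>" and "dalang_condition mD \<Psi>"
    and "white_noise M mG \<xi>"
    and "\<exists>C. C-lipschitz_on UNIV \<sigma>"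
    and "square_integrable mG u0"
    and "\<And>l. l > 0 \<Longrightarrow>
           mild_solution M mG \<xi> (levy_semigroup N X) (transition_density mD \<Psi>) \<sigma> l u0 (u l) \<and>
           exponentially_bounded_field M mG (u l)"
  shows "((\<exists>C. AE z in lborel. \<bar>\<sigma> z\<bar> \<le> C) \<longrightarrow>
           (\<forall>t>0. Limsup at_top (\<lambda>l::real. energy M mG (u l) t / ennreal l) < \<infinity>)) \<and>
         ((\<exists>C. AE z in lborel. \<bar>\<sigma> z\<bar> \<le> C) \<and> (INF x. \<bar>u0 x\<bar>) > 0 \<and> (INF z. \<bar>\<sigma> z\<bar>) > 0 \<longrightarrow>
           (\<forall>t>0. Liminf at_top (\<lambda>l::real. energy M mG (u l) t / ennreal l) > 0))"
proof -
  have sets_mG: "sets mG = sets borel" using assms(2) by (simp add: haar_measure_def)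
  from sets_eq_imp_space_eq[OF this] have space_mG: "space mG = UNIV" by simp
  have "prob_space mG" by (rule prob_spaceI) (simp add: space_mG assms(3))
  then interpret G: compact_group_measure mG
    by (intro compact_group_measure.intro compact_group_measure_axioms.intro assms(2))
  interpret levy_kernel mG mD N X \<Psi>
    by unfold_locales (fact assms)+
  interpret M: white_noise_space M mG \<xi>
  proof -
    interpret prob_space M using assms(9) by (simp add: white_noise_def)
    show "white_noise_space M mG \<xi>" by unfold_locales (fact assms)
  qed
  interpret S: stochastic_convolution_space M mG \<xi> p
    by unfold_locales (use sets_mG haar_measure_nn_integral_translate[OF assms(2)] density_measurable in auto)
  have one: "emeasure mG UNIV = 1" "emeasure mG (space mG) = 1" using assms(3) space_mG by auto
  \<comment> \<open>The constants depend on \<open>t\<close> but not on the level \<open>l\<close>; they turn the two limits into elementary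
    inequalities. The term \<open>a\<close> bounds the contribution of the deterministic part.\<close>
  have main: "\<exists>a b c. 0 \<le> a \<and> 0 \<le> b \<and>
      (\<forall>l>0. expected_L2_norm_sq M mG (u l) t \<le> ennreal (a + b * l\<^sup>2)) \<and>
      ((INF z. \<bar>\<sigma> z\<bar>) > 0 \<longrightarrow> 0 < c \<and> (\<forall>l>0. ennreal (c * l\<^sup>2) \<le> expected_L2_norm_sq M mG (u l) t + ennreal a))"
    if t: "t > 0" and bnd: "\<exists>C. AE z in lborel. \<bar>\<sigma> z\<bar> \<le> C" for t
  proof -
    have t0: "t \<ge> 0" using t by simp
    obtain C where C: "\<And>z. \<bar>\<sigma> z\<bar> \<le> C" using bnd assms(10) lipschitz_AE_bounded by metis
    define mild where "mild l W \<beta> \<longleftrightarrow> \<beta> > 0 \<and> stochastic_convolution M mG \<xi> \<beta> p (\<lambda>t x \<omega>. \<sigma> (u l t x \<omega>)) W \<and>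
        random_field M mG (u l) \<and>
        (AE \<omega> in M. AE x in mG. u l t x \<omega> = levy_semigroup N X t u0 x + l * W t x \<omega>)" for l W and \<beta> :: real
    have "\<exists>W \<beta>. mild l W \<beta>" if l: "l > 0" for l
    proof -
      have "mild_solution M mG \<xi> (levy_semigroup N X) p \<sigma> l u0 (u l)" using assms(12)[OF l] ..
      then obtain \<beta> W where "\<beta> > 0" "u l \<in> predictable_fields M mG \<xi> \<beta>"
        "stochastic_convolution M mG \<xi> \<beta> p (\<lambda>t x \<omega>. \<sigma> (u l t x \<omega>)) W"
        "\<forall>t>0. AE \<omega> in M. AE x in mG. u l t x \<omega> = levy_semigroup N X t u0 x + l * W t x \<omega>"
        unfolding mild_solution_def by (elim conjE exE) blast
      then show ?thesis using t by (intro exI[of _ W] exI[of _ \<beta>]) (simp add: predictable_fields_def mild_def)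
    qed
    then obtain W \<beta> where mild: "\<And>l. l > 0 \<Longrightarrow> mild l (W l) (\<beta> l)" by metis
    have W: "\<And>l. l > 0 \<Longrightarrow> \<beta> l > 0"
      "\<And>l. l > 0 \<Longrightarrow> stochastic_convolution M mG \<xi> (\<beta> l) p (\<lambda>t x \<omega>. \<sigma> (u l t x \<omega>)) (W l)"
      "\<And>l. l > 0 \<Longrightarrow> random_field M mG (u l)"
      "\<And>l. l > 0 \<Longrightarrow> AE \<omega> in M. AE x in mG. u l t x \<omega> = levy_semigroup N X t u0 x + l * W l t x \<omega>"
      using mild unfolding mild_def by blast+
    have rW: "random_field M mG (W l)" if "l > 0" for l
      using W(2)[OF that] by (simp add: stochastic_convolution_def)
    have mass_fin: "S.kernel_mass t < \<infinity>"
      using W(1,2)[of 1] by (intro S.kernel_mass_finite[OF one(1)]) (auto simp: stochastic_convolution_def)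
    have "1 * ennreal t \<le> S.kernel_mass t"
      by (rule S.kernel_mass_ge[OF one(1) density_L2_ge_1 t0])
    then obtain j where j: "S.kernel_mass t = ennreal j" "j \<ge> t"
      using mass_fin t by (cases "S.kernel_mass t") auto
    note energy = S.stochastic_convolution_energy[OF W(2) t0 less_imp_le[OF W(1)] mass_fin]
    have W_le: "expected_L2_norm_sq M mG (W l) t \<le> ennreal (4 * C\<^sup>2 * j)" if l: "l > 0" for l
    proof -
      have "S.convolution_energy t (\<lambda>t x \<omega>. \<sigma> (u l t x \<omega>)) \<le> ennreal (C\<^sup>2) * S.kernel_mass t"
        by (intro S.convolution_energy_le_mass M.expected_L2_norm_sq_le C one)
      from mult_left_mono[OF this, of 4] energy(1)[OF l l] show ?thesis
        using j t by (simp add: ennreal_mult mult.assoc)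
    qed
    \<comment> \<open>Level \<open>1\<close> serves to show that the deterministic part is square integrable.\<close>
    have "expected_L2_norm_sq M mG (u 1) t < \<infinity>"
    proof -
      obtain c1 c2 where "expected_L2_norm_sq M mG (u 1) t \<le> ennreal (c1 * exp (c2 * t))"
        using assms(12)[of 1] t0 unfolding exponentially_bounded_field_def by auto
      then show ?thesis using le_less_trans ennreal_less_top by (metis infinity_ennreal_def)
    qed
    moreover have "expected_L2_norm_sq M mG (W 1) t < \<infinity>"
      using W_le[of 1] le_less_trans ennreal_less_top by (metis infinity_ennreal_def zero_less_one)
    ultimately obtain g where g: "square_integrable mG g" "AE x in mG. levy_semigroup N X t u0 x = g x"
      using M.deterministic_part_square_integrable[OF W(3) _ rW _ t0 W(4), of 1] by auto
    obtain a where a: "L2_norm_sq mG g = ennreal a" "a \<ge> 0"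
      using g(1) by (cases "L2_norm_sq mG g") (auto simp: square_integrable_iff_L2_norm_sq)
    have eq: "AE \<omega> in M. AE x in mG. u l t x \<omega> = g x + l * W l t x \<omega>" if "l > 0" for l
      using W(4)[OF that]
    proof eventually_elim
      case (elim \<omega>)
      with g(2) show ?case by eventually_elim simp
    qed
    note affine = M.expected_L2_norm_sq_affine[OF W(3) rW square_integrable_measurable[OF g(1)] t0 eq]
    have upper: "expected_L2_norm_sq M mG (u l) t \<le> ennreal (8 * a + 8 * C\<^sup>2 * j * l\<^sup>2)" if l: "l > 0" for l
    proof -
      have "expected_L2_norm_sq M mG (u l) t \<le> 2 * ennreal a + 2 * (ennreal (l\<^sup>2) * ennreal (4 * C\<^sup>2 * j))"
        using affine(1)[OF l l l] mult_left_mono[OF mult_left_mono[OF W_le[OF l], of "ennreal (l\<^sup>2)"], of 2]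
        unfolding a(1) by (meson add_left_mono order_trans zero_le)
      also have "\<dots> = ennreal (2 * a + 2 * (l\<^sup>2 * (4 * C\<^sup>2 * j)))"
      proof -
        have "2 * ennreal r + 2 * (ennreal x * ennreal y) = ennreal (2 * r + 2 * (x * y))"
          if "0 \<le> r" "0 \<le> x" "0 \<le> y" for r x y using that by (simp add: ennreal_mult ennreal_plus)
        from this[of a "l\<^sup>2" "4 * C\<^sup>2 * j"] show ?thesis using a(2) j t by simp
      qed
      also have "\<dots> \<le> ennreal (8 * a + 8 * C\<^sup>2 * j * l\<^sup>2)"
        using a(2) by (intro ennreal_leI) (simp add: mult_ac)
      finally show ?thesis .
    qed
    define m where "m = (INF z. \<bar>\<sigma> z\<bar>)"
    have lower: "ennreal (m\<^sup>2 * j / 8 * l\<^sup>2) \<le> expected_L2_norm_sq M mG (u l) t + ennreal (8 * a)" if l: "l > 0" and m: "m > 0" for l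
    proof -
      have "m \<le> \<bar>\<sigma> z\<bar>" for z unfolding m_def by (rule cINF_lower) (auto intro: bdd_belowI[of _ 0])
      then have "ennreal (m\<^sup>2) * S.kernel_mass t \<le> S.convolution_energy t (\<lambda>t x \<omega>. \<sigma> (u l t x \<omega>))"
        using m by (intro S.convolution_energy_ge_mass M.expected_L2_norm_sq_ge one) auto
      also have "\<dots> \<le> 4 * expected_L2_norm_sq M mG (W l) t" by (rule energy(2)[OF l l])
      finally have "ennreal (l\<^sup>2) * (ennreal (m\<^sup>2) * ennreal j) \<le> ennreal (l\<^sup>2) * (4 * expected_L2_norm_sq M mG (W l) t)"
        unfolding j(1) by (rule mult_left_mono) simp
      also have "\<dots> = 4 * (ennreal (l\<^sup>2) * expected_L2_norm_sq M mG (W l) t)" by (simp add: mult_ac)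
      also have "\<dots> \<le> 4 * (2 * expected_L2_norm_sq M mG (u l) t + 2 * ennreal a)"
        using affine(2)[OF l l l] unfolding a(1) by (rule mult_left_mono) simp
      finally have *: "ennreal (l\<^sup>2 * (m\<^sup>2 * j)) \<le> 8 * expected_L2_norm_sq M mG (u l) t + 8 * ennreal a"
        using j t by (simp add: ennreal_mult distrib_left mult.assoc[symmetric])
      show ?thesis
      proof (cases "expected_L2_norm_sq M mG (u l) t")
        case (real e)
        then have "ennreal (l\<^sup>2 * (m\<^sup>2 * j)) \<le> ennreal (8 * e + 8 * a)"
          using * a(2) by (simp add: ennreal_mult ennreal_plus)
        then have "l\<^sup>2 * (m\<^sup>2 * j) \<le> 8 * e + 8 * a" using real a(2) by (simp add: ennreal_le_iff del: ennreal_plus)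
        then have "m\<^sup>2 * j / 8 * l\<^sup>2 \<le> e + 8 * a" using a(2) by (simp add: field_simps)
        then have "ennreal (m\<^sup>2 * j / 8 * l\<^sup>2) \<le> ennreal (e + 8 * a)" by (rule ennreal_leI)
        then show ?thesis using real a(2) by (simp add: ennreal_plus)
      qed simp
    qed
    have "0 \<le> 8 * C\<^sup>2 * j" "m > 0 \<Longrightarrow> 0 < m\<^sup>2 * j / 8" using j t by auto
    with upper lower a(2) show ?thesis
      unfolding m_def[symmetric]
      by (intro exI[of _ "8 * a"] exI[of _ "8 * C\<^sup>2 * j"] exI[of _ "m\<^sup>2 * j / 8"]) auto
  qed
  show ?thesis
  proof (intro conjI impI allI)
    fix t :: real assume bnd: "\<exists>C. AE z in lborel. \<bar>\<sigma> z\<bar> \<le> C" and t: "t > 0"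
    from main[OF t bnd] obtain a b where ab: "0 \<le> a" "0 \<le> b"
      "\<And>l. l > 0 \<Longrightarrow> expected_L2_norm_sq M mG (u l) t \<le> ennreal (a + b * l\<^sup>2)" by blast
    have "Limsup at_top (\<lambda>l. energy M mG (u l) t / ennreal l) \<le> ennreal (sqrt (a + b))"
    proof (rule Limsup_bounded, use eventually_ge_at_top[of "1 :: real"] in eventually_elim)
      case (elim l)
      then have "a * 1 \<le> a * l\<^sup>2" using ab(1) by (intro mult_left_mono) auto
      then have "ennreal (a + b * l\<^sup>2) \<le> ennreal ((a + b) * l\<^sup>2)"
        by (intro ennreal_leI) (simp add: distrib_right)
      with ab(3)[of l] elim have "expected_L2_norm_sq M mG (u l) t \<le> ennreal ((a + b) * l\<^sup>2)"
        by (auto intro: order_trans)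
      then show "energy M mG (u l) t / ennreal l \<le> ennreal (sqrt (a + b))"
        unfolding energy_def using ab elim by (intro esqrt_over_le) auto
    qed
    then show "Limsup at_top (\<lambda>l. energy M mG (u l) t / ennreal l) < \<infinity>"
      using le_less_trans ennreal_less_top by (metis infinity_ennreal_def)
  next
    fix t :: real
    assume *: "(\<exists>C. AE z in lborel. \<bar>\<sigma> z\<bar> \<le> C) \<and> (INF x. \<bar>u0 x\<bar>) > 0 \<and> (INF z. \<bar>\<sigma> z\<bar>) > 0" and t: "t > 0"
    then obtain a c where ac: "0 \<le> a" "0 < c"
      "\<And>l. l > 0 \<Longrightarrow> ennreal (c * l\<^sup>2) \<le> expected_L2_norm_sq M mG (u l) t + ennreal a" using main[OF t] by blast
    have "ennreal (sqrt (c / 2)) \<le> Liminf at_top (\<lambda>l. energy M mG (u l) t / ennreal l)"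
    \<comment> \<open>From \<open>l \<ge> 2 a / c\<close> on, the deterministic part uses up at most half of \<open>c l\<^sup>2\<close>.\<close>
    proof (rule Liminf_bounded, use eventually_ge_at_top[of "max 1 (2 * a / c)"] in eventually_elim)
      case (elim l)
      then have l: "l \<ge> 1" "2 * a / c \<le> l" by auto
      then have "2 * a / c \<le> l\<^sup>2" using self_le_power[of l 2] by linarith
      then have a: "a \<le> c / 2 * l\<^sup>2" using ac(2) by (simp add: field_simps)
      have "ennreal (c / 2 * l\<^sup>2) \<le> expected_L2_norm_sq M mG (u l) t"
      proof (cases "expected_L2_norm_sq M mG (u l) t")
        case (real e)
        then have "ennreal (c * l\<^sup>2) \<le> ennreal (e + a)" using ac(1) ac(3)[of l] l by (simp add: ennreal_plus)
        then have "c * l\<^sup>2 \<le> e + a" using real ac(1) by (simp add: ennreal_le_iff del: ennreal_plus)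
        then have "c / 2 * l\<^sup>2 \<le> e" using a by (simp add: field_simps)
        then show ?thesis using real by (simp add: ennreal_leI)
      qed simp
      then show "ennreal (sqrt (c / 2)) \<le> energy M mG (u l) t / ennreal l"
        unfolding energy_def using ac l by (intro esqrt_over_ge) auto
    qed
    moreover have "0 < ennreal (sqrt (c / 2))" using ac(2) by simp
    ultimately show "Liminf at_top (\<lambda>l. energy M mG (u l) t / ennreal l) > 0" by (rule less_le_trans[rotated])
  qed
qed

end
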